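(* Let $P : \mathcal{E}\to\mathcal{B}$ be a lax functor between measurable bicategories having Euler characteristics, which is both fibered in pseudogroupoids and cofibered in pseudogroupoids, and suppose $\mathcal{B}$ is connected. Let $\mathcal{F} = P^{-1}(b)$ be the fiber bicategory over an object $b$ of $\mathcal{B}$ (all fibers are biequivalent), assumed measurable. Then $\mathcal{F}$ has Euler characteristic and \[ \chi(\mathcal{E}) = \chi(\mathcal{B})\,\chi(\mathcal{F}). \]
   Context: Euler characteristic: for $\zeta : I\times J\to\mathbb{Q}$ ($I,J$ finite), a weighting is $k^\bullet$ with $\sum_j\zeta(i,j)k^j=1$ for all $i$, a coweighting is $k_\bullet$ with $\sum_i k_i\zeta(i,j)=1$ for all $j$; $\zeta$ has Euler characteristic if both exist, and $|\zeta|=\sum_jk^j=\sum_ik_i$. A finite category $C$ has $\chi(C)=|\zeta_C|$, $\zeta_C(x,y)=\#C(x,y)$. A bicategory $\mathcal{A}$ is measurable if $\mathrm{ob}(\mathcal{A})$ is finite and each $\mathcal{A}(x,y)$ is equivalent to a finite category $C$ with Euler characteristic; $\chi(\mathcal{A}(x,y)):=\chi(C)$, $\zeta_{\mathcal{A}}(x,y):=\chi(\mathcal{A}(x,y))$, $\chi(\mathcal{A}):=|\zeta_{\mathcal{A}}|$ when it exists. For a lax functor $P$ with structure 2-cells $\varphi_{g,f}: Pg\circ Pf\Rightarrow P(g\circ f)$, a 1-morphism $f : x\to y$ in $\mathcal{E}$ is cartesian if (i) for every $g: z\to y$, $h : Pz\to Px$ and invertible $\alpha : Pf\circ h\Rightarrow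 Pg$ there exist $\tilde h: z\to x$ and invertible $\tilde\alpha : f\circ\tilde h\Rightarrow g$, $\tilde\beta : P\tilde h\Rightarrow h$ with $\alpha\cdot(Pf*\tilde\beta)=P\tilde\alpha\cdot\varphi_{f,\tilde h}$; (ii) for every $\sigma : g\Rightarrow g'$, such lifts $(\tilde h,\tilde\alpha,\tilde\beta)$, $(\tilde h',\tilde\alpha',\tilde\beta')$ of $(h,\alpha)$, $(h',\alpha')$, and every $\delta : h\Rightarrow h'$ with $\alpha'\cdot(Pf*\delta)=P\sigma\cdot\alpha$, there is a unique $\tilde\delta:\tilde h\Rightarrow\tilde h'$ with $\tilde\alpha'\cdot(f*\tilde\delta)=\sigma\cdot\tilde\alpha$ and $\tilde\beta'\cdot P\tilde\delta=\delta\cdot\tilde\beta$. $P$ is fibered in pseudogroupoids if every 1-morphism of $\mathcal{E}$ is cartesian, every 1-morphism $f : b\to P(e)$ of $\mathcal{B}$ has a lift $\tilde f : e'\to e$ with $P\tilde f=f$, and each functor $P:\mathcal{E}(x,y)\to\mathcal{B}(Px,Py)$ is fibered in groupoids; cofibered in pseudogroupoids is the dual (directions of 1- and 2-morphisms reversed). The fiber bicategory $P^{-1}(b)$ has objects $e$ with $Pe=b$, 1-morphisms $h$ of $\mathcal{E}$ with $Ph=\mathrm{id}_b$, 2-morphisms $\alpha$ of $\mathcal{E}$ with $P\alpha=\mathrm{id}_{\mathrm{id}_b}$, vertical composition from $\mathcal{E}$, and composition of 1-morphisms and remaining structure induced by chosen cartesian lifts (the composite $g\hat\circ f$ is the domain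 of the chosen cartesian lift at $g\circ f$ of $\mathrm{id}_b\Rightarrow Pg\circ Pf\Rightarrow P(g\circ f)$). A bicategory is connected if any two objects are joined by a finite zigzag of 1-morphisms. *)

theory Defs
  imports Complex_Main
begin

record ('o,'m) cat =
  cobj :: "'o set"
  cmor :: "'m set"
  cdom :: "'m \<Rightarrow> 'o"
  ccod :: "'m \<Rightarrow> 'o"
  cid  :: "'o \<Rightarrow> 'm"
  ccomp :: "'m \<Rightarrow> 'm \<Rightarrow> 'm"   (* ccomp C g f = g after f *)

definition category :: "('o,'m) cat \<Rightarrow> bool" where
  "category C \<longleftrightarrow>
     (\<forall>m\<in>cmor C. cdom C m \<in> cobj C \<and> ccod C m \<in> cobj C) \<and>
     (\<forall>x\<in>cobj C. cid C x \<in> cmor C \<and> cdom C (cid C x) = x \<and> ccod C (cid C x) = x) \<and>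
     (\<forall>f\<in>cmor C. \<forall>g\<in>cmor C. ccod C f = cdom C g \<longrightarrow>
        ccomp C g f \<in> cmor C \<and> cdom C (ccomp C g f) = cdom C f \<and> ccod C (ccomp C g f) = ccod C g) \<and>
     (\<forall>f\<in>cmor C. ccomp C (cid C (ccod C f)) f = f \<and> ccomp C f (cid C (cdom C f)) = f) \<and>
     (\<forall>f\<in>cmor C. \<forall>g\<in>cmor C. \<forall>h\<in>cmor C. ccod C f = cdom C g \<and> ccod C g = cdom C h \<longrightarrow>
        ccomp C h (ccomp C g f) = ccomp C (ccomp C h g) f)"

definition op_cat :: "('o,'m) cat \<Rightarrow> ('o,'m) cat" where
  "op_cat C = C\<lparr>cdom := ccod C, ccod := cdom C, ccomp := (\<lambda>g f. ccomp C f g)\<rparr>"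

definition cat_iso :: "('o,'m) cat \<Rightarrow> 'm \<Rightarrow> bool" where
  "cat_iso C f \<longleftrightarrow> f \<in> cmor C \<and> (\<exists>g\<in>cmor C. cdom C g = ccod C f \<and> ccod C g = cdom C f \<and>
      ccomp C g f = cid C (cdom C f) \<and> ccomp C f g = cid C (ccod C f))"

definition cat_functor :: "('o1,'m1) cat \<Rightarrow> ('o2,'m2) cat \<Rightarrow> ('o1 \<Rightarrow> 'o2) \<Rightarrow> ('m1 \<Rightarrow> 'm2) \<Rightarrow> bool" where
  "cat_functor C D Fo Fm \<longleftrightarrow>
     (\<forall>x\<in>cobj C. Fo x \<in> cobj D) \<and>
     (\<forall>f\<in>cmor C. Fm f \<in> cmor D \<and> cdom D (Fm f) = Fo (cdom C f) \<and> ccod D (Fm f) = Fo (ccod C f)) \<and>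
     (\<forall>x\<in>cobj C. Fm (cid C x) = cid D (Fo x)) \<and>
     (\<forall>f\<in>cmor C. \<forall>g\<in>cmor C. ccod C f = cdom C g \<longrightarrow> Fm (ccomp C g f) = ccomp D (Fm g) (Fm f))"

definition cat_equiv :: "('o1,'m1) cat \<Rightarrow> ('o2,'m2) cat \<Rightarrow> bool" where
  "cat_equiv C D \<longleftrightarrow> (\<exists>Fo Fm. cat_functor C D Fo Fm \<and>
     (\<forall>x\<in>cobj C. \<forall>y\<in>cobj C. \<forall>g\<in>cmor D. cdom D g = Fo x \<and> ccod D g = Fo y \<longrightarrow>
         (\<exists>f\<in>cmor C. cdom C f = x \<and> ccod C f = y \<and> Fm f = g)) \<and>
     (\<forall>f\<in>cmor C. \<forall>f'\<in>cmor C. cdom C f = cdom C f' \<and> ccod C f = ccod C f' \<and> Fm f = Fm f' \<longrightarrow> f = f') \<and>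
     (\<forall>d\<in>cobj D. \<exists>x\<in>cobj C. \<exists>g\<in>cmor D. cdom D g = Fo x \<and> ccod D g = d \<and> cat_iso D g))"

text \<open>A functor fibered in groupoids (Stacks project convention).\<close>
definition cat_fibered_groupoids :: "('o1,'m1) cat \<Rightarrow> ('o2,'m2) cat \<Rightarrow> ('o1 \<Rightarrow> 'o2) \<Rightarrow> ('m1 \<Rightarrow> 'm2) \<Rightarrow> bool" where
  "cat_fibered_groupoids C D Fo Fm \<longleftrightarrow>
     (\<forall>\<phi>\<in>cmor D. \<forall>e\<in>cobj C. ccod D \<phi> = Fo e \<longrightarrow> (\<exists>\<psi>\<in>cmor C. ccod C \<psi> = e \<and> Fm \<psi> = \<phi>)) \<and>
     (\<forall>\<psi>\<in>cmor C. \<forall>\<phi>\<in>cmor C. \<forall>\<chi>\<in>cmor D.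
        ccod C \<psi> = ccod C \<phi> \<and> cdom D \<chi> = Fo (cdom C \<phi>) \<and> ccod D \<chi> = Fo (cdom C \<psi>) \<and>
        ccomp D (Fm \<psi>) \<chi> = Fm \<phi> \<longrightarrow>
        (\<exists>!\<mu>. \<mu> \<in> cmor C \<and> cdom C \<mu> = cdom C \<phi> \<and> ccod C \<mu> = cdom C \<psi> \<and>
              ccomp C \<psi> \<mu> = \<phi> \<and> Fm \<mu> = \<chi>))"

definition weighting :: "'i set \<Rightarrow> 'j set \<Rightarrow> ('i \<Rightarrow> 'j \<Rightarrow> rat) \<Rightarrow> ('j \<Rightarrow> rat) \<Rightarrow> bool" where
  "weighting I J \<zeta> k \<longleftrightarrow> (\<forall>i\<in>I. (\<Sum>j\<in>J. \<zeta> i j * k j) = 1)"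

definition coweighting :: "'i set \<Rightarrow> 'j set \<Rightarrow> ('i \<Rightarrow> 'j \<Rightarrow> rat) \<Rightarrow> ('i \<Rightarrow> rat) \<Rightarrow> bool" where
  "coweighting I J \<zeta> k \<longleftrightarrow> (\<forall>j\<in>J. (\<Sum>i\<in>I. k i * \<zeta> i j) = 1)"

definition has_euler :: "'i set \<Rightarrow> 'j set \<Rightarrow> ('i \<Rightarrow> 'j \<Rightarrow> rat) \<Rightarrow> bool" where
  "has_euler I J \<zeta> \<longleftrightarrow> finite I \<and> finite J \<and> (\<exists>k. weighting I J \<zeta> k) \<and> (\<exists>k. coweighting I J \<zeta> k)"

definition magnitude :: "'i set \<Rightarrow> 'j set \<Rightarrow> ('i \<Rightarrow> 'j \<Rightarrow> rat) \<Rightarrow> rat" where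
  "magnitude I J \<zeta> = (\<Sum>j\<in>J. (SOME k. weighting I J \<zeta> k) j)"

definition zeta_cat :: "('o,'m) cat \<Rightarrow> 'o \<Rightarrow> 'o \<Rightarrow> rat" where
  "zeta_cat C x y = of_nat (card {m\<in>cmor C. cdom C m = x \<and> ccod C m = y})"

definition fin_cat_euler :: "('o,'m) cat \<Rightarrow> bool" where
  "fin_cat_euler C \<longleftrightarrow> category C \<and> finite (cobj C) \<and> finite (cmor C) \<and>
      has_euler (cobj C) (cobj C) (zeta_cat C)"

definition chi_cat :: "('o,'m) cat \<Rightarrow> rat" where
  "chi_cat C = magnitude (cobj C) (cobj C) (zeta_cat C)"

text \<open>Every finite category is isomorphic to one whose objects and morphisms are natural
  numbers, so quantifying over such categories is no loss of generality.\<close>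

definition measurable_data :: "'o set \<Rightarrow> ('o \<Rightarrow> 'o \<Rightarrow> ('a,'c) cat) \<Rightarrow> bool" where
  "measurable_data Ob H \<longleftrightarrow> finite Ob \<and>
     (\<forall>x\<in>Ob. \<forall>y\<in>Ob. \<exists>C :: (nat,nat) cat. fin_cat_euler C \<and> cat_equiv (H x y) C)"

definition chi_hom :: "('o \<Rightarrow> 'o \<Rightarrow> ('a,'c) cat) \<Rightarrow> 'o \<Rightarrow> 'o \<Rightarrow> rat" where
  "chi_hom H x y = chi_cat (SOME C :: (nat,nat) cat. fin_cat_euler C \<and> cat_equiv (H x y) C)"

definition has_euler_data :: "'o set \<Rightarrow> ('o \<Rightarrow> 'o \<Rightarrow> ('a,'c) cat) \<Rightarrow> bool" where
  "has_euler_data Ob H \<longleftrightarrow> measurable_data Ob H \<and> has_euler Ob Ob (chi_hom H)"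

definition chi_data :: "'o set \<Rightarrow> ('o \<Rightarrow> 'o \<Rightarrow> ('a,'c) cat) \<Rightarrow> rat" where
  "chi_data Ob H = magnitude Ob Ob (chi_hom H)"

record ('o,'a,'c) bicat =
  bobj :: "'o set"
  barr :: "'a set"
  bsrc :: "'a \<Rightarrow> 'o"
  btrg :: "'a \<Rightarrow> 'o"
  bcell :: "'c set"
  bdom :: "'c \<Rightarrow> 'a"
  bcod :: "'c \<Rightarrow> 'a"
  bid1 :: "'o \<Rightarrow> 'a"
  bcomp :: "'a \<Rightarrow> 'a \<Rightarrow> 'a"          (* bcomp B g f = g \<circ> f *)
  bid2 :: "'a \<Rightarrow> 'c"
  bvcomp :: "'c \<Rightarrow> 'c \<Rightarrow> 'c"         (* bvcomp B \<beta> \<alpha> = \<beta> \<cdot> \<alpha> *)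
  bhcomp :: "'c \<Rightarrow> 'c \<Rightarrow> 'c"         (* bhcomp B \<beta> \<alpha> = \<beta> * \<alpha> : g\<circ>f \<Rightarrow> g'\<circ>f' *)
  bassoc :: "'a \<Rightarrow> 'a \<Rightarrow> 'a \<Rightarrow> 'c"   (* bassoc B h g f : (h\<circ>g)\<circ>f \<Rightarrow> h\<circ>(g\<circ>f) *)
  blunit :: "'a \<Rightarrow> 'c"               (* id\<circ>f \<Rightarrow> f *)
  brunit :: "'a \<Rightarrow> 'c"               (* f\<circ>id \<Rightarrow> f *)

definition Hom2 :: "('o,'a,'c) bicat \<Rightarrow> 'a \<Rightarrow> 'a \<Rightarrow> 'c set" where
  "Hom2 B f g = {\<alpha>\<in>bcell B. bdom B \<alpha> = f \<and> bcod B \<alpha> = g}"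

definition iso2 :: "('o,'a,'c) bicat \<Rightarrow> 'c \<Rightarrow> bool" where
  "iso2 B \<alpha> \<longleftrightarrow> \<alpha> \<in> bcell B \<and> (\<exists>\<beta>\<in>bcell B. bdom B \<beta> = bcod B \<alpha> \<and> bcod B \<beta> = bdom B \<alpha> \<and>
      bvcomp B \<beta> \<alpha> = bid2 B (bdom B \<alpha>) \<and> bvcomp B \<alpha> \<beta> = bid2 B (bcod B \<alpha>))"

definition bicategory :: "('o,'a,'c) bicat \<Rightarrow> bool" where
  "bicategory B \<longleftrightarrow>
   (\<forall>f\<in>barr B. bsrc B f \<in> bobj B \<and> btrg B f \<in> bobj B) \<and>
   (\<forall>x\<in>bobj B. bid1 B x \<in> barr B \<and> bsrc B (bid1 B x) = x \<and> btrg B (bid1 B x) = x) \<and>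
   (\<forall>f\<in>barr B. \<forall>g\<in>barr B. btrg B f = bsrc B g \<longrightarrow>
      bcomp B g f \<in> barr B \<and> bsrc B (bcomp B g f) = bsrc B f \<and> btrg B (bcomp B g f) = btrg B g) \<and>
   (\<forall>\<alpha>\<in>bcell B. bdom B \<alpha> \<in> barr B \<and> bcod B \<alpha> \<in> barr B \<and>
      bsrc B (bdom B \<alpha>) = bsrc B (bcod B \<alpha>) \<and> btrg B (bdom B \<alpha>) = btrg B (bcod B \<alpha>)) \<and>
   (\<forall>f\<in>barr B. bid2 B f \<in> Hom2 B f f) \<and>
   (\<forall>\<alpha>\<in>bcell B. \<forall>\<beta>\<in>bcell B. bcod B \<alpha> = bdom B \<beta> \<longrightarrow>
      bvcomp B \<beta> \<alpha> \<in> Hom2 B (bdom B \<alpha>) (bcod B \<beta>)) \<and>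
   (\<forall>\<alpha>\<in>bcell B. bvcomp B (bid2 B (bcod B \<alpha>)) \<alpha> = \<alpha> \<and> bvcomp B \<alpha> (bid2 B (bdom B \<alpha>)) = \<alpha>) \<and>
   (\<forall>\<alpha>\<in>bcell B. \<forall>\<beta>\<in>bcell B. \<forall>\<gamma>\<in>bcell B. bcod B \<alpha> = bdom B \<beta> \<and> bcod B \<beta> = bdom B \<gamma> \<longrightarrow>
      bvcomp B \<gamma> (bvcomp B \<beta> \<alpha>) = bvcomp B (bvcomp B \<gamma> \<beta>) \<alpha>) \<and>
   (\<forall>\<alpha>\<in>bcell B. \<forall>\<beta>\<in>bcell B. btrg B (bdom B \<alpha>) = bsrc B (bdom B \<beta>) \<longrightarrow>
      bhcomp B \<beta> \<alpha> \<in> Hom2 B (bcomp B (bdom B \<beta>) (bdom B \<alpha>)) (bcomp B (bcod B \<beta>) (bcod B \<alpha>))) \<and>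
   (\<forall>f\<in>barr B. \<forall>g\<in>barr B. btrg B f = bsrc B g \<longrightarrow>
      bhcomp B (bid2 B g) (bid2 B f) = bid2 B (bcomp B g f)) \<and>
   (\<forall>\<alpha>\<in>bcell B. \<forall>\<alpha>'\<in>bcell B. \<forall>\<beta>\<in>bcell B. \<forall>\<beta>'\<in>bcell B.
      bcod B \<alpha> = bdom B \<alpha>' \<and> bcod B \<beta> = bdom B \<beta>' \<and> btrg B (bdom B \<alpha>) = bsrc B (bdom B \<beta>) \<longrightarrow>
      bhcomp B (bvcomp B \<beta>' \<beta>) (bvcomp B \<alpha>' \<alpha>) = bvcomp B (bhcomp B \<beta>' \<alpha>') (bhcomp B \<beta> \<alpha>)) \<and>
   (\<forall>f\<in>barr B. \<forall>g\<in>barr B. \<forall>h\<in>barr B. btrg B f = bsrc B g \<and> btrg B g = bsrc B h \<longrightarrow>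
      bassoc B h g f \<in> Hom2 B (bcomp B (bcomp B h g) f) (bcomp B h (bcomp B g f)) \<and>
      iso2 B (bassoc B h g f)) \<and>
   (\<forall>\<alpha>\<in>bcell B. \<forall>\<beta>\<in>bcell B. \<forall>\<gamma>\<in>bcell B.
      btrg B (bdom B \<alpha>) = bsrc B (bdom B \<beta>) \<and> btrg B (bdom B \<beta>) = bsrc B (bdom B \<gamma>) \<longrightarrow>
      bvcomp B (bassoc B (bcod B \<gamma>) (bcod B \<beta>) (bcod B \<alpha>)) (bhcomp B (bhcomp B \<gamma> \<beta>) \<alpha>) =
      bvcomp B (bhcomp B \<gamma> (bhcomp B \<beta> \<alpha>)) (bassoc B (bdom B \<gamma>) (bdom B \<beta>) (bdom B \<alpha>))) \<and>
   (\<forall>f\<in>barr B. blunit B f \<in> Hom2 B (bcomp B (bid1 B (btrg B f)) f) f \<and> iso2 B (blunit B f) \<and>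
      brunit B f \<in> Hom2 B (bcomp B f (bid1 B (bsrc B f))) f \<and> iso2 B (brunit B f)) \<and>
   (\<forall>\<alpha>\<in>bcell B.
      bvcomp B \<alpha> (blunit B (bdom B \<alpha>)) =
        bvcomp B (blunit B (bcod B \<alpha>)) (bhcomp B (bid2 B (bid1 B (btrg B (bdom B \<alpha>)))) \<alpha>) \<and>
      bvcomp B \<alpha> (brunit B (bdom B \<alpha>)) =
        bvcomp B (brunit B (bcod B \<alpha>)) (bhcomp B \<alpha> (bid2 B (bid1 B (bsrc B (bdom B \<alpha>)))))) \<and>
   (\<forall>f\<in>barr B. \<forall>g\<in>barr B. \<forall>h\<in>barr B. \<forall>k\<in>barr B.
      btrg B f = bsrc B g \<and> btrg B g = bsrc B h \<and> btrg B h = bsrc B k \<longrightarrow>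
      bvcomp B (bassoc B k h (bcomp B g f)) (bassoc B (bcomp B k h) g f) =
      bvcomp B (bhcomp B (bid2 B k) (bassoc B h g f))
        (bvcomp B (bassoc B k (bcomp B h g) f) (bhcomp B (bassoc B k h g) (bid2 B f)))) \<and>
   (\<forall>f\<in>barr B. \<forall>g\<in>barr B. btrg B f = bsrc B g \<longrightarrow>
      bvcomp B (bhcomp B (bid2 B g) (blunit B f)) (bassoc B g (bid1 B (btrg B f)) f) =
      bhcomp B (brunit B g) (bid2 B f))"

definition hom_cat :: "('o,'a,'c) bicat \<Rightarrow> 'o \<Rightarrow> 'o \<Rightarrow> ('a,'c) cat" where
  "hom_cat B x y = \<lparr>cobj = {f\<in>barr B. bsrc B f = x \<and> btrg B f = y},
      cmor = {\<alpha>\<in>bcell B. bsrc B (bdom B \<alpha>) = x \<and> btrg B (bdom B \<alpha>) = y},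
      cdom = bdom B, ccod = bcod B, cid = bid2 B, ccomp = bvcomp B\<rparr>"

definition measurable_bicat :: "('o,'a,'c) bicat \<Rightarrow> bool" where
  "measurable_bicat B \<longleftrightarrow> measurable_data (bobj B) (hom_cat B)"

definition has_euler_bicat :: "('o,'a,'c) bicat \<Rightarrow> bool" where
  "has_euler_bicat B \<longleftrightarrow> has_euler_data (bobj B) (hom_cat B)"

definition chi_bicat :: "('o,'a,'c) bicat \<Rightarrow> rat" where
  "chi_bicat B = chi_data (bobj B) (hom_cat B)"

definition connected_bicat :: "('o,'a,'c) bicat \<Rightarrow> bool" where
  "connected_bicat B \<longleftrightarrow> (\<forall>x\<in>bobj B. \<forall>y\<in>bobj B.
     (\<lambda>u v. \<exists>f\<in>barr B. (bsrc B f = u \<and> btrg B f = v) \<or> (bsrc B f = v \<and> btrg B f = u))\<^sup>*\<^sup>* x y)"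

record ('o1,'a1,'c1,'o2,'a2,'c2) lax_fun =
  lf_obj :: "'o1 \<Rightarrow> 'o2"
  lf_arr :: "'a1 \<Rightarrow> 'a2"
  lf_cell :: "'c1 \<Rightarrow> 'c2"
  lf_cmp :: "'a1 \<Rightarrow> 'a1 \<Rightarrow> 'c2"    (* lf_cmp P g f = \<phi>_{g,f} : Pg\<circ>Pf \<Rightarrow> P(g\<circ>f) *)
  lf_unit :: "'o1 \<Rightarrow> 'c2"          (* id_{Px} \<Rightarrow> P(id_x) *)

definition lax_functor :: "('o1,'a1,'c1) bicat \<Rightarrow> ('o2,'a2,'c2) bicat \<Rightarrow>
    ('o1,'a1,'c1,'o2,'a2,'c2) lax_fun \<Rightarrow> bool" where
  "lax_functor E B P \<longleftrightarrow>
   (\<forall>x\<in>bobj E. lf_obj P x \<in> bobj B) \<and>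
   (\<forall>f\<in>barr E. lf_arr P f \<in> barr B \<and> bsrc B (lf_arr P f) = lf_obj P (bsrc E f) \<and>
      btrg B (lf_arr P f) = lf_obj P (btrg E f)) \<and>
   (\<forall>\<alpha>\<in>bcell E. lf_cell P \<alpha> \<in> Hom2 B (lf_arr P (bdom E \<alpha>)) (lf_arr P (bcod E \<alpha>))) \<and>
   (\<forall>f\<in>barr E. lf_cell P (bid2 E f) = bid2 B (lf_arr P f)) \<and>
   (\<forall>\<alpha>\<in>bcell E. \<forall>\<beta>\<in>bcell E. bcod E \<alpha> = bdom E \<beta> \<longrightarrow>
      lf_cell P (bvcomp E \<beta> \<alpha>) = bvcomp B (lf_cell P \<beta>) (lf_cell P \<alpha>)) \<and>
   (\<forall>f\<in>barr E. \<forall>g\<in>barr E. btrg E f = bsrc E g \<longrightarrow>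
      lf_cmp P g f \<in> Hom2 B (bcomp B (lf_arr P g) (lf_arr P f)) (lf_arr P (bcomp E g f))) \<and>
   (\<forall>x\<in>bobj E. lf_unit P x \<in> Hom2 B (bid1 B (lf_obj P x)) (lf_arr P (bid1 E x))) \<and>
   (\<forall>\<alpha>\<in>bcell E. \<forall>\<beta>\<in>bcell E. btrg E (bdom E \<alpha>) = bsrc E (bdom E \<beta>) \<longrightarrow>
      bvcomp B (lf_cell P (bhcomp E \<beta> \<alpha>)) (lf_cmp P (bdom E \<beta>) (bdom E \<alpha>)) =
      bvcomp B (lf_cmp P (bcod E \<beta>) (bcod E \<alpha>)) (bhcomp B (lf_cell P \<beta>) (lf_cell P \<alpha>))) \<and>
   (\<forall>f\<in>barr E. \<forall>g\<in>barr E. \<forall>h\<in>barr E. btrg E f = bsrc E g \<and> btrg E g = bsrc E h \<longrightarrow>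
      bvcomp B (lf_cell P (bassoc E h g f))
        (bvcomp B (lf_cmp P (bcomp E h g) f) (bhcomp B (lf_cmp P h g) (bid2 B (lf_arr P f)))) =
      bvcomp B (lf_cmp P h (bcomp E g f))
        (bvcomp B (bhcomp B (bid2 B (lf_arr P h)) (lf_cmp P g f))
           (bassoc B (lf_arr P h) (lf_arr P g) (lf_arr P f)))) \<and>
   (\<forall>f\<in>barr E.
      blunit B (lf_arr P f) =
        bvcomp B (lf_cell P (blunit E f))
          (bvcomp B (lf_cmp P (bid1 E (btrg E f)) f) (bhcomp B (lf_unit P (btrg E f)) (bid2 B (lf_arr P f)))) \<and>
      brunit B (lf_arr P f) =
        bvcomp B (lf_cell P (brunit E f))
          (bvcomp B (lf_cmp P f (bid1 E (bsrc E f))) (bhcomp B (bid2 B (lf_arr P f)) (lf_unit P (bsrc E f)))))"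

definition cart_lift where
  "cart_lift E B P f g h \<alpha> ht al bt \<longleftrightarrow>
     ht \<in> barr E \<and> bsrc E ht = bsrc E g \<and> btrg E ht = bsrc E f \<and>
     al \<in> Hom2 E (bcomp E f ht) g \<and> iso2 E al \<and>
     bt \<in> Hom2 B (lf_arr P ht) h \<and> iso2 B bt \<and>
     bvcomp B \<alpha> (bhcomp B (bid2 B (lf_arr P f)) bt) = bvcomp B (lf_cell P al) (lf_cmp P f ht)"

definition cartesian where
  "cartesian E B P f \<longleftrightarrow> f \<in> barr E \<and>
   (\<forall>g\<in>barr E. \<forall>h\<in>barr B. \<forall>\<alpha>.
      btrg E g = btrg E f \<and> bsrc B h = lf_obj P (bsrc E g) \<and> btrg B h = lf_obj P (bsrc E f) \<and>
      \<alpha> \<in> Hom2 B (bcomp B (lf_arr P f) h) (lf_arr P g) \<and> iso2 B \<alpha> \<longrightarrow>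
      (\<exists>ht al bt. cart_lift E B P f g h \<alpha> ht al bt)) \<and>
   (\<forall>g g' \<sigma> h h' \<alpha> \<alpha>' ht al bt ht' al' bt' \<delta>.
      g \<in> barr E \<and> g' \<in> barr E \<and> btrg E g = btrg E f \<and> \<sigma> \<in> Hom2 E g g' \<and>
      h \<in> barr B \<and> bsrc B h = lf_obj P (bsrc E g) \<and> btrg B h = lf_obj P (bsrc E f) \<and>
      h' \<in> barr B \<and> bsrc B h' = lf_obj P (bsrc E g') \<and> btrg B h' = lf_obj P (bsrc E f) \<and>
      \<alpha> \<in> Hom2 B (bcomp B (lf_arr P f) h) (lf_arr P g) \<and> iso2 B \<alpha> \<and>
      \<alpha>' \<in> Hom2 B (bcomp B (lf_arr P f) h') (lf_arr P g') \<and> iso2 B \<alpha>' \<and>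
      cart_lift E B P f g h \<alpha> ht al bt \<and> cart_lift E B P f g' h' \<alpha>' ht' al' bt' \<and>
      \<delta> \<in> Hom2 B h h' \<and>
      bvcomp B \<alpha>' (bhcomp B (bid2 B (lf_arr P f)) \<delta>) = bvcomp B (lf_cell P \<sigma>) \<alpha> \<longrightarrow>
      (\<exists>!dt. dt \<in> Hom2 E ht ht' \<and>
         bvcomp E al' (bhcomp E (bid2 E f) dt) = bvcomp E \<sigma> al \<and>
         bvcomp B bt' (lf_cell P dt) = bvcomp B \<delta> bt))"

definition cocart_lift where
  "cocart_lift E B P f g h \<alpha> ht al bt \<longleftrightarrow>
     ht \<in> barr E \<and> bsrc E ht = btrg E f \<and> btrg E ht = btrg E g \<and>
     al \<in> Hom2 E (bcomp E ht f) g \<and> iso2 E al \<and>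
     bt \<in> Hom2 B (lf_arr P ht) h \<and> iso2 B bt \<and>
     bvcomp B \<alpha> (bhcomp B bt (bid2 B (lf_arr P f))) = bvcomp B (lf_cell P al) (lf_cmp P ht f)"

definition cocartesian where
  "cocartesian E B P f \<longleftrightarrow> f \<in> barr E \<and>
   (\<forall>g\<in>barr E. \<forall>h\<in>barr B. \<forall>\<alpha>.
      bsrc E g = bsrc E f \<and> bsrc B h = lf_obj P (btrg E f) \<and> btrg B h = lf_obj P (btrg E g) \<and>
      \<alpha> \<in> Hom2 B (bcomp B h (lf_arr P f)) (lf_arr P g) \<and> iso2 B \<alpha> \<longrightarrow>
      (\<exists>ht al bt. cocart_lift E B P f g h \<alpha> ht al bt)) \<and>
   (\<forall>g g' \<sigma> h h' \<alpha> \<alpha>' ht al bt ht' al' bt' \<delta>.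
      g \<in> barr E \<and> g' \<in> barr E \<and> bsrc E g = bsrc E f \<and> \<sigma> \<in> Hom2 E g g' \<and>
      h \<in> barr B \<and> bsrc B h = lf_obj P (btrg E f) \<and> btrg B h = lf_obj P (btrg E g) \<and>
      h' \<in> barr B \<and> bsrc B h' = lf_obj P (btrg E f) \<and> btrg B h' = lf_obj P (btrg E g') \<and>
      \<alpha> \<in> Hom2 B (bcomp B h (lf_arr P f)) (lf_arr P g) \<and> iso2 B \<alpha> \<and>
      \<alpha>' \<in> Hom2 B (bcomp B h' (lf_arr P f)) (lf_arr P g') \<and> iso2 B \<alpha>' \<and>
      cocart_lift E B P f g h \<alpha> ht al bt \<and> cocart_lift E B P f g' h' \<alpha>' ht' al' bt' \<and>
      \<delta> \<in> Hom2 B h h' \<and>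
      bvcomp B \<alpha>' (bhcomp B \<delta> (bid2 B (lf_arr P f))) = bvcomp B (lf_cell P \<sigma>) \<alpha> \<longrightarrow>
      (\<exists>!dt. dt \<in> Hom2 E ht ht' \<and>
         bvcomp E al' (bhcomp E dt (bid2 E f)) = bvcomp E \<sigma> al \<and>
         bvcomp B bt' (lf_cell P dt) = bvcomp B \<delta> bt))"

definition fibered_pseudogroupoids where
  "fibered_pseudogroupoids E B P \<longleftrightarrow>
     (\<forall>f\<in>barr E. cartesian E B P f) \<and>
     (\<forall>e\<in>bobj E. \<forall>f\<in>barr B. btrg B f = lf_obj P e \<longrightarrow>
        (\<exists>ft\<in>barr E. btrg E ft = e \<and> lf_arr P ft = f)) \<and>
     (\<forall>x\<in>bobj E. \<forall>y\<in>bobj E. cat_fibered_groupoids (hom_cat E x y)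
        (hom_cat B (lf_obj P x) (lf_obj P y)) (lf_arr P) (lf_cell P))"

definition cofibered_pseudogroupoids where
  "cofibered_pseudogroupoids E B P \<longleftrightarrow>
     (\<forall>f\<in>barr E. cocartesian E B P f) \<and>
     (\<forall>e\<in>bobj E. \<forall>f\<in>barr B. bsrc B f = lf_obj P e \<longrightarrow>
        (\<exists>ft\<in>barr E. bsrc E ft = e \<and> lf_arr P ft = f)) \<and>
     (\<forall>x\<in>bobj E. \<forall>y\<in>bobj E. cat_fibered_groupoids (op_cat (hom_cat E x y))
        (op_cat (hom_cat B (lf_obj P x) (lf_obj P y))) (lf_arr P) (lf_cell P))"

text \<open>Measurability and the Euler characteristic of a bicategory only depend on its objects
  and hom-categories; for the fiber bicategory these are the following (the horizontal
  structure induced by chosen cartesian lifts plays no role).\<close>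

definition fiber_obj :: "('o1,'a1,'c1) bicat \<Rightarrow> ('o1,'a1,'c1,'o2,'a2,'c2) lax_fun \<Rightarrow> 'o2 \<Rightarrow> 'o1 set" where
  "fiber_obj E P b = {e\<in>bobj E. lf_obj P e = b}"

definition fiber_hom :: "('o1,'a1,'c1) bicat \<Rightarrow> ('o2,'a2,'c2) bicat \<Rightarrow>
    ('o1,'a1,'c1,'o2,'a2,'c2) lax_fun \<Rightarrow> 'o2 \<Rightarrow> 'o1 \<Rightarrow> 'o1 \<Rightarrow> ('a1,'c1) cat" where
  "fiber_hom E B P b x y =
     \<lparr>cobj = {h\<in>barr E. bsrc E h = x \<and> btrg E h = y \<and> lf_arr P h = bid1 B b},
      cmor = {\<alpha>\<in>bcell E. bsrc E (bdom E \<alpha>) = x \<and> btrg E (bdom E \<alpha>) = y \<and>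
                lf_cell P \<alpha> = bid2 B (bid1 B b)},
      cdom = bdom E, ccod = bcod E, cid = bid2 E, ccomp = bvcomp E\<rparr>"

end

theory Submission
  imports Defs
begin

text \<open>
  For 1-morphisms \<open>f\<close> of the base, let \<open>Z\<^sub>f(x, y)\<close> be the Euler characteristic of the groupoid of
  1-morphisms \<open>x \<rightarrow> y\<close> lying over \<open>f\<close>. Each hom-functor is bifibered in groupoids, so the Euler
  characteristic of \<open>E(x, y)\<close> is \<open>\<Sum>\<^sub>a k(a) Z\<^sub>a(x, y)\<close> for every weighting \<open>k\<close> of \<open>B(Px, Py)\<close>.
  Composition with a 1-morphism \<open>p\<close> over \<open>f\<close> identifies \<open>Z\<^sub>f\<close> with \<open>Z\<^sub>i\<^sub>d\<close>, because the structure
  cells of \<open>P\<close> at pairs with a vertical 1-morphism turn out to be invertible. Hence \<open>Z\<^sub>i\<^sub>d\<close> is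
  constant on equivalence classes of a fiber and zero off them, so it has an explicit weight \<open>u\<close>
  that is both a weighting and a coweighting, and \<open>u\<close> is also one for every \<open>Z\<^sub>f\<close>. If \<open>w\<close> is a
  weighting of \<open>B\<close>, then \<open>u(e) w(Pe)\<close> is one of \<open>E\<close>; connectedness makes the total weight of
  a fiber independent of the fiber.
\<close>

section \<open>Euler characteristics of possibly infinite matrices\<close>

text \<open>Measurability makes the hom-categories only equivalent to finite ones, so infinitely
  many 1-morphisms may lie over one \<open>f\<close>, and the equivalences ignore \<open>P\<close>.
  Euler characteristics are therefore taken over arbitrary index sets with finitely supported
  weightings; finiteness over each \<open>f\<close> is recovered by moving a finite covering family
  along opcartesian lifts. The obstacle is laxness: to compare \<open>Z\<^sub>f\<close> with
  \<open>Z\<^sub>i\<^sub>d\<close>, a composite \<open>p \<circ> h\<close> with \<open>h\<close>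
  vertical must be isomorphic to a 1-morphism strictly over \<open>f\<close>, which requires an
  invertible structure cell at \<open>(p, h)\<close>, and no axiom provides it. It is extracted from
  cartesian lifts of identities: their defining equations have an invertible side, which forces the
  unit cells and then certain structure cells to be invertible, and associativity spreads this to
  all vertical \<open>h\<close>. Postcomposition uses cartesian 1-morphisms, precomposition
  cocartesian ones. The second case is the first after reversal of 1-morphisms, so the axioms are
  weakened to a form that survives this reversal.\<close>

definition euler_value :: "'x set \<Rightarrow> ('x \<Rightarrow> 'x \<Rightarrow> rat) \<Rightarrow> rat \<Rightarrow> bool" where
  "euler_value X \<zeta> v \<longleftrightarrow>
     (\<exists>T k. finite T \<and> T \<subseteq> X \<and> weighting X T \<zeta> k \<and> sum k T = v) \<and>
     (\<exists>T k. finite T \<and> T \<subseteq> X \<and> coweighting T X \<zeta> k)"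

definition euler_char :: "'x set \<Rightarrow> ('x \<Rightarrow> 'x \<Rightarrow> rat) \<Rightarrow> rat" where
  "euler_char X \<zeta> = (THE v. euler_value X \<zeta> v)"

text \<open>Both sides equal the double sum of \<open>l s * \<zeta> s t * k t\<close> over
  \<open>S\<close> and \<open>T\<close>. The supports need not coincide: each normalization holds on
  all of \<open>X\<close>, hence on the other support.\<close>

lemma weighting_coweighting_sum:
  assumes "finite S" "S \<subseteq> X" "coweighting S X \<zeta> l"
    and "finite T" "T \<subseteq> X" "weighting X T \<zeta> k"
  shows "sum k T = sum l S"
proof -
  have "sum k T = (\<Sum>t\<in>T. (\<Sum>s\<in>S. l s * \<zeta> s t) * k t)"
    using assms by (intro sum.cong) (auto simp: coweighting_def)
  also have "\<dots> = (\<Sum>s\<in>S. l s * (\<Sum>t\<in>T. \<zeta> s t * k t))"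
    by (simp add: sum_distrib_left sum_distrib_right mult.assoc sum.swap[of _ T S])
  also have "\<dots> = sum l S"
    using assms by (intro sum.cong) (auto simp: weighting_def)
  finally show ?thesis .
qed

text \<open>One coweighting fixes the sum of every weighting, which is why
  \<open>euler_value\<close> records only that a coweighting exists.\<close>

lemma euler_value_unique:
  assumes "euler_value X \<zeta> v" "euler_value X \<zeta> w"
  shows "v = w"
proof -
  obtain S l where "finite S" "S \<subseteq> X" "coweighting S X \<zeta> l"
    using assms unfolding euler_value_def by blast
  then show ?thesis
    using assms weighting_coweighting_sum unfolding euler_value_def by metis
qed

lemma euler_char_eq: "euler_value X \<zeta> v \<Longrightarrow> euler_char X \<zeta> = v"
  unfolding euler_char_def using euler_value_unique by blast

lemma euler_value_cong:
  assumes "\<And>x y. x \<in> X \<Longrightarrow> y \<in> X \<Longrightarrow> \<zeta> x y = \<eta> x y"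
  shows "euler_value X \<zeta> v \<longleftrightarrow> euler_value X \<eta> v"
proof -
  have "weighting X T \<zeta> k \<longleftrightarrow> weighting X T \<eta> k" if "T \<subseteq> X" for T k
    using that assms unfolding weighting_def by (intro ball_cong arg_cong2[of _ _ _ _ "(=)"] sum.cong refl) auto
  moreover have "coweighting T X \<zeta> k \<longleftrightarrow> coweighting T X \<eta> k" if "T \<subseteq> X" for T k
    using that assms unfolding coweighting_def by (intro ball_cong arg_cong2[of _ _ _ _ "(=)"] sum.cong refl) auto
  ultimately show ?thesis
    unfolding euler_value_def by blast
qed

lemma sum_pushforward:
  fixes g :: "'x \<Rightarrow> rat"
  assumes "finite I"
  shows "(\<Sum>x\<in>q ` I. g x * (\<Sum>i\<in>{i\<in>I. q i = x}. k i)) = (\<Sum>i\<in>I. g (q i) * k i)"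
  by (subst sum.image_gen[OF assms, of _ q]) (auto simp: sum_distrib_left intro!: sum.cong)

text \<open>A map into \<open>X\<close> that identifies indices still yields a weighting: the
  weights of indices with the same image are added. This avoids injectivity checks when weights are
  transported or assembled from several fibres.\<close>

lemma euler_value_family:
  assumes "finite I" "q ` I \<subseteq> X" "\<And>x. x \<in> X \<Longrightarrow> (\<Sum>i\<in>I. \<zeta> x (q i) * k i) = 1"
    and "finite J" "r ` J \<subseteq> X" "\<And>x. x \<in> X \<Longrightarrow> (\<Sum>j\<in>J. l j * \<zeta> (r j) x) = 1"
  shows "euler_value X \<zeta> (sum k I)"
proof -
  have "weighting X (q ` I) \<zeta> (\<lambda>x. \<Sum>i\<in>{i\<in>I. q i = x}. k i)"
    using assms(3) unfolding weighting_def by (simp add: sum_pushforward[OF assms(1)])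
  moreover have "(\<Sum>x\<in>q ` I. \<Sum>i\<in>{i\<in>I. q i = x}. k i) = sum k I"
    using sum_pushforward[OF assms(1), of "\<lambda>_. 1"] by simp
  moreover have "coweighting (r ` J) X \<zeta> (\<lambda>x. \<Sum>j\<in>{j\<in>J. r j = x}. l j)"
    using assms(6) sum_pushforward[OF assms(4), where q = r and k = l]
    unfolding coweighting_def by (simp add: mult.commute)
  ultimately show ?thesis
    using assms unfolding euler_value_def by (meson finite_imageI)
qed

text \<open>A relation suffices, since an entry against a transported index can be evaluated at any
  related partner. Isomorphism of objects and comparison by lifts are both of this kind, and neither
  provides a canonical map.\<close>

lemma euler_value_transfer:
  assumes "euler_value X \<zeta> v"
    and "\<And>x. x \<in> X \<Longrightarrow> \<exists>y\<in>Y. R x y" "\<And>y. y \<in> Y \<Longrightarrow> \<exists>x\<in>X. R x y"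
    and eq: "\<And>x x' y y'. x \<in> X \<Longrightarrow> x' \<in> X \<Longrightarrow> y \<in> Y \<Longrightarrow> y' \<in> Y \<Longrightarrow> R x y \<Longrightarrow> R x' y' \<Longrightarrow> \<zeta> x x' = \<eta> y y'"
  shows "euler_value Y \<eta> v"
proof -
  obtain q where q: "\<And>x. x \<in> X \<Longrightarrow> q x \<in> Y \<and> R x (q x)" using assms(2) by metis
  obtain r where r: "\<And>y. y \<in> Y \<Longrightarrow> r y \<in> X \<and> R (r y) y" using assms(3) by metis
  obtain T k where T: "finite T" "T \<subseteq> X" "weighting X T \<zeta> k" "sum k T = v"
    using assms(1) unfolding euler_value_def by blast
  obtain S l where S: "finite S" "S \<subseteq> X" "coweighting S X \<zeta> l"
    using assms(1) unfolding euler_value_def by blast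
  have "(\<Sum>t\<in>T. \<eta> y (q t) * k t) = 1" if "y \<in> Y" for y
  proof -
    have "(\<Sum>t\<in>T. \<eta> y (q t) * k t) = (\<Sum>t\<in>T. \<zeta> (r y) t * k t)"
      using that q r T(2) eq[of "r y"] by (intro sum.cong) (metis subsetD)+
    then show ?thesis using T(3) r that by (simp add: weighting_def)
  qed
  moreover have "(\<Sum>s\<in>S. l s * \<eta> (q s) y) = 1" if "y \<in> Y" for y
  proof -
    have "(\<Sum>s\<in>S. l s * \<eta> (q s) y) = (\<Sum>s\<in>S. l s * \<zeta> s (r y))"
      using that q r S(2) eq[of _ "r y"] by (intro sum.cong) (metis subsetD)+
    then show ?thesis using S(3) r that by (simp add: coweighting_def)
  qed
  moreover have "q ` T \<subseteq> Y" "q ` S \<subseteq> Y" using T(2) S(2) q by auto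
  ultimately show ?thesis
    using euler_value_family[of T q Y \<eta> k S q l] T S by simp
qed

lemma has_euler_value:
  assumes "has_euler X X \<zeta>"
  shows "euler_value X \<zeta> (magnitude X X \<zeta>)"
  using assms someI_ex[of "weighting X X \<zeta>"]
  unfolding has_euler_def euler_value_def magnitude_def by blast

lemma euler_value_has_euler:
  assumes "finite X" "euler_value X \<zeta> v"
  shows "has_euler X X \<zeta>"
proof -
  obtain T k where T: "T \<subseteq> X" "weighting X T \<zeta> k"
    using assms unfolding euler_value_def by blast
  obtain S l where S: "S \<subseteq> X" "coweighting S X \<zeta> l"
    using assms unfolding euler_value_def by blast
  have "weighting X X \<zeta> (\<lambda>x. if x \<in> T then k x else 0)"
    using T assms(1) unfolding weighting_def
    by (simp add: if_distrib sum.If_cases Int_absorb1 cong: if_cong)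
  moreover have "coweighting X X \<zeta> (\<lambda>x. if x \<in> S then l x else 0)"
    using S assms(1) unfolding coweighting_def
    by (simp add: if_distrib[of "\<lambda>x. x * _"] sum.If_cases Int_absorb1 cong: if_cong)
  ultimately show ?thesis using assms(1) unfolding has_euler_def by blast
qed

lemma euler_value_magnitude:
  assumes "finite X" "euler_value X \<zeta> v"
  shows "magnitude X X \<zeta> = v"
  using assms euler_value_has_euler has_euler_value euler_value_unique by metis

section \<open>Matrices constant on the blocks of an equivalence relation and zero off them\<close>

definition block_matrix :: "'x set \<Rightarrow> ('x \<Rightarrow> 'x \<Rightarrow> rat) \<Rightarrow> bool" where
  "block_matrix X \<zeta> \<longleftrightarrow> (\<forall>x\<in>X. \<zeta> x x \<noteq> 0) \<and>
     (\<forall>x\<in>X. \<forall>y\<in>X. \<zeta> x y \<noteq> 0 \<longrightarrow> (\<forall>z\<in>X. \<zeta> z x = \<zeta> z y \<and> \<zeta> x z = \<zeta> y z))"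

text \<open>Each block needs total weight one over its constant value \<open>\<zeta> t t\<close>;
  this is shared evenly by the members of \<open>T\<close> in the block.\<close>

definition block_weight :: "'x set \<Rightarrow> ('x \<Rightarrow> 'x \<Rightarrow> rat) \<Rightarrow> 'x \<Rightarrow> rat" where
  "block_weight T \<zeta> t = 1 / (\<zeta> t t * of_nat (card {s\<in>T. \<zeta> s t \<noteq> 0}))"

lemma block_matrixD:
  assumes "block_matrix X \<zeta>" "x \<in> X" "y \<in> X" "\<zeta> x y \<noteq> 0" "z \<in> X"
  shows "\<zeta> z x = \<zeta> z y" "\<zeta> x z = \<zeta> y z"
  using assms unfolding block_matrix_def by blast+

text \<open>If one of the two entries is nonzero, row and column invariance make both equal to a
  diagonal entry; otherwise both vanish.\<close>

lemma block_matrix_sym: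
  assumes "block_matrix X \<zeta>" "x \<in> X" "y \<in> X"
  shows "\<zeta> x y = \<zeta> y x"
  using assms unfolding block_matrix_def by metis

text \<open>Row \<open>x\<close> only sees the members of \<open>T\<close> in the block of
  \<open>x\<close>, and each contributes one over their number; \<open>T\<close> must meet every
  block for this number to be nonzero. Symmetry of the matrix gives the coweighting.\<close>

lemma block_matrix_weighting:
  assumes "block_matrix X \<zeta>" "finite T" "T \<subseteq> X"
    and meets: "\<And>x. x \<in> X \<Longrightarrow> \<exists>t\<in>T. \<zeta> t x \<noteq> 0"
  shows "weighting X T \<zeta> (block_weight T \<zeta>)" "coweighting T X \<zeta> (block_weight T \<zeta>)"
proof -
  have main: "(\<Sum>t\<in>T. \<zeta> x t * block_weight T \<zeta> t) = 1" if x: "x \<in> X" for x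
  proof -
    let ?S = "{s\<in>T. \<zeta> s x \<noteq> 0}"
    have "finite ?S" "?S \<noteq> {}" using assms(2) meets[OF x] by auto
    then have c: "of_nat (card ?S) \<noteq> (0::rat)" by (simp add: card_eq_0_iff)
    have "(\<Sum>t\<in>T. \<zeta> x t * block_weight T \<zeta> t) = (\<Sum>t\<in>?S. \<zeta> x t * block_weight T \<zeta> t)"
      using assms x by (intro sum.mono_neutral_right) (auto dest: block_matrix_sym[of X \<zeta> x])
    also have "\<dots> = (\<Sum>t\<in>?S. 1 / of_nat (card ?S))"
    proof (intro sum.cong refl)
      fix t assume t: "t \<in> ?S"
      then have tX: "t \<in> X" using assms by auto
      have "\<zeta> x t = \<zeta> t t" using block_matrixD(2)[OF assms(1) tX x _ tX] t by simp
      moreover have "\<zeta> t t \<noteq> 0" using assms tX unfolding block_matrix_def by blast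
      moreover have "{s\<in>T. \<zeta> s t \<noteq> 0} = ?S"
        using block_matrixD(1)[OF assms(1) tX x] t assms(3) by auto
      ultimately show "\<zeta> x t * block_weight T \<zeta> t = 1 / of_nat (card ?S)"
        by (simp add: block_weight_def)
    qed
    also have "\<dots> = 1" using c by simp
    finally show ?thesis .
  qed
  then show "weighting X T \<zeta> (block_weight T \<zeta>)" by (simp add: weighting_def)
  have "(\<Sum>t\<in>T. block_weight T \<zeta> t * \<zeta> t x) = (\<Sum>t\<in>T. \<zeta> x t * block_weight T \<zeta> t)" if "x \<in> X" for x
    using that assms block_matrix_sym[OF assms(1)] by (intro sum.cong) (auto simp: subset_iff mult.commute)
  then show "coweighting T X \<zeta> (block_weight T \<zeta>)" using main by (simp add: coweighting_def)
qed

lemma block_matrix_euler_value: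
  assumes "block_matrix X \<zeta>" "finite T" "T \<subseteq> X" "\<And>x. x \<in> X \<Longrightarrow> \<exists>t\<in>T. \<zeta> t x \<noteq> 0"
  shows "euler_value X \<zeta> (sum (block_weight T \<zeta>) T)"
  using block_matrix_weighting[OF assms] assms(2,3) unfolding euler_value_def by blast

text \<open>For nonnegative entries all block weights are positive, so they cannot cancel. In this
  way the Euler characteristic later detects whether any 1-morphism lies over a given one.\<close>

lemma block_matrix_euler_char_nonzero:
  assumes "block_matrix X \<zeta>" "finite T" "T \<subseteq> X" "\<And>x. x \<in> X \<Longrightarrow> \<exists>t\<in>T. \<zeta> t x \<noteq> 0"
    and "\<And>x y. x \<in> X \<Longrightarrow> y \<in> X \<Longrightarrow> \<zeta> x y \<ge> 0"
  shows "euler_char X \<zeta> \<noteq> 0 \<longleftrightarrow> X \<noteq> {}"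
proof -
  have e: "euler_char X \<zeta> = sum (block_weight T \<zeta>) T"
    using block_matrix_euler_value[OF assms(1-4)] by (simp add: euler_char_eq)
  have "block_weight T \<zeta> t > 0" if "t \<in> T" for t
  proof -
    have "\<zeta> t t > 0" using that assms(1,3,5)[unfolded block_matrix_def] by (metis order_le_less subsetD)
    then have "card {s\<in>T. \<zeta> s t \<noteq> 0} > 0" using that assms(2) by (auto simp: card_gt_0_iff)
    with \<open>\<zeta> t t > 0\<close> show ?thesis by (simp add: block_weight_def)
  qed
  then have "T \<noteq> {} \<Longrightarrow> sum (block_weight T \<zeta>) T > 0" by (simp add: sum_pos assms(2))
  moreover have "X = {} \<longleftrightarrow> T = {}" using assms(3,4) by auto
  ultimately show ?thesis using e by (cases "T = {}") auto
qed

section \<open>Functors bifibered in groupoids\<close>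

definition chom :: "('o,'m) cat \<Rightarrow> 'o \<Rightarrow> 'o \<Rightarrow> 'm set" where
  "chom C x y = {m \<in> cmor C. cdom C m = x \<and> ccod C m = y}"

lemma zeta_cat_chom: "zeta_cat C x y = of_nat (card (chom C x y))"
  by (simp add: zeta_cat_def chom_def)

lemma op_cat_simps [simp]:
  "cobj (op_cat C) = cobj C" "cmor (op_cat C) = cmor C" "cdom (op_cat C) = ccod C"
  "ccod (op_cat C) = cdom C" "cid (op_cat C) = cid C" "ccomp (op_cat C) g f = ccomp C f g"
  by (simp_all add: op_cat_def)

lemma chom_op_cat [simp]: "chom (op_cat C) x y = chom C y x"
  by (auto simp: chom_def)

lemma zeta_cat_op_cat [simp]: "zeta_cat (op_cat C) x y = zeta_cat C y x"
  by (simp add: zeta_cat_chom)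

lemma op_cat_op_cat [simp]: "op_cat (op_cat C) = C"
  by (simp add: op_cat_def)

lemma category_op_cat: "category C \<Longrightarrow> category (op_cat C)"
  unfolding category_def op_cat_simps by (intro conjI) metis+

lemma cat_functor_op_cat: "cat_functor C D Fo Fm \<Longrightarrow> cat_functor (op_cat C) (op_cat D) Fo Fm"
  unfolding cat_functor_def op_cat_simps by metis

lemma cat_iso_op_cat: "cat_iso C i \<Longrightarrow> cat_iso (op_cat C) i"
  unfolding cat_iso_def op_cat_simps by metis

lemma chom_comp:
  "category C \<Longrightarrow> f \<in> chom C x y \<Longrightarrow> g \<in> chom C y z \<Longrightarrow> ccomp C g f \<in> chom C x z"
  unfolding category_def chom_def by auto

lemma chom_cid: "category C \<Longrightarrow> x \<in> cobj C \<Longrightarrow> cid C x \<in> chom C x x"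
  unfolding category_def chom_def by auto

lemma chom_obj: "category C \<Longrightarrow> f \<in> chom C x y \<Longrightarrow> x \<in> cobj C \<and> y \<in> cobj C"
  unfolding category_def chom_def by auto

lemma chom_cid_left: "category C \<Longrightarrow> f \<in> chom C x y \<Longrightarrow> ccomp C (cid C y) f = f"
  unfolding category_def chom_def by auto

lemma chom_cid_right: "category C \<Longrightarrow> f \<in> chom C x y \<Longrightarrow> ccomp C f (cid C x) = f"
  unfolding category_def chom_def by auto

lemma chom_assoc:
  "category C \<Longrightarrow> f \<in> chom C x y \<Longrightarrow> g \<in> chom C y z \<Longrightarrow> h \<in> chom C z w \<Longrightarrow>
    ccomp C h (ccomp C g f) = ccomp C (ccomp C h g) f"
  unfolding category_def chom_def by auto

lemma zeta_cat_iso_cod: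
  assumes C: "category C" and i: "cat_iso C i" "i \<in> chom C y y'"
  shows "zeta_cat C x y = zeta_cat C x y'"
proof -
  obtain j where j: "j \<in> chom C y' y" "ccomp C j i = cid C y" "ccomp C i j = cid C y'"
    using i unfolding cat_iso_def chom_def by auto
  have "bij_betw (ccomp C i) (chom C x y) (chom C x y')"
    by (rule bij_betw_byWitness[where f' = "ccomp C j"])
      (auto simp: chom_assoc[OF C _ i(2) j(1)] chom_assoc[OF C _ j(1) i(2)] j chom_cid_left[OF C]
         intro: chom_comp[OF C _ i(2)] chom_comp[OF C _ j(1)])
  then show ?thesis by (simp add: zeta_cat_chom bij_betw_same_card)
qed

lemma zeta_cat_iso_dom:
  assumes "category C" "cat_iso C i" "i \<in> chom C y y'"
  shows "zeta_cat C y x = zeta_cat C y' x"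
proof -
  obtain j where "j \<in> chom C y' y" "cat_iso C j"
    using assms unfolding cat_iso_def chom_def by auto
  then show ?thesis
    using zeta_cat_iso_cod[OF category_op_cat[OF assms(1)] cat_iso_op_cat, of j y y' x] by simp
qed

section \<open>Categories equivalent to a finite category\<close>

locale fin_equiv =
  fixes C :: "('o,'m) cat" and D :: "('p,'n) cat"
  assumes cat_C: "category C" and fin: "fin_cat_euler D" and equiv: "cat_equiv C D"
begin

lemma equiv_functor:
  "\<exists>Fo Fm. cat_functor C D Fo Fm \<and>
     (\<forall>x\<in>cobj C. \<forall>y\<in>cobj C. bij_betw Fm (chom C x y) (chom D (Fo x) (Fo y))) \<and>
     (\<forall>d\<in>cobj D. \<exists>x\<in>cobj C. \<exists>g\<in>chom D (Fo x) d. cat_iso D g)"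
proof -
  obtain Fo Fm where F: "cat_functor C D Fo Fm"
    "\<forall>x\<in>cobj C. \<forall>y\<in>cobj C. \<forall>g\<in>cmor D. cdom D g = Fo x \<and> ccod D g = Fo y \<longrightarrow>
         (\<exists>f\<in>cmor C. cdom C f = x \<and> ccod C f = y \<and> Fm f = g)"
    "\<forall>f\<in>cmor C. \<forall>f'\<in>cmor C. cdom C f = cdom C f' \<and> ccod C f = ccod C f' \<and> Fm f = Fm f' \<longrightarrow> f = f'"
    "\<forall>d\<in>cobj D. \<exists>x\<in>cobj C. \<exists>g\<in>cmor D. cdom D g = Fo x \<and> ccod D g = d \<and> cat_iso D g"
    using equiv unfolding cat_equiv_def by auto
  have "bij_betw Fm (chom C x y) (chom D (Fo x) (Fo y))" if xy: "x \<in> cobj C" "y \<in> cobj C" for x y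
  proof (rule bij_betw_imageI)
    show "inj_on Fm (chom C x y)"
      using F(3) by (auto simp: inj_on_def chom_def)
    show "Fm ` chom C x y = chom D (Fo x) (Fo y)"
    proof (intro equalityI subsetI)
      fix g assume "g \<in> Fm ` chom C x y"
      then show "g \<in> chom D (Fo x) (Fo y)" using F(1) by (auto simp: cat_functor_def chom_def)
    next
      fix g assume "g \<in> chom D (Fo x) (Fo y)"
      then have "\<exists>f\<in>cmor C. cdom C f = x \<and> ccod C f = y \<and> Fm f = g"
        using F(2) xy by (simp add: chom_def)
      then show "g \<in> Fm ` chom C x y" by (auto simp: chom_def)
    qed
  qed
  moreover have "\<exists>x\<in>cobj C. \<exists>g\<in>chom D (Fo x) d. cat_iso D g" if d: "d \<in> cobj D" for d
  proof -
    have "\<exists>x\<in>cobj C. \<exists>g\<in>cmor D. cdom D g = Fo x \<and> ccod D g = d \<and> cat_iso D g"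
      using F(4) d by (rule bspec)
    then show ?thesis by (auto simp: chom_def)
  qed
  ultimately show ?thesis using F(1) by (intro exI conjI ballI)
qed

lemma category_D: "category D"
  using fin by (simp add: fin_cat_euler_def)

lemma finite_chom_D: "finite (chom D x y)"
  using fin by (simp add: fin_cat_euler_def chom_def)

lemma finite_chom: "finite (chom C x y)"
proof (cases "x \<in> cobj C \<and> y \<in> cobj C")
  case True
  obtain Fo Fm where "bij_betw Fm (chom C x y) (chom D (Fo x) (Fo y))"
    using equiv_functor True by metis
  then show ?thesis using finite_chom_D bij_betw_finite by blast
next
  case False
  then have "chom C x y = {}" using chom_obj[OF cat_C] by blast
  then show ?thesis by simp
qed

text \<open>An object \<open>d\<close> of \<open>D\<close> is related to \<open>x\<close> when
  \<open>Fo x\<close> is isomorphic to \<open>d\<close>; isomorphisms do not change hom counts, so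
  no inverse equivalence has to be constructed.\<close>

lemma euler_value: "euler_value (cobj C) (zeta_cat C) (chi_cat D)"
proof -
  obtain Fo Fm where F: "cat_functor C D Fo Fm"
    and bij: "\<And>x y. x \<in> cobj C \<Longrightarrow> y \<in> cobj C \<Longrightarrow> bij_betw Fm (chom C x y) (chom D (Fo x) (Fo y))"
    and surj: "\<And>d. d \<in> cobj D \<Longrightarrow> \<exists>x\<in>cobj C. \<exists>g\<in>chom D (Fo x) d. cat_iso D g"
    using equiv_functor by metis
  define R where "R d x \<longleftrightarrow> (\<exists>g\<in>chom D (Fo x) d. cat_iso D g)" for d x
  show ?thesis
  proof (rule euler_value_transfer[where R = R])
    show "euler_value (cobj D) (zeta_cat D) (chi_cat D)"
      using fin has_euler_value unfolding fin_cat_euler_def chi_cat_def by blast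
    show "\<exists>x\<in>cobj C. R d x" if "d \<in> cobj D" for d
      using surj[OF that] unfolding R_def by blast
    show "\<exists>d\<in>cobj D. R d x" if "x \<in> cobj C" for x
    proof -
      have d: "Fo x \<in> cobj D" using F that by (simp add: cat_functor_def)
      have i: "cid D (Fo x) \<in> chom D (Fo x) (Fo x)" using chom_cid[OF category_D d] .
      moreover have "cat_iso D (cid D (Fo x))"
        using i chom_cid_left[OF category_D i] unfolding cat_iso_def chom_def by auto
      ultimately show ?thesis using d unfolding R_def by blast
    qed
    show "zeta_cat D d d' = zeta_cat C x x'"
      if "x \<in> cobj C" "x' \<in> cobj C" "R d x" "R d' x'" for d d' x x'
    proof -
      have "zeta_cat D d d' = zeta_cat D (Fo x) d'"
        using that zeta_cat_iso_dom[OF category_D] unfolding R_def by metis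
      also have "\<dots> = zeta_cat D (Fo x) (Fo x')"
        using that zeta_cat_iso_cod[OF category_D] unfolding R_def by metis
      also have "\<dots> = zeta_cat C x x'"
        using bij_betw_same_card[OF bij] that by (simp add: zeta_cat_chom)
      finally show ?thesis .
    qed
  qed
qed

text \<open>A substitute for finiteness of the object set: one preimage up to isomorphism is taken
  for each object of \<open>D\<close>. Arrows in both directions are recorded so that the property
  passes to the opposite category.\<close>

lemma finite_cover:
  obtains T where "finite T" "T \<subseteq> cobj C"
    "\<And>x. x \<in> cobj C \<Longrightarrow> \<exists>t\<in>T. chom C t x \<noteq> {} \<and> chom C x t \<noteq> {}"
proof -
  obtain Fo Fm where F: "cat_functor C D Fo Fm"
    and bij: "\<And>x y. x \<in> cobj C \<Longrightarrow> y \<in> cobj C \<Longrightarrow> bij_betw Fm (chom C x y) (chom D (Fo x) (Fo y))"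
    and surj: "\<And>d. d \<in> cobj D \<Longrightarrow> \<exists>x\<in>cobj C. \<exists>g\<in>chom D (Fo x) d. cat_iso D g"
    using equiv_functor by metis
  obtain G where G: "\<And>d. d \<in> cobj D \<Longrightarrow> G d \<in> cobj C \<and> (\<exists>g\<in>chom D (Fo (G d)) d. cat_iso D g)"
    using surj by metis
  have "chom C (G (Fo x)) x \<noteq> {} \<and> chom C x (G (Fo x)) \<noteq> {}" "Fo x \<in> cobj D" if x: "x \<in> cobj C" for x
  proof -
    show d: "Fo x \<in> cobj D" using F x by (simp add: cat_functor_def)
    then have "chom D (Fo (G (Fo x))) (Fo x) \<noteq> {}" "chom D (Fo x) (Fo (G (Fo x))) \<noteq> {}"
      using G[OF d] unfolding cat_iso_def chom_def by auto
    then show "chom C (G (Fo x)) x \<noteq> {} \<and> chom C x (G (Fo x)) \<noteq> {}"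
      using bij[OF x] bij[OF _ x] G[OF d] bij_betw_empty1 by metis
  qed
  moreover have "finite (G ` cobj D)" "G ` cobj D \<subseteq> cobj C"
    using G fin by (auto simp: fin_cat_euler_def)
  ultimately show ?thesis using that[of "G ` cobj D"] by blast
qed

end

lemma measurable_dataD:
  assumes "measurable_data Ob H" "x \<in> Ob" "y \<in> Ob" "category (H x y)"
  shows "\<exists>C :: (nat,nat) cat. fin_equiv (H x y) C"
    and "euler_value (cobj (H x y)) (zeta_cat (H x y)) (chi_hom H x y)"
proof -
  let ?P = "\<lambda>C :: (nat,nat) cat. fin_cat_euler C \<and> cat_equiv (H x y) C"
  have "\<exists>C. ?P C" using assms unfolding measurable_data_def by blast
  then have "?P (SOME C. ?P C)" by (rule someI_ex)
  then have *: "fin_equiv (H x y) (SOME C. ?P C)" using assms(4) by unfold_locales auto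
  then show "\<exists>C :: (nat,nat) cat. fin_equiv (H x y) C" by blast
  show "euler_value (cobj (H x y)) (zeta_cat (H x y)) (chi_hom H x y)"
    using fin_equiv.euler_value[OF *] by (simp add: chi_hom_def)
qed

section \<open>Morphisms over a fixed base morphism\<close>

definition fibre_obj :: "('o,'m) cat \<Rightarrow> ('o \<Rightarrow> 'p) \<Rightarrow> 'p \<Rightarrow> 'o set" where
  "fibre_obj C Fo a = {x \<in> cobj C. Fo x = a}"

definition hom_over :: "('o,'m) cat \<Rightarrow> ('m \<Rightarrow> 'n) \<Rightarrow> 'n \<Rightarrow> 'o \<Rightarrow> 'o \<Rightarrow> 'm set" where
  "hom_over C Fm u x y = {m \<in> chom C x y. Fm m = u}"

text \<open>For \<open>u\<close> an identity this is the zeta matrix of the category over an object;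
  other \<open>u\<close> serve to split the hom-sets of the total category by their image.\<close>

definition fibre_zeta :: "('o,'m) cat \<Rightarrow> ('m \<Rightarrow> 'n) \<Rightarrow> 'n \<Rightarrow> 'o \<Rightarrow> 'o \<Rightarrow> rat" where
  "fibre_zeta C Fm u x y = of_nat (card (hom_over C Fm u x y))"

lemma fibre_op_cat [simp]:
  "fibre_obj (op_cat C) Fo a = fibre_obj C Fo a"
  "hom_over (op_cat C) Fm u x y = hom_over C Fm u y x"
  "fibre_zeta (op_cat C) Fm u x y = fibre_zeta C Fm u y x"
  by (auto simp: fibre_obj_def hom_over_def fibre_zeta_def)

locale bifibered =
  fixes C :: "('o,'m) cat" and D :: "('p,'n) cat" and Fo Fm
  assumes cat_C: "category C" and cat_D: "category D" and is_functor: "cat_functor C D Fo Fm"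
    and fib: "cat_fibered_groupoids C D Fo Fm"
    and opfib: "cat_fibered_groupoids (op_cat C) (op_cat D) Fo Fm"
    and finite_chom_C: "\<And>x y. finite (chom C x y)"
    and finite_chom_D: "\<And>x y. finite (chom D x y)"
    and cover: "\<exists>T. finite T \<and> T \<subseteq> cobj C \<and>
      (\<forall>x\<in>cobj C. \<exists>t\<in>T. chom C t x \<noteq> {} \<and> chom C x t \<noteq> {})"
begin

lemma dual: "bifibered (op_cat C) (op_cat D) Fo Fm"
  by unfold_locales
    (use cat_C cat_D is_functor fib opfib finite_chom_C finite_chom_D cover in
      \<open>auto simp: category_op_cat cat_functor_op_cat conj_commute\<close>)

lemma chom_image: "m \<in> chom C x y \<Longrightarrow> Fm m \<in> chom D (Fo x) (Fo y)"
  using is_functor by (auto simp: chom_def cat_functor_def)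

lemma oplift:
  assumes "x \<in> cobj C" "u \<in> chom D (Fo x) a"
  shows "\<exists>y\<in>fibre_obj C Fo a. hom_over C Fm u x y \<noteq> {}"
proof -
  obtain l where l: "l \<in> cmor C" "cdom C l = x" "Fm l = u"
    using assms opfib unfolding cat_fibered_groupoids_def chom_def by auto
  then have "ccod C l \<in> cobj C" "Fo (ccod C l) = a"
    using cat_C is_functor assms(2) unfolding category_def cat_functor_def chom_def by auto
  then show ?thesis using l by (auto simp: fibre_obj_def hom_over_def chom_def)
qed

text \<open>Every morphism \<open>l\<close> is opcartesian: the second clause of fiberedness for the
  opposite functor, read in \<open>C\<close>.\<close>

lemma opfib_factor:
  assumes "l \<in> chom C x y" "n \<in> chom C x z" "v \<in> chom D (Fo y) (Fo z)" "ccomp D v (Fm l) = Fm n"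
  shows "\<exists>!m. m \<in> chom C y z \<and> ccomp C m l = n \<and> Fm m = v"
proof -
  have "ccod (op_cat C) l = ccod (op_cat C) n \<and> cdom (op_cat D) v = Fo (cdom (op_cat C) n) \<and>
      ccod (op_cat D) v = Fo (cdom (op_cat C) l) \<and> ccomp (op_cat D) (Fm l) v = Fm n"
    using assms by (simp add: chom_def)
  moreover have "l \<in> cmor (op_cat C)" "n \<in> cmor (op_cat C)" "v \<in> cmor (op_cat D)"
    using assms by (auto simp: chom_def)
  ultimately have "\<exists>!m. m \<in> cmor (op_cat C) \<and> cdom (op_cat C) m = cdom (op_cat C) n \<and>
      ccod (op_cat C) m = cdom (op_cat C) l \<and> ccomp (op_cat C) l m = n \<and> Fm m = v"
    using opfib[unfolded cat_fibered_groupoids_def, THEN conjunct2] by blast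
  moreover have "cdom (op_cat C) n = z" "cdom (op_cat C) l = y"
    using assms by (simp_all add: chom_def)
  ultimately show ?thesis by (simp add: chom_def conj_ac)
qed

text \<open>Factoring the identity through an opcartesian lift \<open>l\<close> gives a left inverse
  \<open>m\<close> over the inverse of \<open>u\<close>. Then \<open>l\<close> after
  \<open>m\<close> and the identity both factor \<open>l\<close> through itself over the identity of
  \<open>a\<close>, so they agree.\<close>

lemma iso_lift:
  assumes x: "x \<in> cobj C" and u: "u \<in> chom D (Fo x) a" "cat_iso D u"
  shows "\<exists>y l. l \<in> chom C x y \<and> Fo y = a \<and> Fm l = u \<and> cat_iso C l"
proof -
  obtain y l where l: "l \<in> chom C x y" "Fm l = u" and y: "y \<in> cobj C" "Fo y = a"
    using oplift[OF x u(1)] by (auto simp: hom_over_def fibre_obj_def)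
  obtain v where v: "v \<in> chom D a (Fo x)" "ccomp D v u = cid D (Fo x)" "ccomp D u v = cid D a"
    using u unfolding cat_iso_def chom_def by auto
  note idx = chom_cid[OF cat_C x] and idy = chom_cid[OF cat_C y(1)]
  have F_id: "Fm (cid C x) = cid D (Fo x)" "Fm (cid C y) = cid D a"
    using is_functor x y by (auto simp: cat_functor_def)
  have "\<exists>!m. m \<in> chom C y x \<and> ccomp C m l = cid C x \<and> Fm m = v"
    using opfib_factor[OF l(1) idx] v l y F_id by simp
  then obtain m where m: "m \<in> chom C y x" "ccomp C m l = cid C x" "Fm m = v" by blast
  have "Fm (ccomp C l m) = cid D a"
    using is_functor l m v(3) by (auto simp: cat_functor_def chom_def)
  moreover have "ccomp C (ccomp C l m) l = l"
    using chom_assoc[OF cat_C l(1) m(1) l(1)] m(2) chom_cid_right[OF cat_C l(1)] by simp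
  moreover have "ccomp D (cid D a) u = u" using chom_cid_left[OF cat_D u(1)] .
  ultimately have "ccomp C l m = cid C y"
    using opfib_factor[OF l(1) l(1), of "cid D a"] chom_comp[OF cat_C m(1) l(1)] idy F_id
      chom_image[OF idy] chom_cid_left[OF cat_C l(1)] l y by auto
  then have "cat_iso C l" using l m unfolding cat_iso_def chom_def by auto
  then show ?thesis using l y by blast
qed

text \<open>Composition with the opcartesian \<open>l\<close> is a bijection: each morphism over
  \<open>u\<close> factors uniquely through \<open>l\<close> by a morphism over the identity of
  \<open>a\<close>.\<close>

lemma hom_over_precomp_card:
  assumes l: "l \<in> hom_over C Fm u x y" and z: "z \<in> fibre_obj C Fo a" and y: "y \<in> fibre_obj C Fo a"
  shows "card (hom_over C Fm (cid D a) y z) = card (hom_over C Fm u x z)"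
proof -
  have l': "l \<in> chom C x y" "Fm l = u" and y': "Fo y = a" "a \<in> cobj D" and z': "Fo z = a"
    using l y z is_functor by (auto simp: hom_over_def fibre_obj_def cat_functor_def)
  have u: "u \<in> chom D (Fo x) a" using chom_image[OF l'(1)] l' y' by simp
  have ida: "cid D a \<in> chom D a a" using chom_cid[OF cat_D y'(2)] .
  have idu: "ccomp D (cid D a) u = u" using chom_cid_left[OF cat_D u] .
  have comp: "ccomp C m l \<in> hom_over C Fm u x z" if "m \<in> hom_over C Fm (cid D a) y z" for m
  proof -
    have m: "m \<in> chom C y z" "Fm m = cid D a" using that by (auto simp: hom_over_def)
    then have "Fm (ccomp C m l) = ccomp D (Fm m) (Fm l)"
      using l'(1) is_functor by (simp add: chom_def cat_functor_def)
    then show ?thesis using chom_comp[OF cat_C l'(1) m(1)] m l' idu by (simp add: hom_over_def)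
  qed
  have uniq: "\<exists>!m. m \<in> hom_over C Fm (cid D a) y z \<and> ccomp C m l = n"
    if "n \<in> hom_over C Fm u x z" for n
    using opfib_factor[OF l'(1), of n z "cid D a"] that l' ida idu y' z'
    by (simp add: hom_over_def conj_ac)
  have "bij_betw (\<lambda>m. ccomp C m l) (hom_over C Fm (cid D a) y z) (hom_over C Fm u x z)"
    by (rule bij_betwI') (use comp uniq in metis)+
  then show ?thesis by (rule bij_betw_same_card)
qed

lemma finite_hom_over: "finite (hom_over C Fm u x y)"
  using finite_chom_C by (simp add: hom_over_def)

lemma fibre_zeta_nonzero: "fibre_zeta C Fm u x y \<noteq> 0 \<longleftrightarrow> hom_over C Fm u x y \<noteq> {}"
  by (simp add: fibre_zeta_def finite_hom_over)

lemma cid_hom_over: "x \<in> fibre_obj C Fo a \<Longrightarrow> cid D a \<in> chom D a a \<and> cid C x \<in> hom_over C Fm (cid D a) x x"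
  using is_functor chom_cid[OF cat_C, of x] chom_cid[OF cat_D, of a]
  by (auto simp: hom_over_def fibre_obj_def cat_functor_def)

text \<open>A morphism over the identity of \<open>a\<close> can serve as \<open>l\<close> in
  \<open>hom_over_precomp_card\<close>, which equates rows; the opposite functor equates
  columns.\<close>

lemma fibre_block_matrix: "block_matrix (fibre_obj C Fo a) (fibre_zeta C Fm (cid D a))"
proof -
  interpret op: bifibered "op_cat C" "op_cat D" Fo Fm by (rule dual)
  show ?thesis
    unfolding block_matrix_def fibre_zeta_nonzero
    using cid_hom_over hom_over_precomp_card op.hom_over_precomp_card
    by (fastforce simp: fibre_zeta_def)
qed

text \<open>A cover of \<open>C\<close> need not lie over \<open>a\<close>, so it is moved there:
  for each covering \<open>t\<close> and each \<open>u\<close> from \<open>Fo t\<close> to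
  \<open>a\<close>, the target of a lift of \<open>u\<close> is taken. An arrow \<open>m\<close>
  from \<open>t\<close> to \<open>x\<close> factors through the lift of its image, which connects
  that target to \<open>x\<close> over the identity.\<close>

lemma fibre_cover:
  obtains T where "finite T" "T \<subseteq> fibre_obj C Fo a"
    "\<And>x. x \<in> fibre_obj C Fo a \<Longrightarrow> \<exists>t\<in>T. fibre_zeta C Fm (cid D a) t x \<noteq> 0"
proof -
  obtain T where T: "finite T" "T \<subseteq> cobj C" "\<forall>x\<in>cobj C. \<exists>t\<in>T. chom C t x \<noteq> {} \<and> chom C x t \<noteq> {}"
    using cover by auto
  define I where "I = (SIGMA t:T. chom D (Fo t) a)"
  have "\<exists>y. y \<in> fibre_obj C Fo a \<and> hom_over C Fm (snd i) (fst i) y \<noteq> {}" if "i \<in> I" for i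
    using that T(2) oplift[of "fst i" "snd i" a] unfolding I_def by (cases i) (auto simp: subset_iff)
  then obtain r where r: "\<And>i. i \<in> I \<Longrightarrow> r i \<in> fibre_obj C Fo a \<and> hom_over C Fm (snd i) (fst i) (r i) \<noteq> {}"
    by metis
  have "\<exists>i\<in>I. fibre_zeta C Fm (cid D a) (r i) x \<noteq> 0" if x: "x \<in> fibre_obj C Fo a" for x
  proof -
    obtain t m where t: "t \<in> T" "m \<in> chom C t x" using T(3) x by (fastforce simp: fibre_obj_def)
    then have i: "(t, Fm m) \<in> I" using chom_image[OF t(2)] x by (auto simp: I_def fibre_obj_def)
    from r[OF i] obtain l where "r (t, Fm m) \<in> fibre_obj C Fo a" "l \<in> hom_over C Fm (Fm m) t (r (t, Fm m))"
      by auto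
    then have "card (hom_over C Fm (cid D a) (r (t, Fm m)) x) = card (hom_over C Fm (Fm m) t x)"
      using hom_over_precomp_card x by blast
    moreover have "m \<in> hom_over C Fm (Fm m) t x" using t by (simp add: hom_over_def)
    ultimately show ?thesis
      using i finite_hom_over by (intro bexI[of _ "(t, Fm m)"]) (auto simp: fibre_zeta_def)
  qed
  moreover have "finite I" unfolding I_def using T(1) finite_chom_D by blast
  ultimately show ?thesis using that[of "r ` I"] r by blast
qed

lemma fibre_euler_value: "\<exists>v. euler_value (fibre_obj C Fo a) (fibre_zeta C Fm (cid D a)) v"
  using fibre_cover block_matrix_euler_value[OF fibre_block_matrix] by metis

lemma fibre_euler_char_nonzero:
  "euler_char (fibre_obj C Fo a) (fibre_zeta C Fm (cid D a)) \<noteq> 0 \<longleftrightarrow> fibre_obj C Fo a \<noteq> {}"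
proof -
  obtain T where T: "finite T" "T \<subseteq> fibre_obj C Fo a"
    "\<And>x. x \<in> fibre_obj C Fo a \<Longrightarrow> \<exists>t\<in>T. fibre_zeta C Fm (cid D a) t x \<noteq> 0"
    using fibre_cover[where a = a] by metis
  show ?thesis
    by (rule block_matrix_euler_char_nonzero[OF fibre_block_matrix T]) (simp_all add: fibre_zeta_def)
qed

text \<open>The arrows from \<open>x\<close> to \<open>t\<close> split by their image
  \<open>u\<close>. A lift of \<open>u\<close> at \<open>x\<close> with target \<open>y\<close>
  turns the counts over \<open>u\<close> into row \<open>y\<close> of the fibre matrix, where the
  weighted sum is 1; hence every \<open>u\<close> contributes exactly 1.\<close>

lemma fibre_weighting_sum:
  assumes x: "x \<in> cobj C" and T: "T \<subseteq> fibre_obj C Fo a"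
    and w: "weighting (fibre_obj C Fo a) T (fibre_zeta C Fm (cid D a)) w"
  shows "(\<Sum>t\<in>T. zeta_cat C x t * w t) = zeta_cat D (Fo x) a"
proof -
  have split: "zeta_cat C x t = (\<Sum>u\<in>chom D (Fo x) a. fibre_zeta C Fm u x t)" if "t \<in> T" for t
  proof -
    have "chom C x t = (\<Union>u\<in>chom D (Fo x) a. hom_over C Fm u x t)"
      using that T chom_image by (auto simp: hom_over_def fibre_obj_def subset_iff)
    moreover have "card (\<Union>u\<in>chom D (Fo x) a. hom_over C Fm u x t) =
        (\<Sum>u\<in>chom D (Fo x) a. card (hom_over C Fm u x t))"
      using finite_chom_D finite_hom_over by (intro card_UN_disjoint) (auto simp: hom_over_def)
    ultimately show ?thesis by (simp add: zeta_cat_chom fibre_zeta_def)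
  qed
  have one: "(\<Sum>t\<in>T. fibre_zeta C Fm u x t * w t) = 1" if u: "u \<in> chom D (Fo x) a" for u
  proof -
    obtain y l where y: "y \<in> fibre_obj C Fo a" and l: "l \<in> hom_over C Fm u x y"
      using oplift[OF x u] by blast
    have "(\<Sum>t\<in>T. fibre_zeta C Fm u x t * w t) = (\<Sum>t\<in>T. fibre_zeta C Fm (cid D a) y t * w t)"
      using T hom_over_precomp_card[OF l _ y] by (intro sum.cong) (auto simp: fibre_zeta_def)
    then show ?thesis using w y by (simp add: weighting_def)
  qed
  have "(\<Sum>t\<in>T. zeta_cat C x t * w t) = (\<Sum>u\<in>chom D (Fo x) a. \<Sum>t\<in>T. fibre_zeta C Fm u x t * w t)"
    by (simp add: split sum_distrib_right sum.swap[of _ T])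
  then show ?thesis using one by (simp add: zeta_cat_chom)
qed

lemma fibre_coweighting_sum:
  assumes "x \<in> cobj C" "T \<subseteq> fibre_obj C Fo a"
    and "coweighting T (fibre_obj C Fo a) (fibre_zeta C Fm (cid D a)) w"
  shows "(\<Sum>t\<in>T. w t * zeta_cat C t x) = zeta_cat D a (Fo x)"
  using bifibered.fibre_weighting_sum[OF dual, of x T a w] assms
  by (simp add: weighting_def coweighting_def mult.commute)

text \<open>The weights \<open>k a * w a t\<close> combine a weighting of the base with one of each
  fibre. The coweighting \<open>l\<close> of the base yields a coweighting of \<open>C\<close> in
  the same way, which makes the value well defined.\<close>

lemma euler_value_total:
  assumes T: "finite T" "T \<subseteq> cobj D" "weighting (cobj D) T (zeta_cat D) k"
    and S: "finite S" "S \<subseteq> cobj D" "coweighting S (cobj D) (zeta_cat D) l"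
  shows "euler_value (cobj C) (zeta_cat C)
    (\<Sum>a\<in>T. k a * euler_char (fibre_obj C Fo a) (fibre_zeta C Fm (cid D a)))"
proof -
  let ?X = "fibre_obj C Fo" and ?z = "\<lambda>a. fibre_zeta C Fm (cid D a)"
  have "\<exists>V. finite V \<and> V \<subseteq> ?X a \<and> (\<forall>x\<in>?X a. \<exists>t\<in>V. ?z a t x \<noteq> 0)" for a
    using fibre_cover[where a = a] by metis
  then obtain V where V: "\<And>a. finite (V a)" "\<And>a. V a \<subseteq> ?X a" "\<And>a x. x \<in> ?X a \<Longrightarrow> \<exists>t\<in>V a. ?z a t x \<noteq> 0"
    by metis
  define w where "w a = block_weight (V a) (?z a)" for a
  have w: "weighting (?X a) (V a) (?z a) (w a)" "coweighting (V a) (?X a) (?z a) (w a)" for a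
    using block_matrix_weighting[OF fibre_block_matrix V(1) V(2) V(3), of a] by (auto simp: w_def)
  have sum_w: "sum (w a) (V a) = euler_char (?X a) (?z a)" for a
    using block_matrix_euler_value[OF fibre_block_matrix V(1) V(2) V(3), of a] by (simp add: w_def euler_char_eq)
  have "euler_value (cobj C) (zeta_cat C) (\<Sum>(a,t)\<in>Sigma T V. k a * w a t)"
  proof (rule euler_value_family[where q = snd and J = "Sigma S V" and r = snd and l = "\<lambda>(a,t). l a * w a t"])
    show "finite (Sigma T V)" "finite (Sigma S V)" using T(1) S(1) V(1) by auto
    show "snd ` Sigma T V \<subseteq> cobj C" "snd ` Sigma S V \<subseteq> cobj C"
      using V(2) by (force simp: fibre_obj_def)+
    show "(\<Sum>i\<in>Sigma T V. zeta_cat C x (snd i) * (case i of (a, t) \<Rightarrow> k a * w a t)) = 1" if x: "x \<in> cobj C" for x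
    proof -
      have "(\<Sum>i\<in>Sigma T V. zeta_cat C x (snd i) * (case i of (a, t) \<Rightarrow> k a * w a t)) =
          (\<Sum>(a,t)\<in>Sigma T V. k a * (zeta_cat C x t * w a t))"
        by (intro sum.cong) auto
      also have "\<dots> = (\<Sum>a\<in>T. k a * (\<Sum>t\<in>V a. zeta_cat C x t * w a t))"
        using T(1) V(1) by (simp add: sum.Sigma[symmetric] sum_distrib_left)
      also have "\<dots> = (\<Sum>a\<in>T. zeta_cat D (Fo x) a * k a)"
        using fibre_weighting_sum[OF x V(2) w(1)] by (simp add: mult.commute)
      finally show ?thesis using T(3) x is_functor by (simp add: weighting_def cat_functor_def)
    qed
    show "(\<Sum>j\<in>Sigma S V. (case j of (a, t) \<Rightarrow> l a * w a t) * zeta_cat C (snd j) x) = 1" if x: "x \<in> cobj C" for x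
    proof -
      have "(\<Sum>j\<in>Sigma S V. (case j of (a, t) \<Rightarrow> l a * w a t) * zeta_cat C (snd j) x) =
          (\<Sum>(a,t)\<in>Sigma S V. l a * (w a t * zeta_cat C t x))"
        by (intro sum.cong) auto
      also have "\<dots> = (\<Sum>a\<in>S. l a * (\<Sum>t\<in>V a. w a t * zeta_cat C t x))"
        using S(1) V(1) by (simp add: sum.Sigma[symmetric] sum_distrib_left)
      also have "\<dots> = (\<Sum>a\<in>S. l a * zeta_cat D a (Fo x))"
        using fibre_coweighting_sum[OF x V(2) w(2)] by simp
      finally show ?thesis using S(3) x is_functor by (simp add: coweighting_def cat_functor_def)
    qed
  qed
  moreover have "(\<Sum>(a,t)\<in>Sigma T V. k a * w a t) = (\<Sum>a\<in>T. k a * euler_char (?X a) (?z a))"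
    using T(1) V(1) sum_w by (simp add: sum.Sigma[symmetric] sum_distrib_left[symmetric])
  ultimately show ?thesis by simp
qed

end

section \<open>Bicategories without coherence\<close>

text \<open>Associators and the coherence axioms are left out: what remains is closed under reversal
  of 1-morphisms without inverting any structure cell.\<close>

locale prebicategory =
  fixes B :: "('o,'a,'c) bicat"
  assumes arr_obj: "f \<in> barr B \<Longrightarrow> bsrc B f \<in> bobj B" "f \<in> barr B \<Longrightarrow> btrg B f \<in> bobj B"
    and id1: "x \<in> bobj B \<Longrightarrow> bid1 B x \<in> barr B" "x \<in> bobj B \<Longrightarrow> bsrc B (bid1 B x) = x"
      "x \<in> bobj B \<Longrightarrow> btrg B (bid1 B x) = x"
    and comp1: "f \<in> barr B \<Longrightarrow> g \<in> barr B \<Longrightarrow> btrg B f = bsrc B g \<Longrightarrow> bcomp B g f \<in> barr B"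
      "f \<in> barr B \<Longrightarrow> g \<in> barr B \<Longrightarrow> btrg B f = bsrc B g \<Longrightarrow> bsrc B (bcomp B g f) = bsrc B f"
      "f \<in> barr B \<Longrightarrow> g \<in> barr B \<Longrightarrow> btrg B f = bsrc B g \<Longrightarrow> btrg B (bcomp B g f) = btrg B g"
    and cell: "\<alpha> \<in> Hom2 B f g \<Longrightarrow> f \<in> barr B" "\<alpha> \<in> Hom2 B f g \<Longrightarrow> g \<in> barr B"
      "\<alpha> \<in> Hom2 B f g \<Longrightarrow> bsrc B f = bsrc B g" "\<alpha> \<in> Hom2 B f g \<Longrightarrow> btrg B f = btrg B g"
    and id2: "f \<in> barr B \<Longrightarrow> bid2 B f \<in> Hom2 B f f"
    and vcomp: "\<alpha> \<in> Hom2 B f g \<Longrightarrow> \<beta> \<in> Hom2 B g h \<Longrightarrow> bvcomp B \<beta> \<alpha> \<in> Hom2 B f h"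
    and vid_left: "\<alpha> \<in> Hom2 B f g \<Longrightarrow> bvcomp B (bid2 B g) \<alpha> = \<alpha>"
    and vid_right: "\<alpha> \<in> Hom2 B f g \<Longrightarrow> bvcomp B \<alpha> (bid2 B f) = \<alpha>"
    and vassoc: "\<alpha> \<in> Hom2 B f g \<Longrightarrow> \<beta> \<in> Hom2 B g h \<Longrightarrow> \<gamma> \<in> Hom2 B h k \<Longrightarrow>
      bvcomp B \<gamma> (bvcomp B \<beta> \<alpha>) = bvcomp B (bvcomp B \<gamma> \<beta>) \<alpha>"
    and hcomp: "\<alpha> \<in> Hom2 B f f' \<Longrightarrow> \<beta> \<in> Hom2 B g g' \<Longrightarrow> btrg B f = bsrc B g \<Longrightarrow>
      bhcomp B \<beta> \<alpha> \<in> Hom2 B (bcomp B g f) (bcomp B g' f')"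
    and hcomp_id: "f \<in> barr B \<Longrightarrow> g \<in> barr B \<Longrightarrow> btrg B f = bsrc B g \<Longrightarrow>
      bhcomp B (bid2 B g) (bid2 B f) = bid2 B (bcomp B g f)"
    and interchange: "\<alpha> \<in> Hom2 B f f' \<Longrightarrow> \<alpha>' \<in> Hom2 B f' f'' \<Longrightarrow> \<beta> \<in> Hom2 B g g' \<Longrightarrow> \<beta>' \<in> Hom2 B g' g'' \<Longrightarrow>
      btrg B f = bsrc B g \<Longrightarrow>
      bhcomp B (bvcomp B \<beta>' \<beta>) (bvcomp B \<alpha>' \<alpha>) = bvcomp B (bhcomp B \<beta>' \<alpha>') (bhcomp B \<beta> \<alpha>)"
    and lunit: "f \<in> barr B \<Longrightarrow> blunit B f \<in> Hom2 B (bcomp B (bid1 B (btrg B f)) f) f"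
      "f \<in> barr B \<Longrightarrow> iso2 B (blunit B f)"
    and runit: "f \<in> barr B \<Longrightarrow> brunit B f \<in> Hom2 B (bcomp B f (bid1 B (bsrc B f))) f"
      "f \<in> barr B \<Longrightarrow> iso2 B (brunit B f)"
    and lunit_natural: "\<alpha> \<in> Hom2 B f g \<Longrightarrow>
      bvcomp B \<alpha> (blunit B f) = bvcomp B (blunit B g) (bhcomp B (bid2 B (bid1 B (btrg B f))) \<alpha>)"
    and runit_natural: "\<alpha> \<in> Hom2 B f g \<Longrightarrow>
      bvcomp B \<alpha> (brunit B f) = bvcomp B (brunit B g) (bhcomp B \<alpha> (bid2 B (bid1 B (bsrc B f))))"
begin

lemma iso2I:
  assumes "\<alpha> \<in> Hom2 B f g" "\<beta> \<in> Hom2 B g f" "bvcomp B \<beta> \<alpha> = bid2 B f" "bvcomp B \<alpha> \<beta> = bid2 B g"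
  shows "iso2 B \<alpha>"
  using assms unfolding iso2_def Hom2_def by auto

lemma iso2_inverse:
  assumes "\<alpha> \<in> Hom2 B f g" "iso2 B \<alpha>"
  shows "\<exists>\<beta>\<in>Hom2 B g f. bvcomp B \<beta> \<alpha> = bid2 B f \<and> bvcomp B \<alpha> \<beta> = bid2 B g \<and> iso2 B \<beta>"
proof -
  obtain \<beta> where \<beta>: "\<beta> \<in> Hom2 B g f" "bvcomp B \<beta> \<alpha> = bid2 B f" "bvcomp B \<alpha> \<beta> = bid2 B g"
    using assms unfolding iso2_def Hom2_def by auto
  then show ?thesis using iso2I[OF \<beta>(1) assms(1)] by blast
qed

lemma vcomp_cancel_inner:
  assumes "\<alpha> \<in> Hom2 B f g" "\<beta> \<in> Hom2 B g h" "\<beta>' \<in> Hom2 B h g" "bvcomp B \<beta>' \<beta> = bid2 B g"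
  shows "bvcomp B \<beta>' (bvcomp B \<beta> \<alpha>) = \<alpha>"
  by (simp add: vassoc[OF assms(1-3)] assms(4) vid_left[OF assms(1)])

lemma vcomp_cancel_outer:
  assumes "\<alpha> \<in> Hom2 B g h" "\<alpha>' \<in> Hom2 B h g" "\<beta> \<in> Hom2 B h k" "bvcomp B \<alpha> \<alpha>' = bid2 B h"
  shows "bvcomp B (bvcomp B \<beta> \<alpha>) \<alpha>' = \<beta>"
  by (simp add: vassoc[OF assms(2,1,3), symmetric] assms(4) vid_right[OF assms(3)])

lemma iso2_id: "f \<in> barr B \<Longrightarrow> iso2 B (bid2 B f)"
  using iso2I[OF id2 id2] vid_left[OF id2] by simp

lemma left_right_inverse_eq:
  assumes "\<alpha> \<in> Hom2 B f g" "l \<in> Hom2 B g f" "bvcomp B l \<alpha> = bid2 B f"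
    and "r \<in> Hom2 B g f" "bvcomp B \<alpha> r = bid2 B g"
  shows "l = r"
  using vassoc[OF assms(4,1,2)] vid_left[OF assms(4)] vid_right[OF assms(2)] assms(3,5) by simp

lemma iso2_left_right_inverse:
  assumes "\<alpha> \<in> Hom2 B f g" "l \<in> Hom2 B g f" "bvcomp B l \<alpha> = bid2 B f"
    and "r \<in> Hom2 B g f" "bvcomp B \<alpha> r = bid2 B g"
  shows "iso2 B \<alpha>"
  using iso2I[OF assms(1,2,3)] left_right_inverse_eq[OF assms] assms(5) by simp

lemma iso2_vcomp:
  assumes "\<alpha> \<in> Hom2 B f g" "\<beta> \<in> Hom2 B g h" "iso2 B \<alpha>" "iso2 B \<beta>"
  shows "iso2 B (bvcomp B \<beta> \<alpha>)"
proof -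
  obtain \<alpha>' where a: "\<alpha>' \<in> Hom2 B g f" "bvcomp B \<alpha>' \<alpha> = bid2 B f" "bvcomp B \<alpha> \<alpha>' = bid2 B g"
    using iso2_inverse assms by blast
  obtain \<beta>' where b: "\<beta>' \<in> Hom2 B h g" "bvcomp B \<beta>' \<beta> = bid2 B g" "bvcomp B \<beta> \<beta>' = bid2 B h"
    using iso2_inverse assms by blast
  have ba: "bvcomp B \<beta> \<alpha> \<in> Hom2 B f h" and ab': "bvcomp B \<alpha>' \<beta>' \<in> Hom2 B h f"
    using vcomp assms(1,2) a(1) b(1) by blast+
  have "bvcomp B (bvcomp B \<alpha>' \<beta>') (bvcomp B \<beta> \<alpha>) = bid2 B f"
    using vassoc[OF ba b(1) a(1)] vcomp_cancel_inner[OF assms(1,2) b(1,2)] a(2) by simp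
  moreover have "bvcomp B (bvcomp B \<beta> \<alpha>) (bvcomp B \<alpha>' \<beta>') = bid2 B h"
    using vassoc[OF b(1) a(1) ba] vcomp_cancel_outer[OF assms(1) a(1) assms(2) a(3)] b(3) by simp
  ultimately show ?thesis using iso2I[OF ba ab'] by simp
qed

lemma vcomp_cancel_right:
  assumes "\<beta> \<in> Hom2 B h f" "iso2 B \<beta>" "\<alpha> \<in> Hom2 B f g" "\<alpha>' \<in> Hom2 B f g"
    and "bvcomp B \<alpha> \<beta> = bvcomp B \<alpha>' \<beta>"
  shows "\<alpha> = \<alpha>'"
proof -
  obtain \<beta>' where b: "\<beta>' \<in> Hom2 B f h" "bvcomp B \<beta> \<beta>' = bid2 B f" using iso2_inverse assms by blast
  then show ?thesis using vcomp_cancel_outer[OF assms(1) b(1) _ b(2)] assms(3-5) by metis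
qed

lemma iso2_cancel_left:
  assumes "\<alpha> \<in> Hom2 B f g" "\<beta> \<in> Hom2 B g h" "iso2 B \<beta>" "iso2 B (bvcomp B \<beta> \<alpha>)"
  shows "iso2 B \<alpha>"
proof -
  obtain \<beta>' where b: "\<beta>' \<in> Hom2 B h g" "bvcomp B \<beta>' \<beta> = bid2 B g" "iso2 B \<beta>'"
    using iso2_inverse assms by blast
  then have "bvcomp B \<beta>' (bvcomp B \<beta> \<alpha>) = \<alpha>" using vcomp_cancel_inner[OF assms(1,2)] by blast
  then show ?thesis using iso2_vcomp[OF vcomp[OF assms(1,2)] b(1) assms(4) b(3)] by simp
qed

lemma iso2_cancel_right:
  assumes "\<alpha> \<in> Hom2 B f g" "\<beta> \<in> Hom2 B g h" "iso2 B \<alpha>" "iso2 B (bvcomp B \<beta> \<alpha>)"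
  shows "iso2 B \<beta>"
proof -
  obtain \<alpha>' where a: "\<alpha>' \<in> Hom2 B g f" "bvcomp B \<alpha> \<alpha>' = bid2 B g" "iso2 B \<alpha>'"
    using iso2_inverse assms by blast
  then have "bvcomp B (bvcomp B \<beta> \<alpha>) \<alpha>' = \<beta>" using vcomp_cancel_outer[OF assms(1) _ assms(2)] by blast
  then show ?thesis using iso2_vcomp[OF a(1) vcomp[OF assms(1,2)] a(3) assms(4)] by simp
qed

lemma iso2_hcomp:
  assumes "\<alpha> \<in> Hom2 B f f'" "\<beta> \<in> Hom2 B g g'" "btrg B f = bsrc B g" "iso2 B \<alpha>" "iso2 B \<beta>"
  shows "iso2 B (bhcomp B \<beta> \<alpha>)"
proof -
  obtain \<alpha>' where a: "\<alpha>' \<in> Hom2 B f' f" "bvcomp B \<alpha>' \<alpha> = bid2 B f" "bvcomp B \<alpha> \<alpha>' = bid2 B f'"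
    using iso2_inverse assms by blast
  obtain \<beta>' where b: "\<beta>' \<in> Hom2 B g' g" "bvcomp B \<beta>' \<beta> = bid2 B g" "bvcomp B \<beta> \<beta>' = bid2 B g'"
    using iso2_inverse assms by blast
  have t: "btrg B f' = bsrc B g'" using cell[OF assms(1)] cell[OF assms(2)] assms(3) by simp
  have "bvcomp B (bhcomp B \<beta>' \<alpha>') (bhcomp B \<beta> \<alpha>) = bid2 B (bcomp B g f)"
    using interchange[OF assms(1) a(1) assms(2) b(1) assms(3)] a b hcomp_id assms(3)
      cell[OF assms(1)] cell[OF assms(2)] by simp
  moreover have "bvcomp B (bhcomp B \<beta> \<alpha>) (bhcomp B \<beta>' \<alpha>') = bid2 B (bcomp B g' f')"
    using interchange[OF a(1) assms(1) b(1) assms(2) t] a b hcomp_id t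
      cell[OF assms(1)] cell[OF assms(2)] by simp
  ultimately show ?thesis
    using iso2I[OF hcomp[OF assms(1-3)] hcomp[OF a(1) b(1) t]] by simp
qed

text \<open>The right unitor with the identity replaced by an endomorphism \<open>k\<close>
  isomorphic to it through \<open>\<tau>\<close>: a cell \<open>m \<circ> k \<Rightarrow> m\<close>.
  It is what allows a whiskering by \<open>k\<close> to be undone.\<close>

definition absorb :: "'c \<Rightarrow> 'a \<Rightarrow> 'c" where
  "absorb \<tau> m = bvcomp B (brunit B m) (bhcomp B (bid2 B m) \<tau>)"

context
  fixes k \<tau> x
  assumes x: "x \<in> bobj B" and \<tau>: "\<tau> \<in> Hom2 B k (bid1 B x)" "iso2 B \<tau>"
begin

lemma trg_k: "btrg B k = x" "bsrc B k = x" "k \<in> barr B"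
  using cell[OF \<tau>(1)] id1[OF x] by simp_all

lemma absorb:
  assumes m: "m \<in> barr B" "bsrc B m = x"
  shows "absorb \<tau> m \<in> Hom2 B (bcomp B m k) m" "iso2 B (absorb \<tau> m)"
proof -
  have h: "bhcomp B (bid2 B m) \<tau> \<in> Hom2 B (bcomp B m k) (bcomp B m (bid1 B x))"
    using hcomp[OF \<tau>(1) id2[OF m(1)]] trg_k m by simp
  have r: "brunit B m \<in> Hom2 B (bcomp B m (bid1 B x)) m" using runit m by blast
  show "absorb \<tau> m \<in> Hom2 B (bcomp B m k) m" unfolding absorb_def by (rule vcomp[OF h r])
  have "iso2 B (bhcomp B (bid2 B m) \<tau>)"
    using iso2_hcomp[OF \<tau>(1) id2[OF m(1)] _ \<tau>(2) iso2_id[OF m(1)]] trg_k m by simp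
  then show "iso2 B (absorb \<tau> m)" unfolding absorb_def using iso2_vcomp[OF h r] runit m by blast
qed

lemma absorb_natural:
  assumes \<theta>: "\<theta> \<in> Hom2 B m n" "bsrc B m = x"
  shows "bvcomp B \<theta> (absorb \<tau> m) = bvcomp B (absorb \<tau> n) (bhcomp B \<theta> (bid2 B k))"
proof -
  have m: "m \<in> barr B" and n: "n \<in> barr B" "bsrc B n = x" using cell[OF \<theta>(1)] \<theta>(2) by simp_all
  have hm: "bhcomp B (bid2 B m) \<tau> \<in> Hom2 B (bcomp B m k) (bcomp B m (bid1 B x))"
    using hcomp[OF \<tau>(1) id2[OF m]] trg_k \<theta>(2) by simp
  have hn: "bhcomp B (bid2 B n) \<tau> \<in> Hom2 B (bcomp B n k) (bcomp B n (bid1 B x))"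
    using hcomp[OF \<tau>(1) id2[OF n(1)]] trg_k n by simp
  have r: "brunit B m \<in> Hom2 B (bcomp B m (bid1 B x)) m" using runit m \<theta>(2) by blast
  have rn: "brunit B n \<in> Hom2 B (bcomp B n (bid1 B x)) n" using runit n by blast
  have h1: "bhcomp B \<theta> (bid2 B (bid1 B x)) \<in> Hom2 B (bcomp B m (bid1 B x)) (bcomp B n (bid1 B x))"
    using hcomp[OF id2[OF id1(1)[OF x]] \<theta>(1)] id1[OF x] \<theta>(2) by simp
  have hk: "bhcomp B \<theta> (bid2 B k) \<in> Hom2 B (bcomp B m k) (bcomp B n k)"
    using hcomp[OF id2[OF trg_k(3)] \<theta>(1)] trg_k \<theta>(2) by simp
  have "bvcomp B \<theta> (absorb \<tau> m) = bvcomp B (bvcomp B \<theta> (brunit B m)) (bhcomp B (bid2 B m) \<tau>)"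
    unfolding absorb_def using vassoc[OF hm r \<theta>(1)] .
  also have "\<dots> = bvcomp B (brunit B n) (bvcomp B (bhcomp B \<theta> (bid2 B (bid1 B x))) (bhcomp B (bid2 B m) \<tau>))"
    using runit_natural[OF \<theta>(1)] \<theta>(2) vassoc[OF hm h1 rn] by simp
  also have "bvcomp B (bhcomp B \<theta> (bid2 B (bid1 B x))) (bhcomp B (bid2 B m) \<tau>) =
      bhcomp B (bvcomp B \<theta> (bid2 B m)) (bvcomp B (bid2 B (bid1 B x)) \<tau>)"
    using interchange[OF \<tau>(1) id2[OF id1(1)[OF x]] id2[OF m] \<theta>(1)] trg_k \<theta>(2) by simp
  \<comment> \<open>Both expressions are the horizontal composite of \<open>\<theta>\<close> and
    \<open>\<tau>\<close>; the identities change sides so that interchange splits it the other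
    way.\<close>
  also have "\<dots> = bhcomp B (bvcomp B (bid2 B n) \<theta>) (bvcomp B \<tau> (bid2 B k))"
    by (simp add: vid_left[OF \<theta>(1)] vid_left[OF \<tau>(1)] vid_right[OF \<theta>(1)] vid_right[OF \<tau>(1)])
  also have "\<dots> = bvcomp B (bhcomp B (bid2 B n) \<tau>) (bhcomp B \<theta> (bid2 B k))"
    using interchange[OF id2[OF trg_k(3)] \<tau>(1) \<theta>(1) id2[OF n(1)]] trg_k \<theta>(2) by simp
  also have "bvcomp B (brunit B n) \<dots> = bvcomp B (absorb \<tau> n) (bhcomp B \<theta> (bid2 B k))"
    unfolding absorb_def using vassoc[OF hk hn rn] .
  finally show ?thesis .
qed

text \<open>By naturality of \<open>absorb\<close>, \<open>\<theta>\<close> is the whiskered cell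
  conjugated by isomorphisms.\<close>

lemma iso2_unwhisker:
  assumes \<theta>: "\<theta> \<in> Hom2 B m n" "bsrc B m = x" and iso: "iso2 B (bhcomp B \<theta> (bid2 B k))"
  shows "iso2 B \<theta>"
proof -
  have m: "m \<in> barr B" and n: "n \<in> barr B" "bsrc B n = x" using cell[OF \<theta>(1)] \<theta>(2) by simp_all
  have hk: "bhcomp B \<theta> (bid2 B k) \<in> Hom2 B (bcomp B m k) (bcomp B n k)"
    using hcomp[OF id2[OF trg_k(3)] \<theta>(1)] trg_k \<theta>(2) by simp
  show ?thesis
    using iso2_cancel_right[OF absorb(1)[OF m \<theta>(2)] \<theta>(1) absorb(2)[OF m \<theta>(2)]]
      iso2_vcomp[OF hk absorb(1)[OF n] iso absorb(2)[OF n]] absorb_natural[OF \<theta>] by simp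
qed

text \<open>Conjugating \<open>L\<close> by the isomorphisms \<open>absorb\<close> gives the
  candidate; the equation is checked after precomposition with \<open>absorb \<tau> m\<close>, which
  can be cancelled. The one-sided version is stated on its own because it is applied where a
  two-sided inverse is not yet available.\<close>

lemma left_inverse_unwhisker:
  assumes \<theta>: "\<theta> \<in> Hom2 B m n" "bsrc B m = x"
    and L: "L \<in> Hom2 B (bcomp B n k) (bcomp B m k)" "bvcomp B L (bhcomp B \<theta> (bid2 B k)) = bid2 B (bcomp B m k)"
  shows "\<exists>l\<in>Hom2 B n m. bvcomp B l \<theta> = bid2 B m"
proof -
  have m: "m \<in> barr B" and n: "n \<in> barr B" "bsrc B n = x" using cell[OF \<theta>(1)] \<theta>(2) by simp_all
  have hk: "bhcomp B \<theta> (bid2 B k) \<in> Hom2 B (bcomp B m k) (bcomp B n k)"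
    using hcomp[OF id2[OF trg_k(3)] \<theta>(1)] trg_k \<theta>(2) by simp
  note am = absorb[OF m \<theta>(2)] and an = absorb[OF n]
  obtain c where c: "c \<in> Hom2 B n (bcomp B n k)" "bvcomp B c (absorb \<tau> n) = bid2 B (bcomp B n k)"
    using iso2_inverse[OF an] by blast
  let ?l = "bvcomp B (absorb \<tau> m) (bvcomp B L c)"
  have Lc: "bvcomp B L c \<in> Hom2 B n (bcomp B m k)" by (rule vcomp[OF c(1) L(1)])
  have l: "?l \<in> Hom2 B n m" by (rule vcomp[OF Lc am(1)])
  have "bvcomp B (bvcomp B ?l \<theta>) (absorb \<tau> m) = bvcomp B ?l (bvcomp B (absorb \<tau> n) (bhcomp B \<theta> (bid2 B k)))"
    using vassoc[OF am(1) \<theta>(1) l] absorb_natural[OF \<theta>] by simp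
  also have "\<dots> = bvcomp B (absorb \<tau> m) (bvcomp B (bvcomp B L c) (bvcomp B (absorb \<tau> n) (bhcomp B \<theta> (bid2 B k))))"
    using vassoc[OF vcomp[OF hk an(1)] Lc am(1)] by simp
  also have "bvcomp B (bvcomp B L c) (bvcomp B (absorb \<tau> n) (bhcomp B \<theta> (bid2 B k))) =
      bvcomp B L (bvcomp B (bvcomp B c (absorb \<tau> n)) (bhcomp B \<theta> (bid2 B k)))"
    using vassoc[OF vcomp[OF hk an(1)] c(1) L(1)] vassoc[OF hk an(1) c(1)] by simp
  also have "\<dots> = bid2 B (bcomp B m k)"
    using c(2) L(2) vid_left[OF hk] by simp
  also have "bvcomp B (absorb \<tau> m) (bid2 B (bcomp B m k)) = bvcomp B (bid2 B m) (absorb \<tau> m)"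
    using vid_left[OF am(1)] vid_right[OF am(1)] by simp
  finally have "bvcomp B ?l \<theta> = bid2 B m"
    using vcomp_cancel_right[OF am vcomp[OF \<theta>(1) l] id2[OF m]] by simp
  with l show ?thesis by blast
qed

end

end

section \<open>Reversal of 1-morphisms\<close>

definition rev_bicat :: "('o,'a,'c) bicat \<Rightarrow> ('o,'a,'c) bicat" where
  "rev_bicat B = B\<lparr>bsrc := btrg B, btrg := bsrc B, bcomp := (\<lambda>g f. bcomp B f g),
     bhcomp := (\<lambda>\<beta> \<alpha>. bhcomp B \<alpha> \<beta>), blunit := brunit B, brunit := blunit B\<rparr>"

lemma rev_bicat_simps [simp]:
  "bobj (rev_bicat B) = bobj B" "barr (rev_bicat B) = barr B" "bcell (rev_bicat B) = bcell B"
  "bsrc (rev_bicat B) = btrg B" "btrg (rev_bicat B) = bsrc B" "bdom (rev_bicat B) = bdom B"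
  "bcod (rev_bicat B) = bcod B" "bid1 (rev_bicat B) = bid1 B" "bid2 (rev_bicat B) = bid2 B"
  "bcomp (rev_bicat B) g f = bcomp B f g" "bvcomp (rev_bicat B) = bvcomp B"
  "bhcomp (rev_bicat B) \<beta> \<alpha> = bhcomp B \<alpha> \<beta>" "blunit (rev_bicat B) = brunit B"
  "brunit (rev_bicat B) = blunit B"
  by (simp_all add: rev_bicat_def)

lemma Hom2_rev_bicat [simp]: "Hom2 (rev_bicat B) = Hom2 B"
  by (simp add: Hom2_def fun_eq_iff)

lemma iso2_rev_bicat [simp]: "iso2 (rev_bicat B) = iso2 B"
  by (simp add: iso2_def fun_eq_iff)

lemma prebicategory_rev_bicat:
  assumes "prebicategory B"
  shows "prebicategory (rev_bicat B)"
proof -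
  interpret prebicategory B by (rule assms)
  show ?thesis
  proof unfold_locales
    fix \<alpha> f f' \<beta> g g' assume *: "\<alpha> \<in> Hom2 (rev_bicat B) f f'" "\<beta> \<in> Hom2 (rev_bicat B) g g'"
      "btrg (rev_bicat B) f = bsrc (rev_bicat B) g"
    then show "bhcomp (rev_bicat B) \<beta> \<alpha> \<in> Hom2 (rev_bicat B) (bcomp (rev_bicat B) g f) (bcomp (rev_bicat B) g' f')"
      using hcomp[of \<beta> g g' \<alpha> f f'] by simp
  next
    fix \<alpha> f f' \<alpha>' f'' \<beta> g g' \<beta>' g''
    assume "\<alpha> \<in> Hom2 (rev_bicat B) f f'" "\<alpha>' \<in> Hom2 (rev_bicat B) f' f''" "\<beta> \<in> Hom2 (rev_bicat B) g g'"
      "\<beta>' \<in> Hom2 (rev_bicat B) g' g''" "btrg (rev_bicat B) f = bsrc (rev_bicat B) g"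
    then show "bhcomp (rev_bicat B) (bvcomp (rev_bicat B) \<beta>' \<beta>) (bvcomp (rev_bicat B) \<alpha>' \<alpha>) =
       bvcomp (rev_bicat B) (bhcomp (rev_bicat B) \<beta>' \<alpha>') (bhcomp (rev_bicat B) \<beta> \<alpha>)"
      using interchange[of \<beta> g g' \<beta>' g'' \<alpha> f f' \<alpha>' f''] by simp
  qed (simp_all add: arr_obj id1 comp1 id2 hcomp_id lunit runit vid_left vid_right vcomp
      lunit_natural runit_natural vassoc, (erule cell)+)
qed

section \<open>Lax functors with cartesian 1-morphisms\<close>

text \<open>In \<open>lf_assoc\<close>, compatibility with associators is required for some
  invertible cells of the right type. Reversal of 1-morphisms exchanges the two bracketings, and the
  existential form lets the inverse cells take over.\<close>

locale prelax = E: prebicategory E + B: prebicategory B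
  for E :: "('o1,'a1,'c1) bicat" and B :: "('o2,'a2,'c2) bicat" +
  fixes P :: "('o1,'a1,'c1,'o2,'a2,'c2) lax_fun"
  assumes lf_obj: "x \<in> bobj E \<Longrightarrow> lf_obj P x \<in> bobj B"
    and lf_arr: "f \<in> barr E \<Longrightarrow> lf_arr P f \<in> barr B"
      "f \<in> barr E \<Longrightarrow> bsrc B (lf_arr P f) = lf_obj P (bsrc E f)"
      "f \<in> barr E \<Longrightarrow> btrg B (lf_arr P f) = lf_obj P (btrg E f)"
    and lf_cell: "\<alpha> \<in> Hom2 E f g \<Longrightarrow> lf_cell P \<alpha> \<in> Hom2 B (lf_arr P f) (lf_arr P g)"
    and lf_id2: "f \<in> barr E \<Longrightarrow> lf_cell P (bid2 E f) = bid2 B (lf_arr P f)"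
    and lf_vcomp: "\<alpha> \<in> Hom2 E f g \<Longrightarrow> \<beta> \<in> Hom2 E g h \<Longrightarrow>
      lf_cell P (bvcomp E \<beta> \<alpha>) = bvcomp B (lf_cell P \<beta>) (lf_cell P \<alpha>)"
    and lf_cmp: "f \<in> barr E \<Longrightarrow> g \<in> barr E \<Longrightarrow> btrg E f = bsrc E g \<Longrightarrow>
      lf_cmp P g f \<in> Hom2 B (bcomp B (lf_arr P g) (lf_arr P f)) (lf_arr P (bcomp E g f))"
    and lf_unit: "x \<in> bobj E \<Longrightarrow> lf_unit P x \<in> Hom2 B (bid1 B (lf_obj P x)) (lf_arr P (bid1 E x))"
    and lf_cmp_natural: "\<alpha> \<in> Hom2 E f f' \<Longrightarrow> \<beta> \<in> Hom2 E g g' \<Longrightarrow> btrg E f = bsrc E g \<Longrightarrow>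
      bvcomp B (lf_cell P (bhcomp E \<beta> \<alpha>)) (lf_cmp P g f) =
      bvcomp B (lf_cmp P g' f') (bhcomp B (lf_cell P \<beta>) (lf_cell P \<alpha>))"
    and lf_assoc: "f \<in> barr E \<Longrightarrow> g \<in> barr E \<Longrightarrow> h \<in> barr E \<Longrightarrow> btrg E f = bsrc E g \<Longrightarrow> btrg E g = bsrc E h \<Longrightarrow>
      \<exists>a\<in>Hom2 E (bcomp E (bcomp E h g) f) (bcomp E h (bcomp E g f)).
      \<exists>a'\<in>Hom2 B (bcomp B (bcomp B (lf_arr P h) (lf_arr P g)) (lf_arr P f))
                 (bcomp B (lf_arr P h) (bcomp B (lf_arr P g) (lf_arr P f))).
        iso2 E a \<and> iso2 B a' \<and>
        bvcomp B (lf_cell P a)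
          (bvcomp B (lf_cmp P (bcomp E h g) f) (bhcomp B (lf_cmp P h g) (bid2 B (lf_arr P f)))) =
        bvcomp B (lf_cmp P h (bcomp E g f))
          (bvcomp B (bhcomp B (bid2 B (lf_arr P h)) (lf_cmp P g f)) a')"
    and lf_lunit: "f \<in> barr E \<Longrightarrow> blunit B (lf_arr P f) =
        bvcomp B (lf_cell P (blunit E f))
          (bvcomp B (lf_cmp P (bid1 E (btrg E f)) f) (bhcomp B (lf_unit P (btrg E f)) (bid2 B (lf_arr P f))))"
    and lf_runit: "f \<in> barr E \<Longrightarrow> brunit B (lf_arr P f) =
        bvcomp B (lf_cell P (brunit E f))
          (bvcomp B (lf_cmp P f (bid1 E (bsrc E f))) (bhcomp B (bid2 B (lf_arr P f)) (lf_unit P (bsrc E f))))"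
begin

lemma lf_iso2:
  assumes "\<alpha> \<in> Hom2 E f g" "iso2 E \<alpha>"
  shows "iso2 B (lf_cell P \<alpha>)"
proof -
  obtain \<beta> where b: "\<beta> \<in> Hom2 E g f" "bvcomp E \<beta> \<alpha> = bid2 E f" "bvcomp E \<alpha> \<beta> = bid2 E g"
    using E.iso2_inverse[OF assms] by blast
  show ?thesis
    using B.iso2I[OF lf_cell[OF assms(1)] lf_cell[OF b(1)]] lf_vcomp[OF assms(1) b(1)]
      lf_vcomp[OF b(1) assms(1)] b lf_id2 E.cell[OF assms(1)] by simp
qed

end

text \<open>One-sided on purpose: instantiated for \<open>P\<close> it handles postcomposition, for
  the reversed lax functor precomposition. Lifting invertible 2-cells at a given domain is a
  condition that reversal of 1-morphisms leaves unchanged.\<close>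

locale cartesian_lax = prelax E B P
  for E :: "('o1,'a1,'c1) bicat" and B :: "('o2,'a2,'c2) bicat"
    and P :: "('o1,'a1,'c1,'o2,'a2,'c2) lax_fun" +
  assumes cartesian: "f \<in> barr E \<Longrightarrow> cartesian E B P f"
    and iso_lift: "g \<in> barr E \<Longrightarrow> \<theta> \<in> Hom2 B (lf_arr P g) u \<Longrightarrow> iso2 B \<theta> \<Longrightarrow>
      \<exists>g' \<psi>. \<psi> \<in> Hom2 E g g' \<and> iso2 E \<psi> \<and> lf_arr P g' = u \<and> lf_cell P \<psi> = \<theta>"
begin

section \<open>Invertibility of the unit and structure cells\<close>

lemma cartesian_exists:
  assumes "f \<in> barr E" "g \<in> barr E" "h \<in> barr B" "btrg E g = btrg E f"
    and "bsrc B h = lf_obj P (bsrc E g)" "btrg B h = lf_obj P (bsrc E f)"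
    and "\<alpha> \<in> Hom2 B (bcomp B (lf_arr P f) h) (lf_arr P g)" "iso2 B \<alpha>"
  shows "\<exists>ht al bt. cart_lift E B P f g h \<alpha> ht al bt"
  using cartesian[OF assms(1)] assms unfolding cartesian_def by blast

text \<open>Lifting the right unitor through the identity \<open>e\<close> of \<open>x\<close> gives
  \<open>k\<close> with \<open>P k\<close> isomorphic to an identity, and the lift equation makes
  the structure cell at \<open>(e, k)\<close> invertible. In the left unit law at \<open>k\<close>,
  the unit cell whiskered by \<open>P k\<close> is then the only factor not known to be invertible,
  so it is invertible too, and the whiskering can be removed.\<close>

lemma lf_unit_iso:
  assumes x: "x \<in> bobj E"
  shows "iso2 B (lf_unit P x)"
proof -
  let ?e = "bid1 E x" and ?b = "lf_obj P x"
  have e: "?e \<in> barr E" "bsrc E ?e = x" "btrg E ?e = x" using E.id1 x by auto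
  have b: "?b \<in> bobj B" using lf_obj x by blast
  have Pe: "lf_arr P ?e \<in> barr B" "bsrc B (lf_arr P ?e) = ?b" "btrg B (lf_arr P ?e) = ?b"
    using lf_arr[OF e(1)] e by simp_all
  have r: "brunit B (lf_arr P ?e) \<in> Hom2 B (bcomp B (lf_arr P ?e) (bid1 B ?b)) (lf_arr P ?e)"
    "iso2 B (brunit B (lf_arr P ?e))"
    using B.runit[OF Pe(1)] Pe(2) by simp_all
  obtain k al bt where "cart_lift E B P ?e ?e (bid1 B ?b) (brunit B (lf_arr P ?e)) k al bt"
    using cartesian_exists[OF e(1) e(1) B.id1(1)[OF b] refl _ _ r] B.id1[OF b] e by auto
  then have k: "k \<in> barr E" "bsrc E k = x" "btrg E k = x"
    and al: "al \<in> Hom2 E (bcomp E ?e k) ?e" "iso2 E al"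
    and bt: "bt \<in> Hom2 B (lf_arr P k) (bid1 B ?b)" "iso2 B bt"
    and eq: "B.absorb bt (lf_arr P ?e) = bvcomp B (lf_cell P al) (lf_cmp P ?e k)"
    using e unfolding cart_lift_def B.absorb_def by simp_all
  have cmp: "lf_cmp P ?e k \<in> Hom2 B (bcomp B (lf_arr P ?e) (lf_arr P k)) (lf_arr P (bcomp E ?e k))"
    using lf_cmp[OF k(1) e(1)] k e by simp
  have iso_cmp: "iso2 B (lf_cmp P ?e k)"
    using B.iso2_cancel_left[OF cmp lf_cell[OF al(1)] lf_iso2[OF al]]
      B.absorb(2)[OF b bt Pe(1,2)] eq by simp
  have Pk: "lf_arr P k \<in> barr B" "btrg B (lf_arr P k) = ?b"
    using lf_arr[OF k(1)] k by simp_all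
  have w: "bhcomp B (lf_unit P x) (bid2 B (lf_arr P k)) \<in>
      Hom2 B (bcomp B (bid1 B ?b) (lf_arr P k)) (bcomp B (lf_arr P ?e) (lf_arr P k))"
    using B.hcomp[OF B.id2[OF Pk(1)] lf_unit[OF x]] Pk(2) B.id1[OF b] by simp
  have l: "blunit E k \<in> Hom2 E (bcomp E ?e k) k" "iso2 E (blunit E k)"
    using E.lunit[OF k(1)] k by simp_all
  have "iso2 B (bvcomp B (lf_cmp P ?e k) (bhcomp B (lf_unit P x) (bid2 B (lf_arr P k))))"
    using B.iso2_cancel_left[OF B.vcomp[OF w cmp] lf_cell[OF l(1)] lf_iso2[OF l]]
      lf_lunit[OF k(1)] k B.lunit(2)[OF Pk(1)] by simp
  then have "iso2 B (bhcomp B (lf_unit P x) (bid2 B (lf_arr P k)))"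
    using B.iso2_cancel_left[OF w cmp iso_cmp] by blast
  then show ?thesis
    using B.iso2_unwhisker[OF b bt lf_unit[OF x]] B.id1[OF b] by simp
qed

text \<open>In the right unit law every other factor is invertible once the unit cell is.\<close>

lemma lf_cmp_id_iso:
  assumes p: "p \<in> barr E"
  shows "iso2 B (lf_cmp P p (bid1 E (bsrc E p)))"
proof -
  let ?x = "bsrc E p"
  let ?e = "bid1 E ?x"
  have x: "?x \<in> bobj E" using E.arr_obj p by blast
  have e: "?e \<in> barr E" "bsrc E ?e = ?x" "btrg E ?e = ?x" using E.id1 x by auto
  have b: "lf_obj P ?x \<in> bobj B" using lf_obj x by blast
  have Pp: "lf_arr P p \<in> barr B" "bsrc B (lf_arr P p) = lf_obj P ?x" using lf_arr[OF p] by simp_all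
  have cmp: "lf_cmp P p ?e \<in> Hom2 B (bcomp B (lf_arr P p) (lf_arr P ?e)) (lf_arr P (bcomp E p ?e))"
    using lf_cmp[OF e(1) p] e by simp
  have w: "bhcomp B (bid2 B (lf_arr P p)) (lf_unit P ?x) \<in>
      Hom2 B (bcomp B (lf_arr P p) (bid1 B (lf_obj P ?x))) (bcomp B (lf_arr P p) (lf_arr P ?e))"
    "iso2 B (bhcomp B (bid2 B (lf_arr P p)) (lf_unit P ?x))"
    using B.hcomp[OF lf_unit[OF x] B.id2[OF Pp(1)]] B.id1[OF b] Pp
      B.iso2_hcomp[OF lf_unit[OF x] B.id2[OF Pp(1)] _ lf_unit_iso[OF x] B.iso2_id[OF Pp(1)]] by simp_all
  have r: "brunit E p \<in> Hom2 E (bcomp E p ?e) p" "iso2 E (brunit E p)"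
    using E.runit[OF p] by simp_all
  have "iso2 B (bvcomp B (lf_cmp P p ?e) (bhcomp B (bid2 B (lf_arr P p)) (lf_unit P ?x)))"
    using B.iso2_cancel_left[OF B.vcomp[OF w(1) cmp] lf_cell[OF r(1)] lf_iso2[OF r]]
      lf_runit[OF p] B.runit(2)[OF Pp(1)] by simp
  then show ?thesis using B.iso2_cancel_right[OF w(1) cmp w(2)] by blast
qed

lemma lf_cmp_iso_id_iso:
  assumes p: "p \<in> barr E" and al: "al \<in> Hom2 E m (bid1 E (bsrc E p))" "iso2 E al"
  shows "iso2 B (lf_cmp P p m)"
proof -
  let ?e = "bid1 E (bsrc E p)"
  have e: "?e \<in> barr E" "bsrc E ?e = bsrc E p" "btrg E ?e = bsrc E p"
    using E.id1 E.arr_obj p by auto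
  have m: "m \<in> barr E" "btrg E m = bsrc E p" using E.cell[OF al(1)] e by simp_all
  have Pp: "lf_arr P p \<in> barr B" using lf_arr p by blast
  have t: "btrg B (lf_arr P m) = bsrc B (lf_arr P p)" using lf_arr m p by simp
  have cm: "lf_cmp P p m \<in> Hom2 B (bcomp B (lf_arr P p) (lf_arr P m)) (lf_arr P (bcomp E p m))"
    using lf_cmp[OF m(1) p] m by simp
  have ce: "lf_cmp P p ?e \<in> Hom2 B (bcomp B (lf_arr P p) (lf_arr P ?e)) (lf_arr P (bcomp E p ?e))"
    using lf_cmp[OF e(1) p] e by simp
  have hB: "bhcomp B (bid2 B (lf_arr P p)) (lf_cell P al) \<in>
      Hom2 B (bcomp B (lf_arr P p) (lf_arr P m)) (bcomp B (lf_arr P p) (lf_arr P ?e))"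
    "iso2 B (bhcomp B (bid2 B (lf_arr P p)) (lf_cell P al))"
    using B.hcomp[OF lf_cell[OF al(1)] B.id2[OF Pp] t]
      B.iso2_hcomp[OF lf_cell[OF al(1)] B.id2[OF Pp] t lf_iso2[OF al] B.iso2_id[OF Pp]] by simp_all
  have hE: "bhcomp E (bid2 E p) al \<in> Hom2 E (bcomp E p m) (bcomp E p ?e)"
    "iso2 E (bhcomp E (bid2 E p) al)"
    using E.hcomp[OF al(1) E.id2[OF p] m(2)]
      E.iso2_hcomp[OF al(1) E.id2[OF p] m(2) al(2) E.iso2_id[OF p]] by simp_all
  have "bvcomp B (lf_cell P (bhcomp E (bid2 E p) al)) (lf_cmp P p m) =
      bvcomp B (lf_cmp P p ?e) (bhcomp B (bid2 B (lf_arr P p)) (lf_cell P al))"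
    using lf_cmp_natural[OF al(1) E.id2[OF p] m(2)] lf_id2[OF p] by simp
  moreover have "iso2 B \<dots>"
    using B.iso2_vcomp[OF hB(1) ce hB(2) lf_cmp_id_iso[OF p]] .
  ultimately show ?thesis
    using B.iso2_cancel_left[OF cm lf_cell[OF hE(1)] lf_iso2[OF hE]] by simp
qed

text \<open>The identity of the target lifts through the cartesian \<open>h\<close> because
  \<open>P h\<close> is isomorphic to an identity; this gives a section \<open>k\<close> up to
  isomorphism. The lift equation again exhibits the structure cell at \<open>(h, k)\<close> as an
  isomorphism.\<close>

lemma vertical_section:
  assumes h: "h \<in> barr E" and b: "b \<in> bobj B"
    and \<tau>: "\<tau> \<in> Hom2 B (lf_arr P h) (bid1 B b)" "iso2 B \<tau>"
  shows "\<exists>k al bt. k \<in> barr E \<and> bsrc E k = btrg E h \<and> btrg E k = bsrc E h \<and>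
    al \<in> Hom2 E (bcomp E h k) (bid1 E (btrg E h)) \<and> iso2 E al \<and>
    bt \<in> Hom2 B (lf_arr P k) (bid1 B b) \<and> iso2 B bt \<and> iso2 B (lf_cmp P h k)"
proof -
  let ?y = "btrg E h" and ?Ph = "lf_arr P h"
  let ?e = "bid1 E ?y"
  have y: "?y \<in> bobj E" using E.arr_obj h by blast
  have e: "?e \<in> barr E" "bsrc E ?e = ?y" "btrg E ?e = ?y" using E.id1 y by auto
  have Ph: "?Ph \<in> barr B" "bsrc B ?Ph = b" "btrg B ?Ph = b"
    using B.cell[OF \<tau>(1)] B.id1[OF b] by simp_all
  have obj: "lf_obj P ?y = b" "lf_obj P (bsrc E h) = b" using Ph lf_arr[OF h] by simp_all
  have r: "brunit B ?Ph \<in> Hom2 B (bcomp B ?Ph (bid1 B b)) ?Ph" "iso2 B (brunit B ?Ph)"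
    using B.runit[OF Ph(1)] Ph(2) by simp_all
  have u: "lf_unit P ?y \<in> Hom2 B (bid1 B b) (lf_arr P ?e)" using lf_unit[OF y] obj by simp
  \<comment> \<open>The cell runs from \<open>P h \<circ> id\<close> to \<open>P h\<close>, on to
    the identity of \<open>b\<close> by \<open>\<tau>\<close>, and to \<open>P\<close> of the
    identity of the target; its last factor is invertible by \<open>lf_unit_iso\<close>.\<close>
  define \<alpha> where "\<alpha> = bvcomp B (bvcomp B (lf_unit P ?y) \<tau>) (brunit B ?Ph)"
  have \<alpha>: "\<alpha> \<in> Hom2 B (bcomp B ?Ph (bid1 B b)) (lf_arr P ?e)" "iso2 B \<alpha>"
    unfolding \<alpha>_def
    using B.vcomp[OF r(1) B.vcomp[OF \<tau>(1) u]]
      B.iso2_vcomp[OF r(1) B.vcomp[OF \<tau>(1) u] r(2) B.iso2_vcomp[OF \<tau>(1) u \<tau>(2) lf_unit_iso[OF y]]] by simp_all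
  obtain k al bt where "cart_lift E B P h ?e (bid1 B b) \<alpha> k al bt"
    using cartesian_exists[OF h e(1) B.id1(1)[OF b] _ _ _ \<alpha>] e obj B.id1[OF b] by auto
  then have k: "k \<in> barr E" "bsrc E k = ?y" "btrg E k = bsrc E h"
    and al: "al \<in> Hom2 E (bcomp E h k) ?e" "iso2 E al"
    and bt: "bt \<in> Hom2 B (lf_arr P k) (bid1 B b)" "iso2 B bt"
    and eq: "bvcomp B \<alpha> (bhcomp B (bid2 B ?Ph) bt) = bvcomp B (lf_cell P al) (lf_cmp P h k)"
    using e unfolding cart_lift_def by simp_all
  have t: "btrg B (lf_arr P k) = bsrc B ?Ph" using lf_arr k Ph obj by simp
  have w: "bhcomp B (bid2 B ?Ph) bt \<in> Hom2 B (bcomp B ?Ph (lf_arr P k)) (bcomp B ?Ph (bid1 B b))"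
    "iso2 B (bhcomp B (bid2 B ?Ph) bt)"
    using B.hcomp[OF bt(1) B.id2[OF Ph(1)] t]
      B.iso2_hcomp[OF bt(1) B.id2[OF Ph(1)] t bt(2) B.iso2_id[OF Ph(1)]] by simp_all
  have cmp: "lf_cmp P h k \<in> Hom2 B (bcomp B ?Ph (lf_arr P k)) (lf_arr P (bcomp E h k))"
    using lf_cmp[OF k(1) h k(3)] .
  have "iso2 B (lf_cmp P h k)"
    using B.iso2_cancel_left[OF cmp lf_cell[OF al(1)] lf_iso2[OF al]]
      B.iso2_vcomp[OF w(1) \<alpha>(1) w(2) \<alpha>(2)] eq by simp
  then show ?thesis using k al bt by blast
qed

text \<open>With a section \<open>k\<close> of \<open>h\<close>, associativity exhibits an isomorphism as a composite
  of the whiskered structure cell at \<open>(p, h)\<close> with the one at \<open>(p \<circ> h, k)\<close>.\<close>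

lemma lf_cmp_section:
  assumes p: "p \<in> barr E" and h: "h \<in> barr E" "btrg E h = bsrc E p" and b: "b \<in> bobj B"
    and \<tau>: "\<tau> \<in> Hom2 B (lf_arr P h) (bid1 B b)" "iso2 B \<tau>"
  obtains k \<kappa> where "k \<in> barr E" "btrg E k = bsrc E h"
    "\<kappa> \<in> Hom2 B (lf_arr P k) (bid1 B b)" "iso2 B \<kappa>"
    "iso2 B (bvcomp B (lf_cmp P (bcomp E p h) k) (bhcomp B (lf_cmp P p h) (bid2 B (lf_arr P k))))"
proof -
  obtain k al \<kappa> where k: "k \<in> barr E" "bsrc E k = btrg E h" "btrg E k = bsrc E h"
    and al: "al \<in> Hom2 E (bcomp E h k) (bid1 E (bsrc E p))" "iso2 E al"
    and \<kappa>: "\<kappa> \<in> Hom2 B (lf_arr P k) (bid1 B b)" "iso2 B \<kappa>" and hk: "iso2 B (lf_cmp P h k)"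
    using vertical_section[OF h(1) b \<tau>] h(2) by auto
  let ?Pp = "lf_arr P p" and ?Ph = "lf_arr P h" and ?Pk = "lf_arr P k"
  have arr: "?Pp \<in> barr B" "?Ph \<in> barr B" "?Pk \<in> barr B" using lf_arr p h k by blast+
  have t: "btrg B ?Pk = bsrc B ?Ph" "btrg B ?Ph = bsrc B ?Pp" using lf_arr p h k by simp_all
  have ph: "bcomp E p h \<in> barr E" "bsrc E (bcomp E p h) = bsrc E h" using E.comp1[OF h(1) p h(2)] by blast+
  have hk': "bcomp E h k \<in> barr E" "btrg E (bcomp E h k) = btrg E h"
    "bsrc E (bcomp E h k) = bsrc E k" using E.comp1[OF k(1) h(1) k(3)] by blast+
  obtain a a' where a: "a \<in> Hom2 E (bcomp E (bcomp E p h) k) (bcomp E p (bcomp E h k))" "iso2 E a"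
    and a': "a' \<in> Hom2 B (bcomp B (bcomp B ?Pp ?Ph) ?Pk) (bcomp B ?Pp (bcomp B ?Ph ?Pk))" "iso2 B a'"
    and eq: "bvcomp B (lf_cell P a) (bvcomp B (lf_cmp P (bcomp E p h) k) (bhcomp B (lf_cmp P p h) (bid2 B ?Pk))) =
        bvcomp B (lf_cmp P p (bcomp E h k)) (bvcomp B (bhcomp B (bid2 B ?Pp) (lf_cmp P h k)) a')"
    using lf_assoc[OF k(1) h(1) p k(3) h(2)] by blast
  have c1: "lf_cmp P p h \<in> Hom2 B (bcomp B ?Pp ?Ph) (lf_arr P (bcomp E p h))"
    using lf_cmp[OF h(1) p h(2)] .
  have c2: "lf_cmp P (bcomp E p h) k \<in> Hom2 B (bcomp B (lf_arr P (bcomp E p h)) ?Pk) (lf_arr P (bcomp E (bcomp E p h) k))"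
    using lf_cmp[OF k(1) ph(1)] ph k by simp
  have c3: "lf_cmp P h k \<in> Hom2 B (bcomp B ?Ph ?Pk) (lf_arr P (bcomp E h k))"
    using lf_cmp[OF k(1) h(1) k(3)] .
  have c4: "lf_cmp P p (bcomp E h k) \<in> Hom2 B (bcomp B ?Pp (lf_arr P (bcomp E h k))) (lf_arr P (bcomp E p (bcomp E h k)))"
    using lf_cmp[OF hk'(1) p] hk' h by simp
  have t1: "btrg B ?Pk = bsrc B (bcomp B ?Pp ?Ph)" using B.comp1[OF arr(2,1) t(2)] t by simp
  have t2: "btrg B (bcomp B ?Ph ?Pk) = bsrc B ?Pp" using B.comp1[OF arr(3,2) t(1)] t by simp
  have w1: "bhcomp B (lf_cmp P p h) (bid2 B ?Pk) \<in>
      Hom2 B (bcomp B (bcomp B ?Pp ?Ph) ?Pk) (bcomp B (lf_arr P (bcomp E p h)) ?Pk)"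
    using B.hcomp[OF B.id2[OF arr(3)] c1 t1] .
  have w3: "bhcomp B (bid2 B ?Pp) (lf_cmp P h k) \<in>
      Hom2 B (bcomp B ?Pp (bcomp B ?Ph ?Pk)) (bcomp B ?Pp (lf_arr P (bcomp E h k)))"
    "iso2 B (bhcomp B (bid2 B ?Pp) (lf_cmp P h k))"
    using B.hcomp[OF c3 B.id2[OF arr(1)] t2] B.iso2_hcomp[OF c3 B.id2[OF arr(1)] t2 hk B.iso2_id[OF arr(1)]]
    by blast+
  have "iso2 B (bvcomp B (lf_cmp P p (bcomp E h k)) (bvcomp B (bhcomp B (bid2 B ?Pp) (lf_cmp P h k)) a'))"
    using B.iso2_vcomp[OF B.vcomp[OF a'(1) w3(1)] c4 B.iso2_vcomp[OF a'(1) w3(1) a'(2) w3(2)]]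
      lf_cmp_iso_id_iso[OF p al] by blast
  then have "iso2 B (bvcomp B (lf_cmp P (bcomp E p h) k) (bhcomp B (lf_cmp P p h) (bid2 B ?Pk)))"
    using B.iso2_cancel_left[OF B.vcomp[OF w1 c2] lf_cell[OF a(1)] lf_iso2[OF a]] eq by simp
  then show ?thesis using that k \<kappa> by blast
qed

lemma lf_cmp_whisker:
  assumes p: "p \<in> barr E" and h: "h \<in> barr E" "btrg E h = bsrc E p"
    and k: "k \<in> barr E" "btrg E k = bsrc E h"
  shows "bhcomp B (lf_cmp P p h) (bid2 B (lf_arr P k)) \<in>
      Hom2 B (bcomp B (bcomp B (lf_arr P p) (lf_arr P h)) (lf_arr P k))
        (bcomp B (lf_arr P (bcomp E p h)) (lf_arr P k))"
    and "lf_cmp P (bcomp E p h) k \<in>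
      Hom2 B (bcomp B (lf_arr P (bcomp E p h)) (lf_arr P k)) (lf_arr P (bcomp E (bcomp E p h) k))"
    and "lf_cmp P p h \<in> Hom2 B (bcomp B (lf_arr P p) (lf_arr P h)) (lf_arr P (bcomp E p h))"
    and "bsrc B (bcomp B (lf_arr P p) (lf_arr P h)) = lf_obj P (bsrc E h)"
proof -
  have ph: "bcomp E p h \<in> barr E" "bsrc E (bcomp E p h) = bsrc E h" using E.comp1[OF h(1) p h(2)] by blast+
  show c: "lf_cmp P p h \<in> Hom2 B (bcomp B (lf_arr P p) (lf_arr P h)) (lf_arr P (bcomp E p h))"
    using lf_cmp[OF h(1) p h(2)] .
  show "lf_cmp P (bcomp E p h) k \<in>
      Hom2 B (bcomp B (lf_arr P (bcomp E p h)) (lf_arr P k)) (lf_arr P (bcomp E (bcomp E p h) k))"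
    using lf_cmp[OF k(1) ph(1)] ph k by simp
  show s: "bsrc B (bcomp B (lf_arr P p) (lf_arr P h)) = lf_obj P (bsrc E h)"
    using B.comp1[of "lf_arr P h" "lf_arr P p"] lf_arr p h by simp
  show "bhcomp B (lf_cmp P p h) (bid2 B (lf_arr P k)) \<in>
      Hom2 B (bcomp B (bcomp B (lf_arr P p) (lf_arr P h)) (lf_arr P k))
        (bcomp B (lf_arr P (bcomp E p h)) (lf_arr P k))"
    using B.hcomp[OF B.id2[OF lf_arr(1)[OF k(1)]] c] s lf_arr k by simp
qed

lemma vertical_obj:
  assumes "h \<in> barr E" "b \<in> bobj B" "\<tau> \<in> Hom2 B (lf_arr P h) (bid1 B b)"
  shows "lf_obj P (bsrc E h) = b" "lf_obj P (btrg E h) = b"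
  using B.cell[OF assms(3)] B.id1[OF assms(2)] lf_arr[OF assms(1)] by simp_all

lemma lf_cmp_left_inverse:
  assumes p: "p \<in> barr E" and h: "h \<in> barr E" "btrg E h = bsrc E p" and b: "b \<in> bobj B"
    and \<tau>: "\<tau> \<in> Hom2 B (lf_arr P h) (bid1 B b)" "iso2 B \<tau>"
  shows "\<exists>l\<in>Hom2 B (lf_arr P (bcomp E p h)) (bcomp B (lf_arr P p) (lf_arr P h)).
    bvcomp B l (lf_cmp P p h) = bid2 B (bcomp B (lf_arr P p) (lf_arr P h))"
proof -
  obtain k \<kappa> where k: "k \<in> barr E" "btrg E k = bsrc E h"
    and \<kappa>: "\<kappa> \<in> Hom2 B (lf_arr P k) (bid1 B b)" "iso2 B \<kappa>"
    and iso: "iso2 B (bvcomp B (lf_cmp P (bcomp E p h) k) (bhcomp B (lf_cmp P p h) (bid2 B (lf_arr P k))))"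
    using lf_cmp_section[OF p h b \<tau>] by blast
  note w = lf_cmp_whisker[OF p h k]
  obtain s where s: "s \<in> Hom2 B (lf_arr P (bcomp E (bcomp E p h) k))
      (bcomp B (bcomp B (lf_arr P p) (lf_arr P h)) (lf_arr P k))"
    "bvcomp B s (bvcomp B (lf_cmp P (bcomp E p h) k) (bhcomp B (lf_cmp P p h) (bid2 B (lf_arr P k)))) =
      bid2 B (bcomp B (bcomp B (lf_arr P p) (lf_arr P h)) (lf_arr P k))"
    using B.iso2_inverse[OF B.vcomp[OF w(1,2)] iso] by blast
  show ?thesis
    using B.left_inverse_unwhisker[OF b \<kappa> w(3) _ B.vcomp[OF w(2) s(1)]]
      B.vassoc[OF w(1,2) s(1)] s(2) w(4) vertical_obj[OF h(1) b \<tau>(1)] by simp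
qed

text \<open>The cell at \<open>(p \<circ> h, k)\<close> has a right inverse, being the outer factor
  of an isomorphism, and a left inverse by \<open>lf_cmp_left_inverse\<close>, because
  \<open>k\<close> is again vertical up to isomorphism. Once invertible it can be cancelled, which
  leaves the whiskered cell at \<open>(p, h)\<close>.\<close>

lemma lf_cmp_iso_of_vertical:
  assumes p: "p \<in> barr E" and h: "h \<in> barr E" "btrg E h = bsrc E p" and b: "b \<in> bobj B"
    and \<tau>: "\<tau> \<in> Hom2 B (lf_arr P h) (bid1 B b)" "iso2 B \<tau>"
  shows "iso2 B (lf_cmp P p h)"
proof -
  obtain k \<kappa> where k: "k \<in> barr E" "btrg E k = bsrc E h"
    and \<kappa>: "\<kappa> \<in> Hom2 B (lf_arr P k) (bid1 B b)" "iso2 B \<kappa>"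
    and iso: "iso2 B (bvcomp B (lf_cmp P (bcomp E p h) k) (bhcomp B (lf_cmp P p h) (bid2 B (lf_arr P k))))"
    using lf_cmp_section[OF p h b \<tau>] by blast
  note w = lf_cmp_whisker[OF p h k]
  obtain s where s: "s \<in> Hom2 B (lf_arr P (bcomp E (bcomp E p h) k))
      (bcomp B (bcomp B (lf_arr P p) (lf_arr P h)) (lf_arr P k))"
    "bvcomp B (bvcomp B (lf_cmp P (bcomp E p h) k) (bhcomp B (lf_cmp P p h) (bid2 B (lf_arr P k)))) s =
      bid2 B (lf_arr P (bcomp E (bcomp E p h) k))"
    using B.iso2_inverse[OF B.vcomp[OF w(1,2)] iso] by blast
  have ph: "bcomp E p h \<in> barr E" "bsrc E (bcomp E p h) = bsrc E h" using E.comp1[OF h(1) p h(2)] by blast+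
  have "\<exists>l\<in>Hom2 B (lf_arr P (bcomp E (bcomp E p h) k)) (bcomp B (lf_arr P (bcomp E p h)) (lf_arr P k)).
    bvcomp B l (lf_cmp P (bcomp E p h) k) = bid2 B (bcomp B (lf_arr P (bcomp E p h)) (lf_arr P k))"
    using lf_cmp_left_inverse[OF ph(1) k(1) _ b \<kappa>] ph k by simp
  moreover have "bvcomp B (lf_cmp P (bcomp E p h) k) (bvcomp B (bhcomp B (lf_cmp P p h) (bid2 B (lf_arr P k))) s) =
      bid2 B (lf_arr P (bcomp E (bcomp E p h) k))"
    using B.vassoc[OF s(1) w(1,2)] s(2) by simp
  ultimately have "iso2 B (lf_cmp P (bcomp E p h) k)"
    using B.iso2_left_right_inverse[OF w(2) _ _ B.vcomp[OF s(1) w(1)]] by blast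
  then have "iso2 B (bhcomp B (lf_cmp P p h) (bid2 B (lf_arr P k)))"
    using B.iso2_cancel_left[OF w(1,2) _ iso] by blast
  then show ?thesis
    using B.iso2_unwhisker[OF b \<kappa> w(3)] w(4) vertical_obj[OF h(1) b \<tau>(1)] by simp
qed

text \<open>A cartesian lift of the right unitor whose cell \<open>bt\<close> is an identity, so
  that \<open>h\<close> lies strictly over an identity and \<open>g\<close> strictly over
  \<open>P p\<close>. It is kept as a relation between \<open>h\<close> and \<open>g\<close>, the
  form that \<open>euler_value_transfer\<close> takes.\<close>

definition strict_lift :: "'a1 \<Rightarrow> 'a1 \<Rightarrow> 'a1 \<Rightarrow> 'c1 \<Rightarrow> bool" where
  "strict_lift p h g al \<longleftrightarrow>
     p \<in> barr E \<and> h \<in> barr E \<and> g \<in> barr E \<and> btrg E h = bsrc E p \<and> bsrc E g = bsrc E h \<and> btrg E g = btrg E p \<and>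
     lf_arr P h = bid1 B (lf_obj P (bsrc E p)) \<and> lf_arr P g = lf_arr P p \<and>
     al \<in> Hom2 E (bcomp E p h) g \<and> iso2 E al \<and>
     bvcomp B (lf_cell P al) (lf_cmp P p h) = brunit B (lf_arr P p)"

text \<open>Cartesianness gives a lift \<open>k\<close> that lies over an identity only up to
  \<open>bt\<close>. Lifting \<open>bt\<close> to an isomorphism \<open>k \<Rightarrow> h\<close>
  makes it strict, and the inverse of that isomorphism, whiskered by \<open>p\<close>, corrects
  \<open>al\<close>.\<close>

lemma strict_lift_of_codomain:
  assumes p: "p \<in> barr E" and g: "g \<in> barr E" "btrg E g = btrg E p" "lf_arr P g = lf_arr P p"
  shows "\<exists>h al. strict_lift p h g al"
proof -
  let ?b = "lf_obj P (bsrc E p)" and ?f = "lf_arr P p"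
  have b: "?b \<in> bobj B" using lf_obj E.arr_obj p by blast
  have Pp: "?f \<in> barr B" "bsrc B ?f = ?b" using lf_arr[OF p] by simp_all
  have sg: "lf_obj P (bsrc E g) = ?b" using lf_arr(2)[OF g(1)] g(3) Pp by simp
  note r = B.runit[OF Pp(1), unfolded Pp(2)]
  obtain k al bt where "cart_lift E B P p g (bid1 B ?b) (brunit B ?f) k al bt"
    using cartesian_exists[OF p g(1) B.id1(1)[OF b] g(2) _ _ _ r(2)] r(1) g(3) B.id1[OF b] sg by auto
  then have k: "k \<in> barr E" "bsrc E k = bsrc E g" "btrg E k = bsrc E p"
    and al: "al \<in> Hom2 E (bcomp E p k) g" "iso2 E al"
    and bt: "bt \<in> Hom2 B (lf_arr P k) (bid1 B ?b)" "iso2 B bt"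
    and eq: "bvcomp B (brunit B ?f) (bhcomp B (bid2 B ?f) bt) = bvcomp B (lf_cell P al) (lf_cmp P p k)"
    unfolding cart_lift_def by simp_all
  obtain h \<psi> where \<psi>: "\<psi> \<in> Hom2 E k h" "iso2 E \<psi>" "lf_arr P h = bid1 B ?b" "lf_cell P \<psi> = bt"
    using iso_lift[OF k(1) bt] by blast
  have h: "h \<in> barr E" "bsrc E h = bsrc E g" "btrg E h = bsrc E p" using E.cell[OF \<psi>(1)] k by simp_all
  obtain \<psi>' where \<psi>': "\<psi>' \<in> Hom2 E h k" "bvcomp E \<psi> \<psi>' = bid2 E h" "iso2 E \<psi>'"
    using E.iso2_inverse[OF \<psi>(1,2)] by blast
  have c: "lf_cmp P p h \<in> Hom2 B (bcomp B ?f (bid1 B ?b)) (lf_arr P (bcomp E p h))"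
    and ck: "lf_cmp P p k \<in> Hom2 B (bcomp B ?f (lf_arr P k)) (lf_arr P (bcomp E p k))"
    using lf_cmp[OF h(1) p h(3)] lf_cmp[OF k(1) p k(3)] \<psi>(3) by simp_all
  have w: "bhcomp E (bid2 E p) \<psi>' \<in> Hom2 E (bcomp E p h) (bcomp E p k)"
    "iso2 E (bhcomp E (bid2 E p) \<psi>')"
    using E.hcomp[OF \<psi>'(1) E.id2[OF p] h(3)] E.iso2_hcomp[OF \<psi>'(1) E.id2[OF p] h(3) \<psi>'(3) E.iso2_id[OF p]]
    by blast+
  let ?c = "bvcomp E al (bhcomp E (bid2 E p) \<psi>')"
  have P\<psi>': "lf_cell P \<psi>' \<in> Hom2 B (bid1 B ?b) (lf_arr P k)" "bvcomp B bt (lf_cell P \<psi>') = bid2 B (bid1 B ?b)"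
    using lf_cell[OF \<psi>'(1)] lf_vcomp[OF \<psi>'(1) \<psi>(1)] \<psi>'(2) \<psi>(3,4) lf_id2[OF h(1)] by simp_all
  have t: "btrg B (bid1 B ?b) = bsrc B ?f" using B.id1[OF b] Pp by simp
  have wB: "bhcomp B (bid2 B ?f) (lf_cell P \<psi>') \<in> Hom2 B (bcomp B ?f (bid1 B ?b)) (bcomp B ?f (lf_arr P k))"
    using B.hcomp[OF P\<psi>'(1) B.id2[OF Pp(1)] t] .
  have wbt: "bhcomp B (bid2 B ?f) bt \<in> Hom2 B (bcomp B ?f (lf_arr P k)) (bcomp B ?f (bid1 B ?b))"
    using B.hcomp[OF bt(1) B.id2[OF Pp(1)]] B.cell[OF bt(1)] t by simp
  have "bvcomp B (lf_cell P ?c) (lf_cmp P p h) =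
      bvcomp B (lf_cell P al) (bvcomp B (lf_cell P (bhcomp E (bid2 E p) \<psi>')) (lf_cmp P p h))"
    using lf_vcomp[OF w(1) al(1)] B.vassoc[OF c lf_cell[OF w(1)] lf_cell[OF al(1)]] by simp
  also have "\<dots> = bvcomp B (lf_cell P al) (bvcomp B (lf_cmp P p k) (bhcomp B (bid2 B ?f) (lf_cell P \<psi>')))"
    using lf_cmp_natural[OF \<psi>'(1) E.id2[OF p] h(3)] lf_id2[OF p] by simp
  also have "\<dots> = bvcomp B (bvcomp B (brunit B ?f) (bhcomp B (bid2 B ?f) bt)) (bhcomp B (bid2 B ?f) (lf_cell P \<psi>'))"
    using B.vassoc[OF wB ck lf_cell[OF al(1)]] eq by simp
  also have "\<dots> = bvcomp B (brunit B ?f) (bvcomp B (bhcomp B (bid2 B ?f) bt) (bhcomp B (bid2 B ?f) (lf_cell P \<psi>')))"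
    using B.vassoc[OF wB wbt r(1)] by simp
  \<comment> \<open>The factors cancel because \<open>bt\<close> is the image of
    \<open>\<psi>\<close> and \<open>\<psi>'\<close> is inverse to \<open>\<psi>\<close>.\<close>
  also have "bvcomp B (bhcomp B (bid2 B ?f) bt) (bhcomp B (bid2 B ?f) (lf_cell P \<psi>')) = bid2 B (bcomp B ?f (bid1 B ?b))"
    using B.interchange[OF P\<psi>'(1) bt(1) B.id2[OF Pp(1)] B.id2[OF Pp(1)] t] P\<psi>'(2)
      B.vid_left[OF B.id2[OF Pp(1)]] B.hcomp_id[OF B.id1(1)[OF b] Pp(1) t] by simp
  also have "bvcomp B (brunit B ?f) \<dots> = brunit B ?f" using B.vid_right[OF r(1)] .
  finally have "strict_lift p h g ?c"
    unfolding strict_lift_def using p h g \<psi>(3) E.vcomp[OF w(1) al(1)] E.iso2_vcomp[OF w(1) al(1) w(2) al(2)]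
    by simp
  then show ?thesis by blast
qed

text \<open>Here the invertibility of the structure cell enters: its inverse followed by the right
  unitor is an isomorphism from \<open>P (p \<circ> h)\<close> to \<open>P p\<close>, and a lift of
  it ends strictly over \<open>P p\<close>.\<close>

lemma strict_lift_of_domain:
  assumes p: "p \<in> barr E" and h: "h \<in> barr E" "btrg E h = bsrc E p"
    and Ph: "lf_arr P h = bid1 B (lf_obj P (bsrc E p))"
  shows "\<exists>g al. strict_lift p h g al"
proof -
  let ?b = "lf_obj P (bsrc E p)" and ?f = "lf_arr P p"
  have b: "?b \<in> bobj B" using lf_obj E.arr_obj p by blast
  have Pp: "?f \<in> barr B" "bsrc B ?f = ?b" using lf_arr[OF p] by simp_all
  note r = B.runit[OF Pp(1), unfolded Pp(2)]
  have ph: "bcomp E p h \<in> barr E" "bsrc E (bcomp E p h) = bsrc E h" "btrg E (bcomp E p h) = btrg E p"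
    using E.comp1[OF h(1) p h(2)] by blast+
  have c: "lf_cmp P p h \<in> Hom2 B (bcomp B ?f (bid1 B ?b)) (lf_arr P (bcomp E p h))"
    using lf_cmp[OF h(1) p h(2)] Ph by simp
  have iso: "iso2 B (lf_cmp P p h)"
    using lf_cmp_iso_of_vertical[OF p h b, of "bid2 B (bid1 B ?b)"] Ph B.id2 B.iso2_id B.id1(1)[OF b] by simp
  obtain c' where c': "c' \<in> Hom2 B (lf_arr P (bcomp E p h)) (bcomp B ?f (bid1 B ?b))"
    "bvcomp B c' (lf_cmp P p h) = bid2 B (bcomp B ?f (bid1 B ?b))" "iso2 B c'"
    using B.iso2_inverse[OF c iso] by blast
  obtain g \<psi> where \<psi>: "\<psi> \<in> Hom2 E (bcomp E p h) g" "iso2 E \<psi>" "lf_arr P g = ?f"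
      "lf_cell P \<psi> = bvcomp B (brunit B ?f) c'"
    using iso_lift[OF ph(1) B.vcomp[OF c'(1) r(1)] B.iso2_vcomp[OF c'(1) r(1) c'(3) r(2)]] by blast
  have "bvcomp B (lf_cell P \<psi>) (lf_cmp P p h) = brunit B ?f"
    using B.vassoc[OF c c'(1) r(1)] c'(2) \<psi>(4) B.vid_right[OF r(1)] by simp
  then have "strict_lift p h g \<psi>"
    unfolding strict_lift_def using p h Ph \<psi> ph E.cell[OF \<psi>(1)] by simp
  then show ?thesis by blast
qed

text \<open>The 2-cell clause of cartesianness with \<open>\<delta>\<close> an identity; this
  \<open>\<delta>\<close> is compatible because \<open>\<sigma>\<close> lies over an
  identity.\<close>

lemma strict_lift_cell_unique:
  assumes l: "strict_lift p h g al" and l': "strict_lift p h' g' al'"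
    and \<sigma>: "\<sigma> \<in> Hom2 E g g'" "lf_cell P \<sigma> = bid2 B (lf_arr P p)"
  shows "\<exists>!dt. dt \<in> Hom2 E h h' \<and> lf_cell P dt = bid2 B (bid1 B (lf_obj P (bsrc E p))) \<and>
    bvcomp E al' (bhcomp E (bid2 E p) dt) = bvcomp E \<sigma> al"
proof -
  let ?b = "lf_obj P (bsrc E p)" and ?f = "lf_arr P p"
  let ?i = "bid1 B ?b"
  note l = l[unfolded strict_lift_def] and l' = l'[unfolded strict_lift_def]
  have p: "p \<in> barr E" using l by blast
  have b: "?b \<in> bobj B" using lf_obj E.arr_obj p by blast
  have Pp: "?f \<in> barr B" "bsrc B ?f = ?b" using lf_arr[OF p] by simp_all
  note r = B.runit[OF Pp(1), unfolded Pp(2)]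
  have i: "?i \<in> barr B" "bsrc B ?i = ?b" "btrg B ?i = ?b" using B.id1[OF b] by blast+
  have ii: "bid2 B ?i \<in> Hom2 B ?i ?i" "iso2 B (bid2 B ?i)" using B.id2[OF i(1)] B.iso2_id[OF i(1)] by blast+
  have w: "bvcomp B (brunit B ?f) (bhcomp B (bid2 B ?f) (bid2 B ?i)) = brunit B ?f"
    using B.hcomp_id[OF i(1) Pp(1)] i Pp B.vid_right[OF r(1)] by simp
  have s: "lf_obj P (bsrc E g) = ?b" "lf_obj P (bsrc E g') = ?b"
    using lf_arr(2)[of g] lf_arr(2)[of g'] l l' Pp by auto
  have cl: "cart_lift E B P p g ?i (brunit B ?f) h al (bid2 B ?i)"
    "cart_lift E B P p g' ?i (brunit B ?f) h' al' (bid2 B ?i)"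
    using l l' ii w unfolding cart_lift_def by auto
  have "\<exists>!dt. dt \<in> Hom2 E h h' \<and> bvcomp E al' (bhcomp E (bid2 E p) dt) = bvcomp E \<sigma> al \<and>
      bvcomp B (bid2 B ?i) (lf_cell P dt) = bvcomp B (bid2 B ?i) (bid2 B ?i)"
  proof (rule cartesian[OF p, unfolded cartesian_def, THEN conjunct2, THEN conjunct2, rule_format,
        where g = g and g' = g' and h = "?i" and h' = "?i" and \<alpha> = "brunit B ?f" and \<alpha>' = "brunit B ?f"
          and bt = "bid2 B ?i" and bt' = "bid2 B ?i" and \<delta> = "bid2 B ?i"], intro conjI)
    show "bvcomp B (brunit B ?f) (bhcomp B (bid2 B ?f) (bid2 B ?i)) = bvcomp B (lf_cell P \<sigma>) (brunit B ?f)"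
      using w \<sigma>(2) B.vid_left[OF r(1)] by simp
  qed (use l l' \<sigma> i ii r s cl in auto)
  moreover have "bvcomp B (bid2 B ?i) (lf_cell P dt) = bvcomp B (bid2 B ?i) (bid2 B ?i) \<longleftrightarrow>
      lf_cell P dt = bid2 B ?i" if "dt \<in> Hom2 E h h'" for dt
    using B.vid_left[OF ii(1)] B.vid_left[of "lf_cell P dt" ?i ?i] lf_cell[OF that] l l' by simp
  ultimately show ?thesis by (simp add: conj_commute cong: conj_cong)
qed

text \<open>Since \<open>al\<close> is invertible, \<open>\<sigma>\<close> must be
  \<open>al'\<close> after the whiskered \<open>dt\<close> after the inverse of \<open>al\<close>.
  By naturality of the structure cells, the image of this \<open>\<sigma>\<close> composed with the
  right unitor is that unitor again; it can be cancelled, so \<open>\<sigma>\<close> lies over an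
  identity.\<close>

lemma strict_lift_cell_image:
  assumes l: "strict_lift p h g al" and l': "strict_lift p h' g' al'"
    and d: "dt \<in> Hom2 E h h'" "lf_cell P dt = bid2 B (bid1 B (lf_obj P (bsrc E p)))"
  shows "\<exists>!\<sigma>. \<sigma> \<in> Hom2 E g g' \<and> lf_cell P \<sigma> = bid2 B (lf_arr P p) \<and>
    bvcomp E al' (bhcomp E (bid2 E p) dt) = bvcomp E \<sigma> al"
proof -
  let ?b = "lf_obj P (bsrc E p)" and ?f = "lf_arr P p"
  let ?i = "bid1 B ?b"
  note l = l[unfolded strict_lift_def] and l' = l'[unfolded strict_lift_def]
  have p: "p \<in> barr E" and al: "al \<in> Hom2 E (bcomp E p h) g" "iso2 E al" using l by blast+
  have al': "al' \<in> Hom2 E (bcomp E p h') g'" using l' by blast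
  have h: "h \<in> barr E" "h' \<in> barr E" "btrg E h = bsrc E p" "btrg E h' = bsrc E p"
    "lf_arr P h = ?i" "lf_arr P h' = ?i" using l l' by auto
  have b: "?b \<in> bobj B" using lf_obj E.arr_obj p by blast
  have Pp: "?f \<in> barr B" "bsrc B ?f = ?b" using lf_arr[OF p] by simp_all
  note r = B.runit[OF Pp(1), unfolded Pp(2)]
  obtain be where be: "be \<in> Hom2 E g (bcomp E p h)" "bvcomp E be al = bid2 E (bcomp E p h)"
    using E.iso2_inverse[OF al] by blast
  have w: "bhcomp E (bid2 E p) dt \<in> Hom2 E (bcomp E p h) (bcomp E p h')"
    using E.hcomp[OF d(1) E.id2[OF p] h(3)] .
  define x where "x = bvcomp E al' (bhcomp E (bid2 E p) dt)"
  have x: "x \<in> Hom2 E (bcomp E p h) g'" unfolding x_def using E.vcomp[OF w al'] .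
  define \<sigma> where "\<sigma> = bvcomp E x be"
  have \<sigma>: "\<sigma> \<in> Hom2 E g g'" unfolding \<sigma>_def using E.vcomp[OF be(1) x] .
  have eq: "bvcomp E \<sigma> al = x"
    unfolding \<sigma>_def using E.vcomp_cancel_outer[OF be(1) al(1) x be(2)] .
  have c: "lf_cmp P p h \<in> Hom2 B (bcomp B ?f ?i) (lf_arr P (bcomp E p h))"
    "lf_cmp P p h' \<in> Hom2 B (bcomp B ?f ?i) (lf_arr P (bcomp E p h'))"
    using lf_cmp[OF _ p] h by metis+
  have "bvcomp B (lf_cell P \<sigma>) (brunit B ?f) = bvcomp B (lf_cell P x) (lf_cmp P p h)"
    using B.vassoc[OF c(1) lf_cell[OF al(1)] ] lf_cell[OF \<sigma>] lf_vcomp[OF al(1) \<sigma>] eq l by simp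
  also have "\<dots> = bvcomp B (lf_cell P al') (bvcomp B (lf_cell P (bhcomp E (bid2 E p) dt)) (lf_cmp P p h))"
    unfolding x_def using lf_vcomp[OF w al'] B.vassoc[OF c(1) lf_cell[OF w] lf_cell[OF al']] by simp
  also have "bvcomp B (lf_cell P (bhcomp E (bid2 E p) dt)) (lf_cmp P p h) =
      bvcomp B (lf_cmp P p h') (bid2 B (bcomp B ?f ?i))"
    using lf_cmp_natural[OF d(1) E.id2[OF p] h(3)] lf_id2[OF p] d(2)
      B.hcomp_id[OF B.id1(1)[OF b] Pp(1)] B.id1[OF b] Pp by simp
  also have "\<dots> = lf_cmp P p h'" using B.vid_right[OF c(2)] .
  also have "bvcomp B (lf_cell P al') (lf_cmp P p h') = bvcomp B (bid2 B ?f) (brunit B ?f)"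
    using l' B.vid_left[OF r(1)] by simp
  finally have "lf_cell P \<sigma> = bid2 B ?f"
    using B.vcomp_cancel_right[OF r _ B.id2[OF Pp(1)]] lf_cell[OF \<sigma>] l l' by simp
  then show ?thesis
    using \<sigma> eq E.vcomp_cancel_right[OF al] unfolding x_def by metis
qed

end

lemma chom_hom_cat: "g \<in> cobj (hom_cat E x y) \<Longrightarrow> chom (hom_cat E x y) g g' = Hom2 E g g'"
  by (auto simp: chom_def hom_cat_def Hom2_def)

lemma hom_over_hom_cat:
  "g \<in> cobj (hom_cat E x y) \<Longrightarrow>
    hom_over (hom_cat E x y) Fm u g g' = {\<alpha> \<in> Hom2 E g g'. Fm \<alpha> = u}"
  by (simp add: hom_over_def chom_hom_cat)

lemma card_eq_of_unique_relation:
  assumes "\<And>x. x \<in> A \<Longrightarrow> \<exists>!y. y \<in> B \<and> R x y" "\<And>y. y \<in> B \<Longrightarrow> \<exists>!x. x \<in> A \<and> R x y"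
  shows "card A = card B"
proof -
  obtain f where f: "\<And>x. x \<in> A \<Longrightarrow> f x \<in> B \<and> R x (f x)" using assms(1) by metis
  obtain g where g: "\<And>y. y \<in> B \<Longrightarrow> g y \<in> A \<and> R (g y) y" using assms(2) by metis
  have "g (f x) = x" if "x \<in> A" for x using that f g assms(2) by metis
  moreover have "f (g y) = y" if "y \<in> B" for y using that f g assms(1) by metis
  ultimately have "bij_betw f A B"
    using f g by (intro bij_betw_byWitness[where f' = g]) auto
  then show ?thesis by (rule bij_betw_same_card)
qed

text \<open>Strict lifts relate the 1-morphisms over an identity to those over \<open>P p\<close>,
  totally in both directions. For related pairs, the equation between \<open>dt\<close> and
  \<open>\<sigma>\<close> is a bijection of the 2-cells over identities.\<close>

lemma (in cartesian_lax) euler_value_fibre_shift: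
  assumes p: "p \<in> barr E" and b: "lf_obj P (bsrc E p) = b"
    and v: "euler_value (fibre_obj (hom_cat E z (bsrc E p)) (lf_arr P) (bid1 B b))
        (fibre_zeta (hom_cat E z (bsrc E p)) (lf_cell P) (bid2 B (bid1 B b))) v"
  shows "euler_value (fibre_obj (hom_cat E z (btrg E p)) (lf_arr P) (lf_arr P p))
        (fibre_zeta (hom_cat E z (btrg E p)) (lf_cell P) (bid2 B (lf_arr P p))) v"
proof (rule euler_value_transfer[OF v, where R = "\<lambda>h g. \<exists>al. strict_lift p h g al"])
  fix h assume "h \<in> fibre_obj (hom_cat E z (bsrc E p)) (lf_arr P) (bid1 B b)"
  then have "h \<in> barr E" "bsrc E h = z" "btrg E h = bsrc E p" "lf_arr P h = bid1 B b"
    by (auto simp: fibre_obj_def hom_cat_def)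
  then obtain g al where g: "strict_lift p h g al" "bsrc E h = z"
    using strict_lift_of_domain[OF p] b by blast
  then have "g \<in> fibre_obj (hom_cat E z (btrg E p)) (lf_arr P) (lf_arr P p)"
    by (auto simp: strict_lift_def fibre_obj_def hom_cat_def)
  with g show "\<exists>g\<in>fibre_obj (hom_cat E z (btrg E p)) (lf_arr P) (lf_arr P p). \<exists>al. strict_lift p h g al"
    by blast
next
  fix g assume "g \<in> fibre_obj (hom_cat E z (btrg E p)) (lf_arr P) (lf_arr P p)"
  then have "g \<in> barr E" "bsrc E g = z" "btrg E g = btrg E p" "lf_arr P g = lf_arr P p"
    by (auto simp: fibre_obj_def hom_cat_def)
  then obtain h al where h: "strict_lift p h g al" "bsrc E g = z"
    using strict_lift_of_codomain[OF p] by blast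
  then have "h \<in> fibre_obj (hom_cat E z (bsrc E p)) (lf_arr P) (bid1 B b)"
    using b by (auto simp: strict_lift_def fibre_obj_def hom_cat_def)
  with h show "\<exists>h\<in>fibre_obj (hom_cat E z (bsrc E p)) (lf_arr P) (bid1 B b). \<exists>al. strict_lift p h g al"
    by blast
next
  fix h h' g g'
  assume hg: "h \<in> fibre_obj (hom_cat E z (bsrc E p)) (lf_arr P) (bid1 B b)"
    "g \<in> fibre_obj (hom_cat E z (btrg E p)) (lf_arr P) (lf_arr P p)"
  assume "\<exists>al. strict_lift p h g al" "\<exists>al. strict_lift p h' g' al"
  then obtain al al' where l: "strict_lift p h g al" and l': "strict_lift p h' g' al'" by blast
  let ?D = "{dt \<in> Hom2 E h h'. lf_cell P dt = bid2 B (bid1 B b)}"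
  let ?S = "{\<sigma> \<in> Hom2 E g g'. lf_cell P \<sigma> = bid2 B (lf_arr P p)}"
  let ?R = "\<lambda>dt \<sigma>. bvcomp E al' (bhcomp E (bid2 E p) dt) = bvcomp E \<sigma> al"
  have 1: "\<exists>!\<sigma>. \<sigma> \<in> ?S \<and> ?R dt \<sigma>" if "dt \<in> ?D" for dt
    using strict_lift_cell_image[OF l l'] that b by (simp add: conj_assoc)
  have 2: "\<exists>!dt. dt \<in> ?D \<and> ?R dt \<sigma>" if "\<sigma> \<in> ?S" for \<sigma>
    using strict_lift_cell_unique[OF l l'] that b by (simp add: conj_assoc)
  have "card ?D = card ?S"
    using 1 2 by (rule card_eq_of_unique_relation)
  moreover have "h \<in> cobj (hom_cat E z (bsrc E p))" "g \<in> cobj (hom_cat E z (btrg E p))"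
    using hg by (simp_all add: fibre_obj_def)
  ultimately show "fibre_zeta (hom_cat E z (bsrc E p)) (lf_cell P) (bid2 B (bid1 B b)) h h' =
      fibre_zeta (hom_cat E z (btrg E p)) (lf_cell P) (bid2 B (lf_arr P p)) g g'"
    by (simp add: fibre_zeta_def hom_over_hom_cat)
qed

section \<open>From bicategories and lax functors to the weakened axioms\<close>

lemma bicategory_prebicategory:
  assumes "bicategory B"
  shows "prebicategory B"
proof -
  note c = assms[unfolded bicategory_def]
  note c1 = c[THEN conjunct1] and c = c[THEN conjunct2]
  note c2 = c[THEN conjunct1] and c = c[THEN conjunct2]
  note c3 = c[THEN conjunct1] and c = c[THEN conjunct2]
  note c4 = c[THEN conjunct1] and c = c[THEN conjunct2]
  note c5 = c[THEN conjunct1] and c = c[THEN conjunct2]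
  note c6 = c[THEN conjunct1] and c = c[THEN conjunct2]
  note c7 = c[THEN conjunct1] and c = c[THEN conjunct2]
  note c8 = c[THEN conjunct1] and c = c[THEN conjunct2]
  note c9 = c[THEN conjunct1] and c = c[THEN conjunct2]
  note c10 = c[THEN conjunct1] and c = c[THEN conjunct2]
  note c11 = c[THEN conjunct1] and c = c[THEN conjunct2, THEN conjunct2, THEN conjunct2]
  note c14 = c[THEN conjunct1] and c15 = c[THEN conjunct2, THEN conjunct1]
  show ?thesis
    apply unfold_locales
    subgoal using c1 by blast
    subgoal using c1 by blast
    subgoal using c2 by blast
    subgoal using c2 by blast
    subgoal using c2 by blast
    subgoal using c3 by blast
    subgoal using c3 by blast
    subgoal using c3 by blast
    subgoal using c4 by (auto simp: Hom2_def)
    subgoal using c4 by (auto simp: Hom2_def)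
    subgoal using c4 by (auto simp: Hom2_def)
    subgoal using c4 by (auto simp: Hom2_def)
    subgoal using c5 by blast
    subgoal using c6 by (auto simp: Hom2_def)
    subgoal using c7 by (auto simp: Hom2_def)
    subgoal using c7 by (auto simp: Hom2_def)
    subgoal using c8 by (simp add: Hom2_def)
    subgoal using c9 by (auto simp: Hom2_def)
    subgoal using c10 by blast
    subgoal using c11 by (simp add: Hom2_def)
    subgoal using c14 by blast
    subgoal using c14 by blast
    subgoal using c14 by blast
    subgoal using c14 by blast
    subgoal using c15 by (auto simp: Hom2_def)
    subgoal using c15 by (auto simp: Hom2_def)
    done
qed

lemma bicategory_assoc:
  assumes "bicategory B" "f \<in> barr B" "g \<in> barr B" "h \<in> barr B" "btrg B f = bsrc B g" "btrg B g = bsrc B h"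
  shows "bassoc B h g f \<in> Hom2 B (bcomp B (bcomp B h g) f) (bcomp B h (bcomp B g f))"
    and "iso2 B (bassoc B h g f)"
  using assms(1)[unfolded bicategory_def, THEN conjunct2, THEN conjunct2, THEN conjunct2, THEN conjunct2,
      THEN conjunct2, THEN conjunct2, THEN conjunct2, THEN conjunct2, THEN conjunct2, THEN conjunct2,
      THEN conjunct2, THEN conjunct1] assms(2-) by blast+

lemma category_hom_cat:
  assumes "bicategory B"
  shows "category (hom_cat B x y)"
proof -
  interpret prebicategory B by (rule bicategory_prebicategory[OF assms])
  have H: "\<alpha> \<in> bcell B \<longleftrightarrow> \<alpha> \<in> Hom2 B (bdom B \<alpha>) (bcod B \<alpha>)" for \<alpha> by (simp add: Hom2_def)
  have c: "bdom B \<alpha> \<in> barr B \<and> bcod B \<alpha> \<in> barr B \<and> bsrc B (bcod B \<alpha>) = bsrc B (bdom B \<alpha>) \<and>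
      btrg B (bcod B \<alpha>) = btrg B (bdom B \<alpha>)" if "\<alpha> \<in> bcell B" for \<alpha>
    using cell[of \<alpha>] that H by metis
  have i: "bid2 B f \<in> bcell B \<and> bdom B (bid2 B f) = f \<and> bcod B (bid2 B f) = f" if "f \<in> barr B" for f
    using id2[OF that] by (simp add: Hom2_def)
  have v: "bvcomp B \<beta> \<alpha> \<in> bcell B \<and> bdom B (bvcomp B \<beta> \<alpha>) = bdom B \<alpha> \<and> bcod B (bvcomp B \<beta> \<alpha>) = bcod B \<beta>"
    if "\<alpha> \<in> bcell B" "\<beta> \<in> bcell B" "bcod B \<alpha> = bdom B \<beta>" for \<alpha> \<beta>
    using vcomp[of \<alpha> "bdom B \<alpha>" "bcod B \<alpha>" \<beta> "bcod B \<beta>"] that by (simp add: Hom2_def)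
  have u: "bvcomp B (bid2 B (bcod B \<alpha>)) \<alpha> = \<alpha> \<and> bvcomp B \<alpha> (bid2 B (bdom B \<alpha>)) = \<alpha>" if "\<alpha> \<in> bcell B" for \<alpha>
    using vid_left[of \<alpha>] vid_right[of \<alpha>] that H by metis
  have a: "bvcomp B \<gamma> (bvcomp B \<beta> \<alpha>) = bvcomp B (bvcomp B \<gamma> \<beta>) \<alpha>"
    if "\<alpha> \<in> bcell B" "\<beta> \<in> bcell B" "\<gamma> \<in> bcell B" "bcod B \<alpha> = bdom B \<beta>" "bcod B \<beta> = bdom B \<gamma>" for \<alpha> \<beta> \<gamma>
    using vassoc[of \<alpha> "bdom B \<alpha>" "bcod B \<alpha>" \<beta> "bcod B \<beta>" \<gamma> "bcod B \<gamma>"] that by (simp add: Hom2_def)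
  show ?thesis
    unfolding category_def hom_cat_def using c i v u a by (simp; fail | auto)
qed

text \<open>Inverts two opposite sides of a commuting square; this is how the associativity law of a
  lax functor is read backwards.\<close>

lemma (in prebicategory) vcomp_conjugate:
  assumes \<alpha>: "\<alpha> \<in> Hom2 B f g" "\<alpha>' \<in> Hom2 B g f" "bvcomp B \<alpha>' \<alpha> = bid2 B f"
    and \<beta>: "\<beta> \<in> Hom2 B h k" "\<beta>' \<in> Hom2 B k h" "bvcomp B \<beta> \<beta>' = bid2 B k"
    and x: "x \<in> Hom2 B h f" and y: "y \<in> Hom2 B k g" and eq: "bvcomp B \<alpha> x = bvcomp B y \<beta>"
  shows "bvcomp B \<alpha>' y = bvcomp B x \<beta>'"
proof -
  have "x = bvcomp B \<alpha>' (bvcomp B y \<beta>)" using vcomp_cancel_inner[OF x \<alpha>] eq by simp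
  then have "bvcomp B x \<beta>' = bvcomp B (bvcomp B (bvcomp B \<alpha>' y) \<beta>) \<beta>'"
    using vassoc[OF \<beta>(1) y \<alpha>(2)] by simp
  then show ?thesis using vcomp_cancel_outer[OF \<beta>(1,2) vcomp[OF y \<alpha>(2)] \<beta>(3)] by simp
qed

lemma lax_functor_prelax:
  assumes "bicategory E" "bicategory B" "lax_functor E B P"
  shows "prelax E B P"
proof -
  interpret E: prebicategory E by (rule bicategory_prebicategory[OF assms(1)])
  interpret B: prebicategory B by (rule bicategory_prebicategory[OF assms(2)])
  note c = assms(3)[unfolded lax_functor_def]
  note c1 = c[THEN conjunct1] and c = c[THEN conjunct2]
  note c2 = c[THEN conjunct1] and c = c[THEN conjunct2]
  note c3 = c[THEN conjunct1] and c = c[THEN conjunct2]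
  note c4 = c[THEN conjunct1] and c = c[THEN conjunct2]
  note c5 = c[THEN conjunct1] and c = c[THEN conjunct2]
  note c6 = c[THEN conjunct1] and c = c[THEN conjunct2]
  note c7 = c[THEN conjunct1] and c = c[THEN conjunct2]
  note c8 = c[THEN conjunct1] and c = c[THEN conjunct2]
  note c9 = c[THEN conjunct1] and c10 = c[THEN conjunct2]
  show ?thesis
    apply unfold_locales
    subgoal using c1 by blast
    subgoal using c2 by blast
    subgoal using c2 by blast
    subgoal using c2 by blast
    subgoal using c3 by (auto simp: Hom2_def)
    subgoal using c4 by blast
    subgoal using c5 by (auto simp: Hom2_def)
    subgoal using c6 by blast
    subgoal using c7 by blast
    subgoal using c8 by (auto simp: Hom2_def)
    subgoal premises p for f g h
    proof -
      have "btrg B (lf_arr P f) = bsrc B (lf_arr P g)" "btrg B (lf_arr P g) = bsrc B (lf_arr P h)"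
        "lf_arr P f \<in> barr B" "lf_arr P g \<in> barr B" "lf_arr P h \<in> barr B"
        using c2 p by simp_all
      then show ?thesis
        using bicategory_assoc[OF assms(1) p] bicategory_assoc[OF assms(2), of "lf_arr P f" "lf_arr P g" "lf_arr P h"]
          c9 p by blast
    qed
    subgoal using c10 by blast
    subgoal using c10 by blast
    done
qed

section \<open>Reversal of lax functors\<close>

definition rev_lax :: "('o1,'a1,'c1,'o2,'a2,'c2) lax_fun \<Rightarrow> ('o1,'a1,'c1,'o2,'a2,'c2) lax_fun" where
  "rev_lax P = P\<lparr>lf_cmp := (\<lambda>g f. lf_cmp P f g)\<rparr>"

lemma rev_lax_simps [simp]:
  "lf_obj (rev_lax P) = lf_obj P" "lf_arr (rev_lax P) = lf_arr P" "lf_cell (rev_lax P) = lf_cell P"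
  "lf_cmp (rev_lax P) g f = lf_cmp P f g" "lf_unit (rev_lax P) = lf_unit P"
  by (simp_all add: rev_lax_def)

text \<open>The cells of a lift point the same way in both notions, so reversing 1-morphisms alone
  exchanges them and keeps the direction of laxness.\<close>

lemma cartesian_rev: "cartesian (rev_bicat E) (rev_bicat B) (rev_lax P) f \<longleftrightarrow> cocartesian E B P f"
proof -
  have "cart_lift (rev_bicat E) (rev_bicat B) (rev_lax P) = cocart_lift E B P"
    by (simp add: fun_eq_iff cart_lift_def cocart_lift_def conj_ac)
  then show ?thesis
    by (simp add: cartesian_def cocartesian_def conj_ac)
qed

text \<open>Only associativity has content: reversal exchanges the bracketings, so the square is
  read with the inverses \<open>s\<close> and \<open>s'\<close> of the two associating
  cells.\<close>

lemma prelax_rev: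
  assumes "prelax E B P"
  shows "prelax (rev_bicat E) (rev_bicat B) (rev_lax P)"
proof -
  interpret prelax E B P by (rule assms)
  interpret rE: prebicategory "rev_bicat E" by (rule prebicategory_rev_bicat) unfold_locales
  interpret rB: prebicategory "rev_bicat B" by (rule prebicategory_rev_bicat) unfold_locales
  show ?thesis
    apply unfold_locales
    subgoal using lf_obj by simp
    subgoal using lf_arr by simp
    subgoal using lf_arr by simp
    subgoal using lf_arr by simp
    subgoal using lf_cell by simp
    subgoal using lf_id2 by simp
    subgoal using lf_vcomp by simp
    subgoal using lf_cmp by simp
    subgoal using lf_unit by simp
    subgoal for \<alpha> f f' \<beta> g g' using lf_cmp_natural[of \<beta> g g' \<alpha> f f'] by simp
    subgoal premises p for f g h
    proof -
      have arr: "h \<in> barr E" "g \<in> barr E" "f \<in> barr E" and t: "btrg E h = bsrc E g" "btrg E g = bsrc E f"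
        using p by simp_all
      obtain a a' where a: "a \<in> Hom2 E (bcomp E (bcomp E f g) h) (bcomp E f (bcomp E g h))" "iso2 E a"
        and a': "a' \<in> Hom2 B (bcomp B (bcomp B (lf_arr P f) (lf_arr P g)) (lf_arr P h))
                 (bcomp B (lf_arr P f) (bcomp B (lf_arr P g) (lf_arr P h)))" "iso2 B a'"
        and eq: "bvcomp B (lf_cell P a)
          (bvcomp B (lf_cmp P (bcomp E f g) h) (bhcomp B (lf_cmp P f g) (bid2 B (lf_arr P h)))) =
          bvcomp B (lf_cmp P f (bcomp E g h)) (bvcomp B (bhcomp B (bid2 B (lf_arr P f)) (lf_cmp P g h)) a')"
        using lf_assoc[OF arr t] by blast
      obtain s where s: "s \<in> Hom2 E (bcomp E f (bcomp E g h)) (bcomp E (bcomp E f g) h)" "iso2 E s"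
        "bvcomp E s a = bid2 E (bcomp E (bcomp E f g) h)"
        using E.iso2_inverse[OF a] by blast
      obtain s' where s': "s' \<in> Hom2 B (bcomp B (lf_arr P f) (bcomp B (lf_arr P g) (lf_arr P h)))
          (bcomp B (bcomp B (lf_arr P f) (lf_arr P g)) (lf_arr P h))" "iso2 B s'"
        "bvcomp B a' s' = bid2 B (bcomp B (lf_arr P f) (bcomp B (lf_arr P g) (lf_arr P h)))"
        using B.iso2_inverse[OF a'] by blast
      have fg: "bcomp E f g \<in> barr E" "bsrc E (bcomp E f g) = bsrc E g" using E.comp1[OF arr(2,3) t(2)] by blast+
      have gh: "bcomp E g h \<in> barr E" "btrg E (bcomp E g h) = btrg E g" using E.comp1[OF arr(1,2) t(1)] by blast+
      have P: "lf_arr P f \<in> barr B" "lf_arr P g \<in> barr B" "lf_arr P h \<in> barr B"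
        "btrg B (lf_arr P h) = bsrc B (lf_arr P g)" "btrg B (lf_arr P g) = bsrc B (lf_arr P f)"
        using lf_arr arr t by simp_all
      have w1: "bhcomp B (lf_cmp P f g) (bid2 B (lf_arr P h)) \<in>
          Hom2 B (bcomp B (bcomp B (lf_arr P f) (lf_arr P g)) (lf_arr P h)) (bcomp B (lf_arr P (bcomp E f g)) (lf_arr P h))"
        using B.hcomp[OF B.id2[OF P(3)] lf_cmp[OF arr(2,3) t(2)]] B.comp1[OF P(2,1,5)] P(4) by simp
      have w2: "bhcomp B (bid2 B (lf_arr P f)) (lf_cmp P g h) \<in>
          Hom2 B (bcomp B (lf_arr P f) (bcomp B (lf_arr P g) (lf_arr P h))) (bcomp B (lf_arr P f) (lf_arr P (bcomp E g h)))"
        using B.hcomp[OF lf_cmp[OF arr(1,2) t(1)] B.id2[OF P(1)]] B.comp1[OF P(3,2,4)] P(5) by simp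
      have c1: "lf_cmp P (bcomp E f g) h \<in> Hom2 B (bcomp B (lf_arr P (bcomp E f g)) (lf_arr P h)) (lf_arr P (bcomp E (bcomp E f g) h))"
        using lf_cmp[OF arr(1) fg(1)] fg t by simp
      have c2: "lf_cmp P f (bcomp E g h) \<in> Hom2 B (bcomp B (lf_arr P f) (lf_arr P (bcomp E g h))) (lf_arr P (bcomp E f (bcomp E g h)))"
        using lf_cmp[OF gh(1) arr(3)] gh t by simp
      have Pa: "lf_cell P a \<in> Hom2 B (lf_arr P (bcomp E (bcomp E f g) h)) (lf_arr P (bcomp E f (bcomp E g h)))"
        "lf_cell P s \<in> Hom2 B (lf_arr P (bcomp E f (bcomp E g h))) (lf_arr P (bcomp E (bcomp E f g) h))"
        "bvcomp B (lf_cell P s) (lf_cell P a) = bid2 B (lf_arr P (bcomp E (bcomp E f g) h))"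
        using lf_cell[OF a(1)] lf_cell[OF s(1)] lf_vcomp[OF a(1) s(1)] s(3) lf_id2 E.cell[OF a(1)] by simp_all
      have "bvcomp B (lf_cell P s) (bvcomp B (lf_cmp P f (bcomp E g h)) (bhcomp B (bid2 B (lf_arr P f)) (lf_cmp P g h))) =
          bvcomp B (bvcomp B (lf_cmp P (bcomp E f g) h) (bhcomp B (lf_cmp P f g) (bid2 B (lf_arr P h)))) s'"
        using B.vcomp_conjugate[OF Pa a'(1) s'(1,3) B.vcomp[OF w1 c1] B.vcomp[OF w2 c2]]
          eq B.vassoc[OF a'(1) w2 c2] by simp
      then have "bvcomp B (lf_cell P s) (bvcomp B (lf_cmp P f (bcomp E g h)) (bhcomp B (bid2 B (lf_arr P f)) (lf_cmp P g h))) =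
          bvcomp B (lf_cmp P (bcomp E f g) h) (bvcomp B (bhcomp B (lf_cmp P f g) (bid2 B (lf_arr P h))) s')"
        using B.vassoc[OF s'(1) w1 c1] by simp
      then show ?thesis using s s' by simp blast
    qed
    subgoal using lf_runit by simp
    subgoal using lf_lunit by simp
    done
qed

lemma hom_cat_rev_bicat [simp]: "hom_cat (rev_bicat E) x y = hom_cat E y x"
  by (auto simp: hom_cat_def)

section \<open>The product formula\<close>

locale bifibered_bicat =
  fixes E :: "('o1,'a1,'c1) bicat" and B :: "('o2,'a2,'c2) bicat"
    and P :: "('o1,'a1,'c1,'o2,'a2,'c2) lax_fun"
  assumes bicat_E: "bicategory E" and bicat_B: "bicategory B" and lax: "lax_functor E B P"
    and measurable_E: "measurable_data (bobj E) (hom_cat E)"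
    and measurable_B: "measurable_data (bobj B) (hom_cat B)"
    and fibered: "fibered_pseudogroupoids E B P" and cofibered: "cofibered_pseudogroupoids E B P"
begin

sublocale prelax E B P
  by (rule lax_functor_prelax[OF bicat_E bicat_B lax])

text \<open>From the equivalences with finite categories, only finiteness of the hom-sets and a
  finite cover upstairs are retained; neither refers to the finite model.\<close>

lemma hom_bifibered:
  assumes x: "x \<in> bobj E" and y: "y \<in> bobj E"
  shows "bifibered (hom_cat E x y) (hom_cat B (lf_obj P x) (lf_obj P y)) (lf_arr P) (lf_cell P)"
proof -
  obtain C :: "(nat,nat) cat" where "fin_equiv (hom_cat E x y) C"
    using measurable_dataD(1)[OF measurable_E x y category_hom_cat[OF bicat_E]] by blast
  then interpret C: fin_equiv "hom_cat E x y" C .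
  obtain D :: "(nat,nat) cat" where "fin_equiv (hom_cat B (lf_obj P x) (lf_obj P y)) D"
    using measurable_dataD(1)[OF measurable_B lf_obj[OF x] lf_obj[OF y] category_hom_cat[OF bicat_B]] by blast
  then interpret D: fin_equiv "hom_cat B (lf_obj P x) (lf_obj P y)" D .
  have H: "\<alpha> \<in> bcell E \<longleftrightarrow> \<alpha> \<in> Hom2 E (bdom E \<alpha>) (bcod E \<alpha>)" for \<alpha> by (simp add: Hom2_def)
  have cell: "lf_cell P \<alpha> \<in> bcell B" "bdom B (lf_cell P \<alpha>) = lf_arr P (bdom E \<alpha>)"
    "bcod B (lf_cell P \<alpha>) = lf_arr P (bcod E \<alpha>)" "bdom E \<alpha> \<in> barr E" if "\<alpha> \<in> bcell E" for \<alpha>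
    using lf_cell[of \<alpha> "bdom E \<alpha>" "bcod E \<alpha>"] E.cell(1)[of \<alpha> "bdom E \<alpha>" "bcod E \<alpha>"] that
    by (simp_all add: Hom2_def)
  have vc: "lf_cell P (bvcomp E \<beta> \<alpha>) = bvcomp B (lf_cell P \<beta>) (lf_cell P \<alpha>)"
    if "\<alpha> \<in> bcell E" "\<beta> \<in> bcell E" "bcod E \<alpha> = bdom E \<beta>" for \<alpha> \<beta>
    using lf_vcomp[of \<alpha> "bdom E \<alpha>" "bcod E \<alpha>" \<beta> "bcod E \<beta>"] that by (simp add: Hom2_def)
  have "cat_functor (hom_cat E x y) (hom_cat B (lf_obj P x) (lf_obj P y)) (lf_arr P) (lf_cell P)"
    unfolding cat_functor_def hom_cat_def using lf_arr lf_id2 cell vc by simp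
  moreover have "\<exists>T. finite T \<and> T \<subseteq> cobj (hom_cat E x y) \<and>
      (\<forall>g\<in>cobj (hom_cat E x y). \<exists>t\<in>T. chom (hom_cat E x y) t g \<noteq> {} \<and> chom (hom_cat E x y) g t \<noteq> {})"
    using C.finite_cover by metis
  ultimately show ?thesis
    using fibered cofibered x y C.cat_C D.cat_C C.finite_chom D.finite_chom
    unfolding fibered_pseudogroupoids_def cofibered_pseudogroupoids_def
    by (intro bifibered.intro) auto
qed

text \<open>An opcartesian lift of an isomorphism in the hom-category is an isomorphism. As
  \<open>rev_bicat\<close> keeps the direction of 2-cells, the same statement serves
  \<open>dual_cartesian_lax\<close>.\<close>

lemma lift_iso2:
  assumes g: "g \<in> barr E" and \<theta>: "\<theta> \<in> Hom2 B (lf_arr P g) u" "iso2 B \<theta>"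
  shows "\<exists>g' \<psi>. \<psi> \<in> Hom2 E g g' \<and> iso2 E \<psi> \<and> lf_arr P g' = u \<and> lf_cell P \<psi> = \<theta>"
proof -
  let ?x = "bsrc E g" and ?y = "btrg E g"
  let ?C = "hom_cat E ?x ?y" and ?D = "hom_cat B (lf_obj P ?x) (lf_obj P ?y)"
  have "?x \<in> bobj E" "?y \<in> bobj E" using E.arr_obj g by blast+
  then interpret F: bifibered ?C ?D "lf_arr P" "lf_cell P" by (rule hom_bifibered)
  have gC: "g \<in> cobj ?C" "lf_arr P g \<in> cobj ?D" using g lf_arr by (simp_all add: hom_cat_def)
  have u: "bsrc B u = lf_obj P ?x" "btrg B u = lf_obj P ?y"
    using B.cell[OF \<theta>(1)] lf_arr[OF g] by simp_all
  obtain \<theta>' where \<theta>': "\<theta>' \<in> Hom2 B u (lf_arr P g)" "bvcomp B \<theta>' \<theta> = bid2 B (lf_arr P g)" "bvcomp B \<theta> \<theta>' = bid2 B u"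
    using B.iso2_inverse[OF \<theta>] by blast
  have "\<theta> \<in> chom ?D (lf_arr P g) u" using \<theta>(1) chom_hom_cat[OF gC(2)] by simp
  moreover have "cat_iso ?D \<theta>"
    using \<theta>(1) \<theta>' u lf_arr[OF g] unfolding cat_iso_def hom_cat_def Hom2_def by auto
  ultimately obtain g' \<psi> where \<psi>: "\<psi> \<in> chom ?C g g'" "lf_arr P g' = u" "lf_cell P \<psi> = \<theta>" "cat_iso ?C \<psi>"
    using F.iso_lift[OF gC(1)] by blast
  moreover have "iso2 E \<psi>" using \<psi>(4) unfolding cat_iso_def iso2_def hom_cat_def by auto
  ultimately show ?thesis using chom_hom_cat[OF gC(1)] by auto
qed

sublocale cartesian_lax E B P
  by unfold_locales (use fibered lift_iso2 in \<open>auto simp: fibered_pseudogroupoids_def\<close>)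

lemma dual_cartesian_lax: "cartesian_lax (rev_bicat E) (rev_bicat B) (rev_lax P)"
proof -
  interpret r: prelax "rev_bicat E" "rev_bicat B" "rev_lax P"
    by (rule prelax_rev) unfold_locales
  show ?thesis
    by unfold_locales
      (use cofibered lift_iso2 in \<open>auto simp: cofibered_pseudogroupoids_def cartesian_rev\<close>)
qed

section \<open>The matrices \<open>Z\<^sub>f\<close>, written \<open>fibre_chi x y f\<close>\<close>

definition fibre_chi :: "'o1 \<Rightarrow> 'o1 \<Rightarrow> 'a2 \<Rightarrow> rat" where
  "fibre_chi x y f = euler_char (fibre_obj (hom_cat E x y) (lf_arr P) f)
     (fibre_zeta (hom_cat E x y) (lf_cell P) (bid2 B f))"

lemma fibre_chi_euler_value:
  assumes "x \<in> bobj E" "y \<in> bobj E"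
  shows "euler_value (fibre_obj (hom_cat E x y) (lf_arr P) f)
     (fibre_zeta (hom_cat E x y) (lf_cell P) (bid2 B f)) (fibre_chi x y f)"
proof -
  interpret F: bifibered "hom_cat E x y" "hom_cat B (lf_obj P x) (lf_obj P y)" "lf_arr P" "lf_cell P"
    using assms by (rule hom_bifibered)
  have "cid (hom_cat B (lf_obj P x) (lf_obj P y)) f = bid2 B f" by (simp add: hom_cat_def)
  then show ?thesis
    using F.fibre_euler_value[of f] euler_char_eq unfolding fibre_chi_def by force
qed

text \<open>This trades a nonzero entry for an actual 1-morphism over \<open>f\<close>, along which
  rows and columns can be compared.\<close>

lemma fibre_chi_nonzero:
  assumes "x \<in> bobj E" "y \<in> bobj E"
  shows "fibre_chi x y f \<noteq> 0 \<longleftrightarrow> (\<exists>g\<in>barr E. bsrc E g = x \<and> btrg E g = y \<and> lf_arr P g = f)"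
proof -
  interpret F: bifibered "hom_cat E x y" "hom_cat B (lf_obj P x) (lf_obj P y)" "lf_arr P" "lf_cell P"
    using assms by (rule hom_bifibered)
  have "fibre_chi x y f \<noteq> 0 \<longleftrightarrow> fibre_obj (hom_cat E x y) (lf_arr P) f \<noteq> {}"
    using F.fibre_euler_char_nonzero[of f] by (simp add: fibre_chi_def hom_cat_def)
  then show ?thesis by (auto simp: fibre_obj_def hom_cat_def)
qed

lemma fibre_chi_postcomp:
  assumes "p \<in> barr E" "z \<in> bobj E" "lf_obj P (bsrc E p) = b"
  shows "fibre_chi z (btrg E p) (lf_arr P p) = fibre_chi z (bsrc E p) (bid1 B b)"
  using euler_value_fibre_shift[OF assms(1,3) fibre_chi_euler_value[OF assms(2) E.arr_obj(1)[OF assms(1)]]]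
  by (simp add: fibre_chi_def euler_char_eq)

text \<open>The postcomposition statement for the reversed lax functor, in which \<open>p\<close>
  runs from its target to its source.\<close>

lemma fibre_chi_precomp:
  assumes "p \<in> barr E" "z \<in> bobj E" "lf_obj P (btrg E p) = b"
  shows "fibre_chi (bsrc E p) z (lf_arr P p) = fibre_chi (btrg E p) z (bid1 B b)"
  using cartesian_lax.euler_value_fibre_shift[OF dual_cartesian_lax, of p b z] assms
    fibre_chi_euler_value[OF E.arr_obj(2)[OF assms(1)] assms(2)]
  by (simp add: fibre_chi_def euler_char_eq)

text \<open>\<open>chi_hom\<close> is computed in an arbitrarily chosen finite model; uniqueness of
  the value identifies it with the sum supplied by \<open>euler_value_total\<close>.\<close>

lemma chi_hom_decomposition:
  assumes x: "x \<in> bobj E" and y: "y \<in> bobj E"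
    and T: "finite T" "T \<subseteq> cobj (hom_cat B (lf_obj P x) (lf_obj P y))"
      "weighting (cobj (hom_cat B (lf_obj P x) (lf_obj P y))) T (zeta_cat (hom_cat B (lf_obj P x) (lf_obj P y))) k"
  shows "chi_hom (hom_cat E) x y = (\<Sum>a\<in>T. k a * fibre_chi x y a)"
proof -
  let ?D = "hom_cat B (lf_obj P x) (lf_obj P y)"
  interpret F: bifibered "hom_cat E x y" ?D "lf_arr P" "lf_cell P"
    using x y by (rule hom_bifibered)
  obtain S l where S: "finite S" "S \<subseteq> cobj ?D" "coweighting S (cobj ?D) (zeta_cat ?D) l"
    using measurable_dataD(2)[OF measurable_B lf_obj[OF x] lf_obj[OF y] category_hom_cat[OF bicat_B]]
    unfolding euler_value_def by blast
  have "cid ?D a = bid2 B a" for a by (simp add: hom_cat_def)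
  then have "euler_value (cobj (hom_cat E x y)) (zeta_cat (hom_cat E x y)) (\<Sum>a\<in>T. k a * fibre_chi x y a)"
    using F.euler_value_total[OF T S] by (simp add: fibre_chi_def)
  then show ?thesis
    using euler_value_unique measurable_dataD(2)[OF measurable_E x y category_hom_cat[OF bicat_E]] by blast
qed

text \<open>The weight \<open>u\<close> as one function on all objects: each object is weighted
  inside its own fiber, with the whole fiber as the set of representatives.\<close>

definition fibre_weight :: "'o1 \<Rightarrow> rat" where
  "fibre_weight e = block_weight (fiber_obj E P (lf_obj P e)) (\<lambda>x y. fibre_chi x y (bid1 B (lf_obj P e))) e"

lemma finite_fiber_obj: "finite (fiber_obj E P b)"
  using measurable_E by (simp add: fiber_obj_def measurable_data_def)

text \<open>The identity of \<open>x\<close> lies over its own image, which need not be the identity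
  of \<open>P x\<close>. Lifting the inverse of the unit cell moves it strictly over that identity,
  so invertibility of \<open>lf_unit\<close> is essential here.\<close>

lemma fibre_chi_refl:
  assumes x: "x \<in> bobj E"
  shows "fibre_chi x x (bid1 B (lf_obj P x)) \<noteq> 0"
proof -
  note e = E.id1[OF x]
  obtain \<theta> where \<theta>: "\<theta> \<in> Hom2 B (lf_arr P (bid1 E x)) (bid1 B (lf_obj P x))" "iso2 B \<theta>"
    using B.iso2_inverse[OF lf_unit[OF x] lf_unit_iso[OF x]] by blast
  obtain g \<psi> where \<psi>: "\<psi> \<in> Hom2 E (bid1 E x) g" "lf_arr P g = bid1 B (lf_obj P x)"
    using lift_iso2[OF e(1) \<theta>] by blast
  have "g \<in> barr E" "bsrc E g = x" "btrg E g = x" using E.cell[OF \<psi>(1)] e by simp_all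
  then show ?thesis using fibre_chi_nonzero[OF x x] \<psi>(2) by blast
qed

text \<open>A nonzero entry provides a 1-morphism \<open>h\<close> over the identity of
  \<open>b\<close>; postcomposition with it equates columns, precomposition rows.\<close>

lemma fiber_block_matrix: "block_matrix (fiber_obj E P b) (\<lambda>x y. fibre_chi x y (bid1 B b))"
  unfolding block_matrix_def
proof (intro conjI ballI impI)
  fix x assume "x \<in> fiber_obj E P b"
  then show "fibre_chi x x (bid1 B b) \<noteq> 0" using fibre_chi_refl by (auto simp: fiber_obj_def)
next
  fix x y z assume f: "x \<in> fiber_obj E P b" "y \<in> fiber_obj E P b" "z \<in> fiber_obj E P b"
    and "fibre_chi x y (bid1 B b) \<noteq> 0"
  then obtain h where h: "h \<in> barr E" "bsrc E h = x" "btrg E h = y" "lf_arr P h = bid1 B b"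
    using fibre_chi_nonzero by (auto simp: fiber_obj_def)
  show "fibre_chi z x (bid1 B b) = fibre_chi z y (bid1 B b)"
    using fibre_chi_postcomp[OF h(1), of z b] f h by (simp add: fiber_obj_def)
  show "fibre_chi x z (bid1 B b) = fibre_chi y z (bid1 B b)"
    using fibre_chi_precomp[OF h(1), of z b] f h by (simp add: fiber_obj_def)
qed

lemma fiber_weighting:
  "weighting (fiber_obj E P b) (fiber_obj E P b) (\<lambda>x y. fibre_chi x y (bid1 B b)) fibre_weight"
  "coweighting (fiber_obj E P b) (fiber_obj E P b) (\<lambda>x y. fibre_chi x y (bid1 B b)) fibre_weight"
proof -
  let ?X = "fiber_obj E P b" and ?z = "\<lambda>x y. fibre_chi x y (bid1 B b)"
  have "\<exists>t\<in>?X. ?z t x \<noteq> 0" if "x \<in> ?X" for x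
    using that fiber_block_matrix[of b] unfolding block_matrix_def by blast
  note w = block_matrix_weighting[OF fiber_block_matrix finite_fiber_obj order_refl this]
  have eq: "block_weight ?X ?z e = fibre_weight e" if "e \<in> ?X" for e
    using that by (simp add: fibre_weight_def fiber_obj_def)
  show "weighting ?X ?X ?z fibre_weight"
    using w(1) eq unfolding weighting_def by (simp cong: sum.cong)
  show "coweighting ?X ?X ?z fibre_weight"
    using w(2) eq unfolding coweighting_def by (simp cong: sum.cong)
qed

text \<open>A lift \<open>p\<close> of \<open>f\<close> starting at \<open>e\<close>, available
  because \<open>P\<close> is cofibered, turns the entries over \<open>f\<close> into the row of the
  fiber matrix at the target of \<open>p\<close>. Thus one weight normalizes all
  \<open>Z\<^sub>f\<close> at once.\<close>

lemma fibre_chi_weighting: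
  assumes e: "e \<in> bobj E" and f: "f \<in> barr B" "bsrc B f = lf_obj P e" "btrg B f = b"
  shows "(\<Sum>z\<in>fiber_obj E P b. fibre_chi e z f * fibre_weight z) = 1"
proof -
  obtain p where p: "p \<in> barr E" "bsrc E p = e" "lf_arr P p = f"
    using cofibered e f unfolding cofibered_pseudogroupoids_def by blast
  have b: "lf_obj P (btrg E p) = b" using lf_arr(3)[OF p(1)] p(3) f(3) by simp
  then have t: "btrg E p \<in> fiber_obj E P b" using E.arr_obj(2)[OF p(1)] by (simp add: fiber_obj_def)
  have "(\<Sum>z\<in>fiber_obj E P b. fibre_chi e z f * fibre_weight z) =
      (\<Sum>z\<in>fiber_obj E P b. fibre_chi (btrg E p) z (bid1 B b) * fibre_weight z)"
    using fibre_chi_precomp[OF p(1) _ b] p by (intro sum.cong) (auto simp: fiber_obj_def)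
  then show ?thesis using fiber_weighting(1) t by (simp add: weighting_def)
qed

lemma fibre_chi_coweighting:
  assumes e: "e \<in> bobj E" and f: "f \<in> barr B" "bsrc B f = b" "btrg B f = lf_obj P e"
  shows "(\<Sum>z\<in>fiber_obj E P b. fibre_weight z * fibre_chi z e f) = 1"
proof -
  obtain p where p: "p \<in> barr E" "btrg E p = e" "lf_arr P p = f"
    using fibered e f unfolding fibered_pseudogroupoids_def by blast
  have b: "lf_obj P (bsrc E p) = b" using lf_arr(2)[OF p(1)] p(3) f(2) by simp
  then have t: "bsrc E p \<in> fiber_obj E P b" using E.arr_obj(1)[OF p(1)] by (simp add: fiber_obj_def)
  have "(\<Sum>z\<in>fiber_obj E P b. fibre_weight z * fibre_chi z e f) =
      (\<Sum>z\<in>fiber_obj E P b. fibre_weight z * fibre_chi z (bsrc E p) (bid1 B b))"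
    using fibre_chi_postcomp[OF p(1) _ b] p by (intro sum.cong) (auto simp: fiber_obj_def)
  then show ?thesis using fiber_weighting(2) t by (simp add: coweighting_def)
qed

lemma hom_weighting:
  assumes "b \<in> bobj B" "c \<in> bobj B"
  obtains T k where "finite T" "T \<subseteq> cobj (hom_cat B b c)"
    "weighting (cobj (hom_cat B b c)) T (zeta_cat (hom_cat B b c)) k" "sum k T = chi_hom (hom_cat B) b c"
  using measurable_dataD(2)[OF measurable_B assms category_hom_cat[OF bicat_B]]
  unfolding euler_value_def by blast

text \<open>For \<open>z\<close> in the fiber over \<open>b\<close>, the base hom-category and its
  weighting \<open>k\<close> do not depend on \<open>z\<close>. The sum over \<open>z\<close> can
  therefore be taken first; it gives 1 for each \<open>a\<close>, and the total weight of
  \<open>k\<close> remains.\<close>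

lemma chi_hom_fiber_weighting:
  assumes e: "e \<in> bobj E" and b: "b \<in> bobj B"
  shows "(\<Sum>z\<in>fiber_obj E P b. chi_hom (hom_cat E) e z * fibre_weight z) = chi_hom (hom_cat B) (lf_obj P e) b"
proof -
  obtain T k where T: "finite T" "T \<subseteq> cobj (hom_cat B (lf_obj P e) b)"
    "weighting (cobj (hom_cat B (lf_obj P e) b)) T (zeta_cat (hom_cat B (lf_obj P e) b)) k"
    "sum k T = chi_hom (hom_cat B) (lf_obj P e) b"
    using hom_weighting[OF lf_obj[OF e] b] .
  have "(\<Sum>z\<in>fiber_obj E P b. chi_hom (hom_cat E) e z * fibre_weight z) =
      (\<Sum>z\<in>fiber_obj E P b. \<Sum>a\<in>T. k a * (fibre_chi e z a * fibre_weight z))"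
    using chi_hom_decomposition[OF e] T
    by (intro sum.cong) (auto simp: fiber_obj_def sum_distrib_right mult.assoc)
  also have "\<dots> = (\<Sum>a\<in>T. k a * (\<Sum>z\<in>fiber_obj E P b. fibre_chi e z a * fibre_weight z))"
    by (subst sum.swap) (simp add: sum_distrib_left)
  also have "\<dots> = sum k T"
    using fibre_chi_weighting[OF e] T(2) by (intro sum.cong) (auto simp: hom_cat_def)
  finally show ?thesis using T(4) by simp
qed

lemma chi_hom_fiber_coweighting:
  assumes e: "e \<in> bobj E" and b: "b \<in> bobj B"
  shows "(\<Sum>z\<in>fiber_obj E P b. fibre_weight z * chi_hom (hom_cat E) z e) = chi_hom (hom_cat B) b (lf_obj P e)"
proof -
  obtain T k where T: "finite T" "T \<subseteq> cobj (hom_cat B b (lf_obj P e))"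
    "weighting (cobj (hom_cat B b (lf_obj P e))) T (zeta_cat (hom_cat B b (lf_obj P e))) k"
    "sum k T = chi_hom (hom_cat B) b (lf_obj P e)"
    using hom_weighting[OF b lf_obj[OF e]] .
  have "(\<Sum>z\<in>fiber_obj E P b. fibre_weight z * chi_hom (hom_cat E) z e) =
      (\<Sum>z\<in>fiber_obj E P b. \<Sum>a\<in>T. k a * (fibre_weight z * fibre_chi z e a))"
    using chi_hom_decomposition[OF _ e] T
    by (intro sum.cong) (auto simp: fiber_obj_def sum_distrib_left mult.left_commute)
  also have "\<dots> = (\<Sum>a\<in>T. k a * (\<Sum>z\<in>fiber_obj E P b. fibre_weight z * fibre_chi z e a))"
    by (subst sum.swap) (simp add: sum_distrib_left)
  also have "\<dots> = sum k T"
    using fibre_chi_coweighting[OF e] T(2) by (intro sum.cong) (auto simp: hom_cat_def)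
  finally show ?thesis using T(4) by simp
qed

lemma sum_over_fibers: "(\<Sum>b\<in>bobj B. \<Sum>e\<in>fiber_obj E P b. h e) = sum h (bobj E)"
proof -
  have "finite (bobj E)" "finite (bobj B)"
    using measurable_E measurable_B by (simp_all add: measurable_data_def)
  then show ?thesis
    using sum.group[of "bobj E" "bobj B" "lf_obj P" h] lf_obj by (auto simp: fiber_obj_def)
qed

text \<open>The same product of weights as in \<open>euler_value_total\<close>, one dimension up:
  \<open>fibre_weight\<close> within the fibers, \<open>w\<close> and \<open>l\<close> on the
  base.\<close>

lemma euler_value_total_bicat:
  assumes w: "weighting (bobj B) (bobj B) (chi_hom (hom_cat B)) w"
    and l: "coweighting (bobj B) (bobj B) (chi_hom (hom_cat B)) l"
  shows "euler_value (bobj E) (chi_hom (hom_cat E)) (\<Sum>b\<in>bobj B. w b * sum fibre_weight (fiber_obj E P b))"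
proof -
  have fin: "finite (bobj E)" using measurable_E by (simp add: measurable_data_def)
  have Pf: "lf_obj P e = b" if "e \<in> fiber_obj E P b" for e b using that by (simp add: fiber_obj_def)
  have "(\<Sum>z\<in>bobj E. chi_hom (hom_cat E) e z * (fibre_weight z * w (lf_obj P z))) = 1" if e: "e \<in> bobj E" for e
  proof -
    have "(\<Sum>z\<in>bobj E. chi_hom (hom_cat E) e z * (fibre_weight z * w (lf_obj P z))) =
       (\<Sum>b\<in>bobj B. (\<Sum>z\<in>fiber_obj E P b. chi_hom (hom_cat E) e z * fibre_weight z) * w b)"
      unfolding sum_over_fibers[symmetric] by (simp add: sum_distrib_right Pf mult.assoc cong: sum.cong)
    also have "\<dots> = 1"
      using chi_hom_fiber_weighting[OF e] w lf_obj[OF e] by (simp add: weighting_def)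
    finally show ?thesis .
  qed
  moreover have "(\<Sum>z\<in>bobj E. (l (lf_obj P z) * fibre_weight z) * chi_hom (hom_cat E) z e) = 1" if e: "e \<in> bobj E" for e
  proof -
    have "(\<Sum>z\<in>bobj E. (l (lf_obj P z) * fibre_weight z) * chi_hom (hom_cat E) z e) =
       (\<Sum>b\<in>bobj B. l b * (\<Sum>z\<in>fiber_obj E P b. fibre_weight z * chi_hom (hom_cat E) z e))"
      unfolding sum_over_fibers[symmetric] by (simp add: sum_distrib_left Pf mult.assoc cong: sum.cong)
    also have "\<dots> = 1"
      using chi_hom_fiber_coweighting[OF e] l lf_obj[OF e] by (simp add: coweighting_def)
    finally show ?thesis .
  qed
  moreover have "(\<Sum>z\<in>bobj E. fibre_weight z * w (lf_obj P z)) = (\<Sum>b\<in>bobj B. w b * sum fibre_weight (fiber_obj E P b))"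
    unfolding sum_over_fibers[symmetric] by (simp add: sum_distrib_left Pf mult.commute cong: sum.cong)
  ultimately show ?thesis
    using euler_value_family[of "bobj E" id "bobj E" "chi_hom (hom_cat E)" "\<lambda>z. fibre_weight z * w (lf_obj P z)"
        "bobj E" id "\<lambda>z. l (lf_obj P z) * fibre_weight z"] fin by simp
qed

text \<open>Both sides are the double sum of \<open>u(x) Z\<^sub>f(x, y) u(y)\<close> over the two
  fibers, evaluated in either order. This takes the place of a biequivalence between the
  fibers.\<close>

lemma fiber_weight_arr:
  assumes f: "f \<in> barr B"
  shows "sum fibre_weight (fiber_obj E P (bsrc B f)) = sum fibre_weight (fiber_obj E P (btrg B f))"
proof -
  let ?X = "fiber_obj E P (bsrc B f)" and ?Y = "fiber_obj E P (btrg B f)"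
  have "sum fibre_weight ?X = (\<Sum>x\<in>?X. fibre_weight x * (\<Sum>y\<in>?Y. fibre_chi x y f * fibre_weight y))"
    using fibre_chi_weighting f by (intro sum.cong) (auto simp: fiber_obj_def)
  also have "\<dots> = (\<Sum>y\<in>?Y. (\<Sum>x\<in>?X. fibre_weight x * fibre_chi x y f) * fibre_weight y)"
    by (simp add: sum_distrib_left sum_distrib_right mult.assoc) (rule sum.swap)
  also have "\<dots> = sum fibre_weight ?Y"
    using fibre_chi_coweighting f by (intro sum.cong) (auto simp: fiber_obj_def)
  finally show ?thesis .
qed

lemma fiber_weight_connected:
  assumes "connected_bicat B" "b \<in> bobj B" "c \<in> bobj B"
  shows "sum fibre_weight (fiber_obj E P b) = sum fibre_weight (fiber_obj E P c)"
proof -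
  have "(\<lambda>u v. \<exists>f\<in>barr B. (bsrc B f = u \<and> btrg B f = v) \<or> (bsrc B f = v \<and> btrg B f = u))\<^sup>*\<^sup>* b c"
    using assms unfolding connected_bicat_def by blast
  then show ?thesis
    by induction (auto dest: fiber_weight_arr)
qed

section \<open>Hom-categories of the fiber bicategory\<close>

lemma category_fiber_hom:
  assumes b: "b \<in> bobj B"
  shows "category (fiber_hom E B P b x y)"
proof -
  have i: "bid2 B (bid1 B b) \<in> Hom2 B (bid1 B b) (bid1 B b)" using B.id2 B.id1 b by blast
  \<comment> \<open>\<open>fiber_hom\<close> restricts cells by their image alone; that their ends
    lie over the identity of \<open>b\<close> follows, because the image is an identity cell
    there.\<close>
  have dc: "lf_arr P (bdom E \<alpha>) = bid1 B b" "lf_arr P (bcod E \<alpha>) = bid1 B b"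
    if "\<alpha> \<in> bcell E" "lf_cell P \<alpha> = bid2 B (bid1 B b)" for \<alpha>
    using lf_cell[of \<alpha> "bdom E \<alpha>" "bcod E \<alpha>"] i that by (simp_all add: Hom2_def)
  have vc: "lf_cell P (bvcomp E \<beta> \<alpha>) = bid2 B (bid1 B b)"
    if "\<alpha> \<in> bcell E" "\<beta> \<in> bcell E" "bcod E \<alpha> = bdom E \<beta>"
      "lf_cell P \<alpha> = bid2 B (bid1 B b)" "lf_cell P \<beta> = bid2 B (bid1 B b)" for \<alpha> \<beta>
    using lf_vcomp[of \<alpha> "bdom E \<alpha>" "bcod E \<alpha>" \<beta> "bcod E \<beta>"] B.vid_left[OF i] that
    by (simp add: Hom2_def)
  show ?thesis
    using category_hom_cat[OF bicat_E, of x y] dc vc lf_id2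
    unfolding category_def fiber_hom_def hom_cat_def by simp
qed

text \<open>Objects and hom counts of \<open>fiber_hom\<close> are those of the hom-functor's fibre
  over the identity of \<open>b\<close>, so the two Euler characteristics agree by uniqueness of the
  value.\<close>

lemma chi_hom_fiber_hom:
  assumes m: "measurable_data (fiber_obj E P b) (fiber_hom E B P b)" and b: "b \<in> bobj B"
    and x: "x \<in> fiber_obj E P b" and y: "y \<in> fiber_obj E P b"
  shows "chi_hom (fiber_hom E B P b) x y = fibre_chi x y (bid1 B b)"
proof -
  let ?F = "fiber_hom E B P b x y" and ?X = "fibre_obj (hom_cat E x y) (lf_arr P) (bid1 B b)"
  have obj: "cobj ?F = ?X" by (auto simp: fiber_hom_def fibre_obj_def hom_cat_def)
  have "{m \<in> cmor ?F. cdom ?F m = g \<and> ccod ?F m = g'} =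
      hom_over (hom_cat E x y) (lf_cell P) (bid2 B (bid1 B b)) g g'" for g g'
    by (auto simp: fiber_hom_def hom_cat_def hom_over_def chom_def)
  then have zeta: "zeta_cat ?F = fibre_zeta (hom_cat E x y) (lf_cell P) (bid2 B (bid1 B b))"
    by (simp add: fun_eq_iff zeta_cat_def fibre_zeta_def)
  have "x \<in> bobj E" "y \<in> bobj E" using x y by (simp_all add: fiber_obj_def)
  then show ?thesis
    using euler_value_unique[OF measurable_dataD(2)[OF m x y category_fiber_hom[OF b]]]
      fibre_chi_euler_value obj zeta by simp
qed

lemma euler_value_fiber:
  assumes "measurable_data (fiber_obj E P b) (fiber_hom E B P b)" "b \<in> bobj B"
  shows "euler_value (fiber_obj E P b) (chi_hom (fiber_hom E B P b)) (sum fibre_weight (fiber_obj E P b))"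
proof -
  have "euler_value (fiber_obj E P b) (\<lambda>x y. fibre_chi x y (bid1 B b)) (sum fibre_weight (fiber_obj E P b))"
    using fiber_weighting finite_fiber_obj unfolding euler_value_def by blast
  moreover have "euler_value (fiber_obj E P b) (chi_hom (fiber_hom E B P b)) v \<longleftrightarrow>
      euler_value (fiber_obj E P b) (\<lambda>x y. fibre_chi x y (bid1 B b)) v" for v
    by (rule euler_value_cong) (rule chi_hom_fiber_hom[OF assms])
  ultimately show ?thesis by simp
qed

end

theorem theorem3p35:
  fixes E :: "('o1,'a1,'c1) bicat" and B :: "('o2,'a2,'c2) bicat"
    and P :: "('o1,'a1,'c1,'o2,'a2,'c2) lax_fun" and b :: 'o2
  assumes "bicategory E" and "bicategory B" and "lax_functor E B P"
    and "has_euler_bicat E" and "has_euler_bicat B"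
    and "fibered_pseudogroupoids E B P" and "cofibered_pseudogroupoids E B P"
    and "connected_bicat B"
    and "b \<in> bobj B"
    and "measurable_data (fiber_obj E P b) (fiber_hom E B P b)"
  shows "has_euler_data (fiber_obj E P b) (fiber_hom E B P b) \<and>
         chi_bicat E = chi_bicat B * chi_data (fiber_obj E P b) (fiber_hom E B P b)"
proof -
  have E: "measurable_data (bobj E) (hom_cat E)"
    and B: "measurable_data (bobj B) (hom_cat B)" "has_euler (bobj B) (bobj B) (chi_hom (hom_cat B))"
    using assms(4,5) by (auto simp: has_euler_bicat_def has_euler_data_def)
  interpret bifibered_bicat E B P
    using assms E B by unfold_locales
  have fin: "finite (bobj E)" "finite (bobj B)" using E B by (simp_all add: measurable_data_def)
  let ?U = "\<lambda>c. sum fibre_weight (fiber_obj E P c)"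
  note F = euler_value_fiber[OF assms(10,9)]
  have chi_F: "chi_data (fiber_obj E P b) (fiber_hom E B P b) = ?U b"
    using euler_value_magnitude[OF finite_fiber_obj F] by (simp add: chi_data_def)
  obtain w where w: "weighting (bobj B) (bobj B) (chi_hom (hom_cat B)) w"
    using B(2) by (auto simp: has_euler_def)
  obtain l where l: "coweighting (bobj B) (bobj B) (chi_hom (hom_cat B)) l"
    using B(2) by (auto simp: has_euler_def)
  \<comment> \<open>\<open>magnitude\<close> sums an unspecified weighting; all weightings have the
    same sum here, so \<open>w\<close> may replace it, and the same \<open>w\<close> enters the
    formula for \<open>E\<close>.\<close>
  have "euler_value (bobj B) (chi_hom (hom_cat B)) (sum w (bobj B))"
    using w l fin unfolding euler_value_def by blast
  then have chi_B: "chi_bicat B = sum w (bobj B)"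
    using euler_value_magnitude[OF fin(2)] by (simp add: chi_bicat_def chi_data_def)
  have "chi_bicat E = (\<Sum>c\<in>bobj B. w c * ?U c)"
    using euler_value_magnitude[OF fin(1) euler_value_total_bicat[OF w l]]
    by (simp add: chi_bicat_def chi_data_def)
  also have "\<dots> = chi_bicat B * ?U b"
    using fiber_weight_connected[OF assms(8) _ assms(9)]
    by (simp add: chi_B sum_distrib_right cong: sum.cong)
  finally show ?thesis
    using chi_F assms(10) euler_value_has_euler[OF finite_fiber_obj F] by (simp add: has_euler_data_def)
qed

end
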